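(* Let $D=(G,\mathcal{O},w)$ be a weighted oriented graph with $G$ connected and without $4$-cycles and $5$-cycles. Then $I(D)$ is unmixed if and only if $D$ satisfies one of: (a) $G$ is isomorphic to $C_7$ or to $T_{10}$, and every vertex of $V^{+}$ is a sink; (b) each vertex is in exactly one simplex of $D$, and no simplex of $D$ has a generating $\star$-semi-forest.
   Context: A weighted oriented graph is a triple $D=(G,\mathcal{O},w)$ with $G$ a finite simple graph with vertex set $\{x_1,\dots,x_n\}$, $\mathcal{O}$ an orientation of its edges, $w:V(G)\to\mathbb{N}$; $E(D)$ is the set of oriented edges. $V^{+}=\{x\mid w(x)>1\}$. $I(D)=(x_ix_j^{w(x_j)}\mid (x_i,x_j)\in E(D))\subseteq K[x_1,\dots,x_n]$, $K$ a field; unmixed means all associated primes have the same height. $N_D^{+}(x)=\{y\mid(x,y)\in E(D)\}$, $N_D^{-}(x)=\{y\mid(y,x)\in E(D)\}$, $N_D(x)=N_D^+(x)\cup N_D^-(x)$. A sink has $N_D^+(x)=\emptyset$, a source $N_D^-(x)=\emptyset$; standing convention: sources have weight $1$. $C_7$ is the $7$-cycle. $T_{10}$ is the graph with vertices $v,a_1,a_2,a_3,b_1,b_2,b_3,c_1,c_2,c_3$ and edges $va_i$, $a_ib_i$, $b_ic_i$ ($i=1,2,3$), $c_1c_2$, $c_2c_3$, $c_1c_3$. A vertex $v$ is simplicial if $G[N_G[v]]$ is complete; then $G[N_G[v]]$ is a simplex; a simplex of $D$ is the induced weighted oriented subgraph of $D$ on its vertex set. Weighted oriented subgraph: oriented subgraph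 of $(G,\mathcal{O})$ with restricted weights; $\deg_H(x)$ = number of neighbours in $H$. Oriented path: distinct $(y_1,\dots,y_m)$ with $(y_i,y_{i+1})\in E(D)$; oriented cycle: such a path closed by $(y_m,y_1)\in E(D)$. Unicycle oriented subgraph: weighted oriented subgraph $B$ with exactly one cycle $C$, $C$ oriented, every vertex off $C$ reached by an oriented path in $B$ from $C$, and $w(x)=1\Rightarrow\deg_B(x)=1$. ROT with parent $v$: acyclic weighted oriented subgraph $T\ni v$, every $x\ne v$ reached by an oriented path in $T$ from $v$, and $w(x)=1$ implies ($\deg_T(x)=1$, $x\ne v$) or ($V(T)=\{v\}=\{x\}$). $\star$-semi-forest: $H=(\bigcup_{i=1}^r T_i)\cup(\bigcup_{j=1}^s B_j)$, $T_i$ ROTs with parents $v_i$, $B_j$ unicycle, vertex sets partitioning $V(H)$, with $W=\{w_1,\dots,w_r\}\subseteq V(D)\setminus V(H)$, $w_i\in N_D(v_i)$ (repetitions allowed), and a partition $W_1,W_2$ of $W$ with $W_1$ stable, $W_2\subseteq V^+$, $(w_i,v_i)\in E(D)$ if $w_i\in W_2$, and $N_D^+(W_2\cup\tilde H)\cap W_1=\emptyset$, $\tilde H=\{x\in V(H)\mid\deg_H(x)\ge2\}\cup\{v_i\mid\deg_H(v_i)=1\}$. A generating $\star$-semi-forest of $K$ is a $\star$-semi-forest $H$ of $D$ with $V(H)=V(K)$. *)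

theory Defs
  imports
    "Graph_Theory.Graph_Theory"
    "HOL-Algebra.Ideal"
    "HOL-Algebra.Algebraic_Closure_Type"
    "HOL-Library.Poly_Mapping"
    "HOL-Library.Extended_Nat"
begin

section \<open>Associated primes, height, unmixed ideals\<close>

definition ring_height :: "('a, 'm) ring_scheme \<Rightarrow> 'a set \<Rightarrow> enat" where
  "ring_height R P = Sup {enat n | n. \<exists>Q :: nat \<Rightarrow> 'a set.
     (\<forall>i\<le>n. primeideal (Q i) R) \<and> (\<forall>i<n. Q i \<subset> Q (Suc i)) \<and> Q n = P}"

text \<open>The associated primes of an ideal \<open>I\<close> are those of the module \<open>R/I\<close>, that is,
  the prime ideals of the form \<open>(I : f)\<close>.\<close>

definition associated_primes :: "('a, 'm) ring_scheme \<Rightarrow> 'a set \<Rightarrow> 'a set set" where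
  "associated_primes R I =
     {P. primeideal P R \<and> (\<exists>f\<in>carrier R. P = {g \<in> carrier R. g \<otimes>\<^bsub>R\<^esub> f \<in> I})}"

definition unmixed_ideal :: "('a, 'm) ring_scheme \<Rightarrow> 'a set \<Rightarrow> bool" where
  "unmixed_ideal R I \<longleftrightarrow>
     (\<forall>P\<in>associated_primes R I. \<forall>Q\<in>associated_primes R I. ring_height R P = ring_height R Q)"


section \<open>Polynomial rings\<close>

text \<open>A polynomial is a finitely supported map from monomials to coefficients, a monomial a
  finitely supported map from variables to exponents.\<close>

type_synonym ('v, 'k) mvpoly = "('v \<Rightarrow>\<^sub>0 nat) \<Rightarrow>\<^sub>0 'k"

definition mvpoly_ring :: "'v set \<Rightarrow> ('v, 'k::field) mvpoly ring" where
  "mvpoly_ring V = ring_of_type_algebra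
     \<lparr>carrier := {p. \<forall>m\<in>Poly_Mapping.keys p. Poly_Mapping.keys m \<subseteq> V}\<rparr>"

definition mvar :: "'v \<Rightarrow> ('v, 'k::field) mvpoly" where
  "mvar x = Poly_Mapping.single (Poly_Mapping.single x 1) 1"


section \<open>Weighted oriented graphs\<close>

text \<open>The oriented graph \<open>(G, \<O>)\<close> is a digraph \<open>D\<close> whose arcs are pairs, with no loops and at most
  one of the arcs \<open>(x, y)\<close>, \<open>(y, x)\<close>; the graph \<open>G\<close> is its symmetric closure
  \<open>mk_symmetric D\<close>. The weights are kept apart in a function \<open>w\<close>, so that a weighted oriented
  subgraph is just a subgraph of \<open>D\<close>, taken with the same \<open>w\<close>.\<close>

locale weighted_oriented_graph = pair_digraph D
  for D :: "'v pair_pre_digraph" +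
  fixes w :: "'v \<Rightarrow> nat"
  assumes oriented: "(x, y) \<in> parcs D \<Longrightarrow> (y, x) \<notin> parcs D"
    and weight_pos: "x \<in> pverts D \<Longrightarrow> 1 \<le> w x"
    and source_weight: "x \<in> pverts D \<Longrightarrow> (\<And>y. (y, x) \<notin> parcs D) \<Longrightarrow> w x = 1"

definition edge_ideal :: "'v pair_pre_digraph \<Rightarrow> ('v \<Rightarrow> nat) \<Rightarrow> ('v, 'k::field) mvpoly set" where
  "edge_ideal D w = Idl\<^bsub>mvpoly_ring (pverts D)\<^esub> {mvar x * mvar y ^ w y | x y. (x, y) \<in> parcs D}"

definition V_plus :: "'v pair_pre_digraph \<Rightarrow> ('v \<Rightarrow> nat) \<Rightarrow> 'v set" where
  "V_plus D w = {x \<in> pverts D. 1 < w x}"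

definition out_nbrs :: "'v pair_pre_digraph \<Rightarrow> 'v \<Rightarrow> 'v set" where
  "out_nbrs D x = {y. (x, y) \<in> parcs D}"

definition in_nbrs :: "'v pair_pre_digraph \<Rightarrow> 'v \<Rightarrow> 'v set" where
  "in_nbrs D x = {y. (y, x) \<in> parcs D}"

definition nbrs :: "'v pair_pre_digraph \<Rightarrow> 'v \<Rightarrow> 'v set" where
  "nbrs D x = out_nbrs D x \<union> in_nbrs D x"

definition deg :: "'v pair_pre_digraph \<Rightarrow> 'v \<Rightarrow> nat" where
  "deg D x = card (nbrs D x)"

definition is_sink :: "'v pair_pre_digraph \<Rightarrow> 'v \<Rightarrow> bool" where
  "is_sink D x \<longleftrightarrow> out_nbrs D x = {}"

definition stable_set :: "'v pair_pre_digraph \<Rightarrow> 'v set \<Rightarrow> bool" where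
  "stable_set D S \<longleftrightarrow> (\<forall>x\<in>S. \<forall>y\<in>S. (x, y) \<notin> parcs D)"


section \<open>Cycles and isomorphism types of the underlying graph\<close>

text \<open>A cycle of the underlying graph, not necessarily induced, given by its list of (directed) edges.
  The bound on the length excludes going back and forth along one edge, which is a directed cycle
  of the symmetric closure.\<close>

definition ucycle :: "'v pair_pre_digraph \<Rightarrow> ('v \<times> 'v) list \<Rightarrow> bool" where
  "ucycle D p \<longleftrightarrow> pre_digraph.cycle (with_proj (mk_symmetric (with_proj D))) p \<and> 3 \<le> length p"

definition uedges :: "('v \<times> 'v) list \<Rightarrow> 'v set set" where
  "uedges p = (\<lambda>(x, y). {x, y}) ` set p"

definition C7 :: "nat pair_pre_digraph" where
  "C7 = mk_symmetric (with_proj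
     \<lparr>pverts = {0..<7}, parcs = {(i, (i + 1) mod 7) | i. i < 7}\<rparr>)"

datatype T10_vertex = T10_v | T10_a nat | T10_b nat | T10_c nat

definition T10 :: "T10_vertex pair_pre_digraph" where
  "T10 = mk_symmetric (with_proj
     \<lparr>pverts = {T10_v} \<union> T10_a ` {1, 2, 3} \<union> T10_b ` {1, 2, 3} \<union> T10_c ` {1, 2, 3},
      parcs = {(T10_v, T10_a i) | i. i \<in> {1, 2, 3}} \<union> {(T10_a i, T10_b i) | i. i \<in> {1, 2, 3}}
        \<union> {(T10_b i, T10_c i) | i. i \<in> {1, 2, 3}}
        \<union> {(T10_c 1, T10_c 2), (T10_c 2, T10_c 3), (T10_c 1, T10_c 3)}\<rparr>)"

definition underlying_iso :: "'v pair_pre_digraph \<Rightarrow> 'u pair_pre_digraph \<Rightarrow> bool" where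
  "underlying_iso D G \<longleftrightarrow> digraph_iso (with_proj (mk_symmetric (with_proj D))) (with_proj G)"


section \<open>Simplices\<close>

definition closed_nbrs :: "'v pair_pre_digraph \<Rightarrow> 'v \<Rightarrow> 'v set" where
  "closed_nbrs D x = insert x (nbrs D x)"

definition simplicial :: "'v pair_pre_digraph \<Rightarrow> 'v \<Rightarrow> bool" where
  "simplicial D x \<longleftrightarrow> x \<in> pverts D \<and>
     (\<exists>n. complete_digraph n
       (induce_subgraph (with_proj (mk_symmetric (with_proj D))) (closed_nbrs D x)))"

definition simplex_of :: "'v pair_pre_digraph \<Rightarrow> 'v pair_pre_digraph \<Rightarrow> bool" where
  "simplex_of D K \<longleftrightarrow> induced_subgraph (with_proj K) (with_proj D) \<and>
     (\<exists>x. simplicial D x \<and> pverts K = closed_nbrs D x)"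


section \<open>Generating \<open>\<star>\<close>-semi-forests\<close>

text \<open>That \<open>B\<close> has exactly one cycle \<open>C\<close>, and that \<open>C\<close> is oriented, is expressed by a directed cycle
  \<open>c\<close> of \<open>B\<close> such that every cycle of the underlying graph of \<open>B\<close> has the same edges as \<open>c\<close>. The
  vertices of \<open>c\<close> are the tails of its arcs.\<close>

definition unicycle :: "'v pair_pre_digraph \<Rightarrow> ('v \<Rightarrow> nat) \<Rightarrow> 'v pair_pre_digraph \<Rightarrow> bool" where
  "unicycle D w B \<longleftrightarrow> subgraph (with_proj B) (with_proj D) \<and>
     (\<exists>c. pre_digraph.cycle (with_proj B) c \<and>
        (\<forall>p. ucycle B p \<longrightarrow> uedges p = uedges c) \<and>
        (\<forall>x\<in>pverts B - fst ` set c. \<exists>y\<in>fst ` set c. \<exists>p. pre_digraph.apath (with_proj B) y p x)) \<and>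
     (\<forall>x\<in>pverts B. w x = 1 \<longrightarrow> deg B x = 1)"

definition ROT :: "'v pair_pre_digraph \<Rightarrow> ('v \<Rightarrow> nat) \<Rightarrow> 'v pair_pre_digraph \<Rightarrow> 'v \<Rightarrow> bool" where
  "ROT D w T v \<longleftrightarrow> subgraph (with_proj T) (with_proj D) \<and> v \<in> pverts T \<and>
     (\<nexists>p. ucycle T p) \<and>
     (\<forall>x\<in>pverts T. x \<noteq> v \<longrightarrow> (\<exists>p. pre_digraph.apath (with_proj T) v p x)) \<and>
     (\<forall>x\<in>pverts T. w x = 1 \<longrightarrow> (deg T x = 1 \<and> x \<noteq> v) \<or> (pverts T = {v} \<and> x = v))"

text \<open>The indices run from \<open>0\<close>: the trees are \<open>T 0, \<dots>, T (r - 1)\<close> with parents \<open>v i\<close> and attached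
  vertices \<open>u i\<close> (the \<open>w\<^sub>i\<close> of the literature), the unicycle subgraphs \<open>B 0, \<dots>, B (s - 1)\<close>.
  Either family may be empty.\<close>

definition star_semi_forest ::
    "'v pair_pre_digraph \<Rightarrow> ('v \<Rightarrow> nat) \<Rightarrow> 'v pair_pre_digraph \<Rightarrow> bool" where
  "star_semi_forest D w H \<longleftrightarrow> subgraph (with_proj H) (with_proj D) \<and>
     (\<exists>(r::nat) (s::nat) T v u B W1 W2.
        (\<forall>i<r. ROT D w (T i) (v i)) \<and>
        (\<forall>j<s. unicycle D w (B j)) \<and>
        pverts H = (\<Union>i<r. pverts (T i)) \<union> (\<Union>j<s. pverts (B j)) \<and>
        parcs H = (\<Union>i<r. parcs (T i)) \<union> (\<Union>j<s. parcs (B j)) \<and>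
        (\<forall>i<r. \<forall>i'<r. i \<noteq> i' \<longrightarrow> pverts (T i) \<inter> pverts (T i') = {}) \<and>
        (\<forall>j<s. \<forall>j'<s. j \<noteq> j' \<longrightarrow> pverts (B j) \<inter> pverts (B j') = {}) \<and>
        (\<forall>i<r. \<forall>j<s. pverts (T i) \<inter> pverts (B j) = {}) \<and>
        (\<forall>i<r. u i \<in> pverts D - pverts H \<and> u i \<in> nbrs D (v i)) \<and>
        u ` {..<r} = W1 \<union> W2 \<and> W1 \<inter> W2 = {} \<and>
        stable_set D W1 \<and>
        W2 \<subseteq> V_plus D w \<and>
        (\<forall>i<r. u i \<in> W2 \<longrightarrow> (u i, v i) \<in> parcs D) \<and>
        (let H' = {x \<in> pverts H. 2 \<le> deg H x} \<union> {v i | i. i < r \<and> deg H (v i) = 1}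
         in (\<Union>x\<in>W2 \<union> H'. out_nbrs D x) \<inter> W1 = {}))"

definition generating_star_semi_forest ::
    "'v pair_pre_digraph \<Rightarrow> ('v \<Rightarrow> nat) \<Rightarrow> 'v pair_pre_digraph \<Rightarrow> 'v pair_pre_digraph \<Rightarrow> bool" where
  "generating_star_semi_forest D w K H \<longleftrightarrow> star_semi_forest D w H \<and> pverts H = pverts K"

end

theory Submission
  imports Defs
begin

text \<open>The edge ideal is the intersection, over the strong vertex covers \<open>C\<close>, of the ideals generated by
  the powers of the variables in \<open>C\<close> with exponent \<open>w x\<close> if \<open>N\<^sup>+(x) \<subseteq> C\<close> and \<open>1\<close> otherwise, so it is
  unmixed iff all strong covers have the same size. Complements of maximal stable sets are strong
  covers; hence the graph is then well-covered and every strong cover is minimal. An exchange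
  argument with stable sets shows that in a well-covered connected graph without 4-cycles and
  5-cycles every vertex lies in a simplex unless the graph is \<open>C\<^sub>7\<close> or \<open>T\<^sub>1\<^sub>0\<close>. If the simplices
  partition the vertices, all strong covers have the same size iff none contains a simplex, and the
  simplices contained in strong covers are exactly those with a generating semi-forest. On \<open>C\<^sub>7\<close> and
  \<open>T\<^sub>1\<^sub>0\<close>, a vertex of weight above 1 which is not a sink gives a strong cover that is not minimal.\<close>

section \<open>Well-covered graphs without 4-cycles and 5-cycles\<close>

text \<open>The obstacle in the exchange argument is to find maximal stable sets in which two
  non-adjacent neighbours of a member \<open>v\<close> see nothing but \<open>v\<close>: exchanging
  \<open>v\<close> for both then enlarges the set. Without 4-cycles and 5-cycles, the parts of the
  second neighbourhood of \<open>v\<close> behind different neighbours are disjoint and not joined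
  by edges, so vertices dominating them can be chosen almost independently. What obstructs a choice
  is a family of edges between vertices at distance 3 from \<open>v\<close>. On an edge with the
  fewest vertices behind it this family is a perfect matching, and that forces the number of
  vertices behind the edge to be 1. The matching then closes induced heptagons, from which C_7 and
  T_10 are grown. Heights of primes are bounded by counting: a long chain of primes would produce
  linearly independent families that grow faster than the number of monomials available. A complete
  graph on four vertices contains a 4-cycle, so a simplex has at most three vertices; a semi-forest
  on a simplex inside a strong cover is then found among a few shapes.\<close>

locale sgraph =
  fixes V :: "'a set" and E :: "'a \<Rightarrow> 'a \<Rightarrow> bool"
  assumes finite_V: "finite V"
    and E_sym: "E x y \<Longrightarrow> E y x"
    and E_irrefl: "\<not> E x x"
    and E_V: "E x y \<Longrightarrow> x \<in> V"
begin

definition stable :: "'a set \<Rightarrow> bool" where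
  "stable S \<longleftrightarrow> S \<subseteq> V \<and> (\<forall>x\<in>S. \<forall>y\<in>S. \<not> E x y)"

definition max_stable :: "'a set \<Rightarrow> bool" where
  "max_stable S \<longleftrightarrow> stable S \<and> (\<forall>x\<in>V - S. \<exists>y\<in>S. E x y)"

definition well_covered :: bool where
  "well_covered \<longleftrightarrow> (\<forall>S T. max_stable S \<longrightarrow> max_stable T \<longrightarrow> card S = card T)"

definition nb :: "'a \<Rightarrow> 'a set" where
  "nb x = {y. E x y}"

text \<open>For an edge \<open>E x y\<close> this is the part of the second neighbourhood of
  \<open>x\<close> that is reached through \<open>y\<close>.\<close>

definition beyond :: "'a \<Rightarrow> 'a \<Rightarrow> 'a set" where
  "beyond x y = {z. E y z \<and> z \<noteq> x \<and> \<not> E x z}"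

definition simplicial_vertex :: "'a \<Rightarrow> bool" where
  "simplicial_vertex s \<longleftrightarrow> s \<in> V \<and> (\<forall>x\<in>nb s. \<forall>y\<in>nb s. x \<noteq> y \<longrightarrow> E x y)"

definition in_simplex :: "'a \<Rightarrow> bool" where
  "in_simplex x \<longleftrightarrow> (\<exists>s. simplicial_vertex s \<and> x \<in> insert s (nb s))"

lemma E_V2: "E x y \<Longrightarrow> y \<in> V"
  using E_sym E_V by blast

lemma finite_stable: "stable S \<Longrightarrow> finite S"
  using finite_V finite_subset stable_def by auto

lemma nb_iff [simp]: "y \<in> nb x \<longleftrightarrow> E x y"
  by (simp add: nb_def)

lemma finite_nb [simp]: "finite (nb x)"
  using finite_V E_V2 by (auto intro: finite_subset[of _ V] simp: nb_def)

lemma beyond_iff: "z \<in> beyond x y \<longleftrightarrow> E y z \<and> z \<noteq> x \<and> \<not> E x z"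
  by (simp add: beyond_def)

lemma finite_beyond [simp]: "finite (beyond x y)"
  by (rule finite_subset[OF _ finite_nb[of y]]) (auto simp: beyond_def)

lemma stable_insert:
  assumes "stable S" "x \<in> V" "\<And>s. s \<in> S \<Longrightarrow> \<not> E s x"
  shows "stable (insert x S)"
  unfolding stable_def
proof (intro conjI ballI)
  show "insert x S \<subseteq> V" using assms by (simp add: stable_def)
  fix a b assume "a \<in> insert x S" "b \<in> insert x S"
  then show "\<not> E a b"
    using assms(3)[of a] assms(3)[of b] assms(1) E_irrefl[of x] E_sym[of a b]
    unfolding stable_def by blast
qed

text \<open>Maximality is relative to a set \<open>U\<close>, because the exchange arguments extend
  stable sets only outside prescribed neighbourhoods and check domination of the rest by
  hand.\<close>

lemma stable_extend:
  assumes "stable S" "S \<subseteq> U" "U \<subseteq> V"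
  obtains M where "S \<subseteq> M" "M \<subseteq> U" "stable M" "\<And>x. x \<in> U \<Longrightarrow> x \<notin> M \<Longrightarrow> \<exists>y\<in>M. E x y"
proof -
  let ?F = "{M. S \<subseteq> M \<and> M \<subseteq> U \<and> stable M}"
  have fin: "finite ?F"
    by (rule finite_subset[of _ "Pow V"]) (use finite_V assms in auto)
  have "S \<in> ?F" using assms by auto
  from finite_has_maximal2[OF fin this]
  obtain M where M: "M \<in> ?F" and max: "\<And>M'. M' \<in> ?F \<Longrightarrow> M \<subseteq> M' \<Longrightarrow> M = M'"
    by auto
  have "\<exists>y\<in>M. E x y" if "x \<in> U" "x \<notin> M" for x
  proof (rule ccontr)
    assume "\<not> (\<exists>y\<in>M. E x y)"
    then have "stable (insert x M)"
      using M that assms(3) E_sym by (intro stable_insert) auto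
    then have "insert x M \<in> ?F" using M that by auto
    with max[of "insert x M"] that show False by auto
  qed
  with M that show ?thesis by blast
qed

lemma stable_card_le:
  assumes wc: well_covered and M: "max_stable M" and S: "stable S"
  shows "card S \<le> card M"
proof -
  obtain M' where M': "S \<subseteq> M'" "M' \<subseteq> V" "stable M'" "\<And>x. x \<in> V \<Longrightarrow> x \<notin> M' \<Longrightarrow> \<exists>y\<in>M'. E x y"
    using stable_extend[of S V] S by (auto simp: stable_def)
  then have "max_stable M'" by (auto simp: max_stable_def)
  then have "card M' = card M" using wc M unfolding well_covered_def by blast
  moreover have "card S \<le> card M'"
    using M'(1) finite_stable[OF M'(3)] by (rule card_mono[rotated])
  ultimately show ?thesis by simp
qed

text \<open>Exchanging \<open>v\<close> for two non-adjacent neighbours that no member of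
  \<open>S\<close> sees would give a stable set larger than a maximal one. Most uses of
  well-coveredness below are this exchange.\<close>

lemma undominated_nbs_clique:
  assumes wc: well_covered and M: "max_stable (insert v S)" "v \<notin> S"
    and y: "E v y" "\<And>s. s \<in> S \<Longrightarrow> \<not> E s y" and z: "E v z" "\<And>s. s \<in> S \<Longrightarrow> \<not> E s z"
    and "y \<noteq> z"
  shows "E y z"
proof (rule ccontr)
  assume yz: "\<not> E y z"
  have st: "stable (insert v S)" using M by (simp add: max_stable_def)
  then have fin: "finite S" using finite_stable by fastforce
  have "y \<notin> S" "z \<notin> S"
    using st y z by (auto simp: stable_def)
  have "stable (insert y (insert z S))"
  proof (intro stable_insert)
    show "stable S" using st by (auto simp: stable_def)
    show "z \<in> V" "y \<in> V" using y z E_V2 by auto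
    show "\<not> E s z" if "s \<in> S" for s using that z by auto
    show "\<not> E s y" if "s \<in> insert z S" for s using that y yz E_sym by blast
  qed
  from stable_card_le[OF wc M(1) this] show False
    using \<open>y \<notin> S\<close> \<open>z \<notin> S\<close> \<open>y \<noteq> z\<close> M(2) fin by simp
qed

text \<open>If the two simplicial vertices are equal or adjacent, each closed neighbourhood contains
  the other. Otherwise take a maximal stable set through \<open>x\<close>: its other members are
  adjacent to neither \<open>s\<close> nor \<open>t\<close>, since every neighbour of
  \<open>s\<close> or \<open>t\<close> is \<open>x\<close> or adjacent to \<open>x\<close>.
  Exchanging \<open>x\<close> for \<open>s\<close> and \<open>t\<close> is then a
  contradiction.\<close>

lemma simplices_agree:
  assumes wc: well_covered and s: "simplicial_vertex s" and t: "simplicial_vertex t"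
    and x: "x \<in> insert s (nb s)" "x \<in> insert t (nb t)"
  shows "insert s (nb s) = insert t (nb t)"
proof (cases "s = t \<or> E s t")
  case True
  have *: "insert a (nb a) \<subseteq> insert b (nb b)" if "simplicial_vertex a" "E a b" for a b
  proof
    fix c assume "c \<in> insert a (nb a)"
    then show "c \<in> insert b (nb b)"
      using that E_sym[of a b] unfolding simplicial_vertex_def by (cases "c = b") auto
  qed
  from True show ?thesis using *[OF s] *[OF t] E_sym by blast
next
  case False
  have st: "s \<noteq> t" "\<not> E s t" using False by auto
  then have xs: "E s x" "E t x" "x \<noteq> s" "x \<noteq> t" using x E_sym by auto
  obtain M where M: "{x} \<subseteq> M" "M \<subseteq> V" "stable M" "\<And>z. z \<in> V \<Longrightarrow> z \<notin> M \<Longrightarrow> \<exists>y\<in>M. E z y"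
    using stable_extend[of "{x}" V] xs(1) E_V2[of s x] E_irrefl[of x] unfolding stable_def by blast
  have max: "max_stable (insert x (M - {x}))"
    using M by (auto simp: max_stable_def insert_absorb)
  have nos: "\<not> E m a" if "m \<in> M - {x}" "simplicial_vertex a" "E a x" for a m
  proof
    assume "E m a"
    then have "E m x" using that unfolding simplicial_vertex_def by (metis DiffD2 E_sym nb_iff singletonI)
    then show False using M that by (auto simp: stable_def)
  qed
  have "E s t"
    by (rule undominated_nbs_clique[OF wc max]) (use nos s t xs st E_sym in auto)
  with st show ?thesis by simp
qed

end

section \<open>Second neighbourhoods in graphs without 4-cycles and 5-cycles\<close>

locale sgraph45 = sgraph +
  assumes no_C4: "\<lbrakk>E a b; E b c; E c d; E d a; a \<noteq> c; b \<noteq> d\<rbrakk> \<Longrightarrow> False"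
    and no_C5: "\<lbrakk>E a b; E b c; E c d; E d e; E e a; distinct [a, b, c, d, e]\<rbrakk> \<Longrightarrow> False"
begin

text \<open>A common vertex \<open>t\<close> closes the 4-cycle v, y, t, z.\<close>

lemma beyond_disjoint:
  assumes "E v y" "E v z" "t \<in> beyond v y" "t \<in> beyond v z"
  shows "y = z"
  using assms no_C4[of v y t z] by (auto simp: beyond_iff E_sym)

text \<open>Such an edge closes the 5-cycle v, y, t, u, z.\<close>

lemma beyond_no_edge:
  assumes "E v y" "E v z" "t \<in> beyond v y" "u \<in> beyond v z" "y \<noteq> z"
  shows "\<not> E t u"
proof
  assume "E t u"
  moreover have "t \<noteq> y" "t \<noteq> z" "u \<noteq> y" "u \<noteq> z" "t \<noteq> u" "v \<noteq> y" "v \<noteq> z"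
    using assms \<open>E t u\<close> E_irrefl by (auto simp: beyond_iff)
  ultimately show False
    using assms no_C5[of v y t u z] by (auto simp: beyond_iff E_sym)
qed

text \<open>Together these facts place \<open>r\<close> at distance exactly 3 from \<open>v\<close>:
  an edge to \<open>v\<close> closes the 4-cycle v, y, t, r, and an edge to a neighbour
  \<open>u\<close> of \<open>v\<close> is excluded by \<open>beyond_no_edge\<close>.\<close>

lemma beyond_far:
  assumes "E v y" "t \<in> beyond v y" "r \<in> beyond y t"
  shows "r \<noteq> v" "\<not> E v r" "E v u \<Longrightarrow> r \<notin> beyond v u" "E v u \<Longrightarrow> \<not> E r u" "r \<noteq> t" "r \<noteq> y"
proof -
  show v: "r \<noteq> v" using assms by (auto simp: beyond_iff E_sym)
  have tr: "E t r" "\<not> E y r" "r \<noteq> y" "E y t" "t \<noteq> v" "\<not> E v t" using assms by (auto simp: beyond_iff)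
  show vr: "\<not> E v r"
    using no_C4[of v y t r] tr assms(1) by (auto simp: E_sym)
  show u: "r \<notin> beyond v u" if "E v u" for u
    using beyond_no_edge[OF assms(1) that assms(2)] tr by (auto simp: beyond_iff)
  show "\<not> E r u" if "E v u" for u
    using u[OF that] v vr by (auto simp: beyond_iff E_sym)
  show "r \<noteq> t" "r \<noteq> y" using tr E_irrefl by auto
qed

text \<open>The neighbours of \<open>z\<close> are then \<open>v\<close> and common neighbours of
  \<open>v\<close> and \<open>z\<close>. Two common neighbours would form a 4-cycle with
  \<open>v\<close> and \<open>z\<close>, so the closed neighbourhood of \<open>z\<close> is an edge
  or a triangle.\<close>

lemma nb_of_nb_subset_simplicial:
  assumes "E v z" "beyond v z = {}"
  shows "simplicial_vertex z"
  unfolding simplicial_vertex_def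
proof (intro conjI ballI impI)
  show "z \<in> V" using assms E_V2 by blast
  fix x y assume "x \<in> nb z" "y \<in> nb z" "x \<noteq> y"
  then have "E z x" "E z y" "x = v \<or> E v x" "y = v \<or> E v y"
    using assms by (auto simp: beyond_def)
  moreover have "v \<noteq> z" using assms(1) E_irrefl by auto
  moreover have False if "E v x" "E v y"
    using no_C4[of v x z y] that calculation \<open>x \<noteq> y\<close> E_sym by blast
  ultimately show "E x y"
    using \<open>x \<noteq> y\<close> E_sym by blast
qed

text \<open>Suppose \<open>y\<close> lies in the simplex of \<open>s\<close>. Behind each neighbour
  of \<open>v\<close> outside the closed neighbourhood of \<open>y\<close> one vertex is chosen. A
  maximal stable set with \<open>y\<close> and all chosen vertices contains no neighbour of
  \<open>v\<close> except \<open>y\<close>, and no neighbour of \<open>s\<close> except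
  \<open>y\<close>. The exchange of \<open>y\<close> for \<open>v\<close> and \<open>s\<close> makes
  \<open>v\<close> adjacent to \<open>s\<close>, hence a member of the simplex.\<close>

lemma bad_nb:
  assumes wc: well_covered and vV: "v \<in> V" and bad: "\<not> in_simplex v" and "E v y"
  shows "\<not> in_simplex y"
proof
  assume "in_simplex y"
  then obtain s where s: "simplicial_vertex s" "y = s \<or> E s y" by (auto simp: in_simplex_def)
  have ne: "beyond v z \<noteq> {}" if "E v z" for z
    using nb_of_nb_subset_simplicial[OF that] bad that E_sym by (auto simp: in_simplex_def)
  have "\<not> E s v" "s \<noteq> v" using bad s by (auto simp: in_simplex_def)
  then have sy: "E s y" using s assms(4) E_sym by auto
  define f where "f z = (SOME t. t \<in> beyond v z)" for z
  have f: "f z \<in> beyond v z" if "E v z" for z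
    using ne[OF that] by (auto simp: f_def some_in_eq)
  define S where "S = f ` (nb v - nb y - {y})"
  have S: "\<exists>z. a = f z \<and> E v z \<and> \<not> E y z \<and> z \<noteq> y \<and> a \<in> beyond v z" if "a \<in> S" for a
    using that f by (auto simp: S_def)
  have "stable S"
    unfolding stable_def
  proof (intro conjI ballI subsetI)
    fix a assume "a \<in> S" then show "a \<in> V" using S[of a] E_V2 by (auto simp: beyond_iff)
    fix b assume "b \<in> S"
    then show "\<not> E a b" using S[of a] S[of b] \<open>a \<in> S\<close> beyond_no_edge E_irrefl by metis
  qed
  let ?U = "V - {y} - nb y"
  have "S \<subseteq> ?U"
  proof
    fix a assume a: "a \<in> S"
    then obtain z where z: "E v z" "\<not> E y z" "z \<noteq> y" "a \<in> beyond v z" using S by blast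
    then have "a \<noteq> y" using assms(4) by (auto simp: beyond_iff)
    moreover have "\<not> E y a"
      using z beyond_disjoint[OF assms(4) z(1), of a] by (auto simp: beyond_iff)
    moreover have "a \<in> V" using z E_V2 by (auto simp: beyond_iff)
    ultimately show "a \<in> ?U" by auto
  qed
  then obtain M where M: "S \<subseteq> M" "M \<subseteq> ?U" "stable M" "\<And>x. x \<in> ?U \<Longrightarrow> x \<notin> M \<Longrightarrow> \<exists>y\<in>M. E x y"
    using stable_extend[of S ?U] \<open>stable S\<close> by blast
  have max: "max_stable (insert y M)"
    unfolding max_stable_def
  proof (intro conjI ballI)
    show "stable (insert y M)"
      using M E_V2[OF assms(4)] E_sym by (intro stable_insert) auto
    fix x assume x: "x \<in> V - insert y M"
    show "\<exists>y\<in>insert y M. E x y"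
      using M(4)[of x] x E_sym[of y x] by auto
  qed
  have "E v s"
  proof (rule undominated_nbs_clique[OF wc max])
    show "y \<notin> M" using M by auto
    show "E y v" "E y s" "v \<noteq> s" using assms(4) sy E_sym \<open>s \<noteq> v\<close> by auto
    show "\<not> E m s" if "m \<in> M" for m
    proof
      assume "E m s"
      then have "m = y \<or> E y m" using s sy unfolding simplicial_vertex_def by (metis E_sym nb_iff)
      then show False using M that by auto
    qed
    show "\<not> E m v" if "m \<in> M" for m
    proof
      assume "E m v"
      then have "E v m" "\<not> E y m" "m \<noteq> y" using that M E_sym by auto
      then have "f m \<in> M" "E m (f m)" using f M S_def by (auto simp: beyond_iff)
      then show False using M that by (auto simp: stable_def)
    qed
  qed
  then show False using \<open>\<not> E s v\<close> E_sym by blast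
qed

text \<open>The room left for a stable set that contains \<open>v\<close> and in which
  \<open>y\<close> and \<open>z\<close> see nothing but \<open>v\<close>.\<close>

definition remote :: "'a \<Rightarrow> 'a \<Rightarrow> 'a \<Rightarrow> 'a set" where
  "remote v y z = V - insert v (nb v) - beyond v y - beyond v z"

lemma remote_not_adjacent:
  assumes "m \<in> remote v y z"
  shows "\<not> E v m" "m \<noteq> v" "\<not> E m y" "\<not> E m z" "\<not> E m v" "m \<in> V"
  using assms E_sym by (auto simp: remote_def beyond_iff)

lemma beyond_beyond_remote:
  assumes "E v y" "E v z" "r \<in> beyond u t" "t \<in> beyond v u" "E v u"
  shows "r \<in> remote v y z"
  using beyond_far[OF assms(5,4,3)] assms E_V2 by (auto simp: remote_def beyond_iff)

text \<open>A maximal extension of \<open>S\<close> inside \<open>remote v y z\<close> becomes a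
  maximal stable set of the graph once \<open>v\<close> is added, since \<open>S\<close> dominates
  the two parts that were removed. It sees neither \<open>y\<close> nor \<open>z\<close>, so
  \<open>v\<close> can be exchanged.\<close>

lemma dominated_pair_adjacent:
  assumes wc: well_covered and y: "E v y" and z: "E v z" and "y \<noteq> z"
    and S: "stable S" "S \<subseteq> remote v y z"
    and dom: "\<And>t. t \<in> beyond v y \<union> beyond v z \<Longrightarrow> \<exists>s\<in>S. E t s"
  shows "E y z"
proof -
  obtain M where M: "S \<subseteq> M" "M \<subseteq> remote v y z" "stable M"
      "\<And>x. x \<in> remote v y z \<Longrightarrow> x \<notin> M \<Longrightarrow> \<exists>y\<in>M. E x y"
    by (rule stable_extend[OF S]) (auto simp: remote_def)
  have far: "\<not> E m y" "\<not> E m z" "m \<noteq> v" "\<not> E m v" if "m \<in> M" for m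
    using remote_not_adjacent[OF subsetD[OF M(2) that]] by auto
  have max: "max_stable (insert v M)"
    unfolding max_stable_def
  proof (intro conjI ballI)
    show "stable (insert v M)"
      using M(3) far E_V[OF y] by (intro stable_insert) auto
    fix x assume x: "x \<in> V - insert v M"
    show "\<exists>y\<in>insert v M. E x y"
    proof (cases "x \<in> remote v y z \<or> E v x")
      case True then show ?thesis using M(4) x E_sym by blast
    next
      case False
      then have "x \<in> beyond v y \<union> beyond v z" using x by (auto simp: remote_def)
      then show ?thesis using dom M(1) by blast
    qed
  qed
  show ?thesis
    by (rule undominated_nbs_clique[OF wc max _ y _ z]) (use far \<open>y \<noteq> z\<close> in auto)
qed

text \<open>The image of \<open>f\<close> is stable and dominates \<open>beyond v y\<close>. If each
  vertex \<open>u\<close> of \<open>beyond v z\<close> missed by it had a neighbour in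
  \<open>beyond z u\<close> not adjacent to the image, these neighbours could be added, the result
  would dominate \<open>beyond v z\<close> as well, and \<open>y\<close> and \<open>z\<close> would
  be adjacent. So some \<open>u\<close> is blocked.\<close>

lemma blocked:
  assumes wc: well_covered and y: "E v y" and z: "E v z" and yz: "y \<noteq> z" "\<not> E y z"
    and f: "\<And>t. t \<in> beyond v y \<Longrightarrow> f t \<in> beyond y t"
  shows "\<exists>u\<in>beyond v z. (\<forall>t\<in>beyond v y. \<not> E (f t) u) \<and>
    (\<forall>r\<in>beyond z u. \<exists>t\<in>beyond v y. E r (f t))"
proof (rule ccontr)
  assume neg: "\<not> ?thesis"
  have H: "\<exists>r\<in>beyond z u. \<forall>t\<in>beyond v y. \<not> E r (f t)"
    if "u \<in> beyond v z" "\<And>t. t \<in> beyond v y \<Longrightarrow> \<not> E (f t) u" for u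
    using neg that by blast
  define g where "g u = (SOME r. r \<in> beyond z u \<and> (\<forall>t\<in>beyond v y. \<not> E r (f t)))" for u
  define B where "B = {u \<in> beyond v z. \<forall>t\<in>beyond v y. \<not> E (f t) u}"
  have g: "g u \<in> beyond z u" "\<And>t. t \<in> beyond v y \<Longrightarrow> \<not> E (g u) (f t)" if "u \<in> B" for u
  proof -
    have "\<exists>r. r \<in> beyond z u \<and> (\<forall>t\<in>beyond v y. \<not> E r (f t))"
      using H[of u] that unfolding B_def by blast
    from someI_ex[OF this] show "g u \<in> beyond z u" "\<And>t. t \<in> beyond v y \<Longrightarrow> \<not> E (g u) (f t)"
      unfolding g_def by auto
  qed
  have B: "u \<in> beyond v z" if "u \<in> B" for u using that by (simp add: B_def)
  let ?S = "f ` beyond v y \<union> g ` B"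
  have sub: "?S \<subseteq> remote v y z"
    using beyond_beyond_remote[OF y z f _ y] beyond_beyond_remote[OF y z g(1) B z] by blast
  have ff: "\<not> E (f t) (f t')" if "t \<in> beyond v y" "t' \<in> beyond v y" for t t'
  proof (cases "t = t'")
    case False
    then show ?thesis
      using beyond_no_edge[OF _ _ f[OF that(1)] f[OF that(2)]] that by (auto simp: beyond_iff)
  qed (simp add: E_irrefl)
  have gg: "\<not> E (g t) (g t')" if "t \<in> B" "t' \<in> B" for t t'
  proof (cases "t = t'")
    case False
    then show ?thesis
      using beyond_no_edge[OF _ _ g(1)[OF that(1)] g(1)[OF that(2)]] B[OF that(1)] B[OF that(2)]
      by (auto simp: beyond_iff)
  qed (simp add: E_irrefl)
  have gf: "\<not> E (g u) (f t)" "\<not> E (f t) (g u)" if "u \<in> B" "t \<in> beyond v y" for u t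
    using g(2)[OF that] E_sym by blast+
  have "stable ?S"
    unfolding stable_def using ff gg gf sub remote_not_adjacent(6) by blast
  moreover have "\<exists>s\<in>?S. E t s" if "t \<in> beyond v y \<union> beyond v z" for t
  proof (cases "t \<in> beyond v y")
    case True then show ?thesis using f[OF True] by (auto simp: beyond_iff)
  next
    case False
    then have t: "t \<in> beyond v z" using that by simp
    show ?thesis
    proof (cases "t \<in> B")
      case True then show ?thesis using g(1)[OF True] by (auto simp: beyond_iff)
    next
      case False
      then obtain t' where "t' \<in> beyond v y" "E (f t') t" using t by (auto simp: B_def)
      then show ?thesis using E_sym by blast
    qed
  qed
  ultimately have "E y z"
    by (rule dominated_pair_adjacent[OF wc y z yz(1) _ sub])
  with yz show False by simp
qed

text \<open>Two maximal stable sets with a common part \<open>M\<close> containing \<open>S\<close>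
  are compared. One adds \<open>v\<close> and a maximal stable set \<open>I\<close> of those
  vertices of \<open>beyond v z\<close> that \<open>M\<close> does not dominate; the other adds
  \<open>y\<close> and \<open>z\<close>. Equal sizes give \<open>card I = 1\<close>, so two
  non-adjacent survivors are impossible.\<close>

lemma two_survivors_adjacent:
  assumes wc: well_covered and y: "E v y" and z: "E v z" and yz: "y \<noteq> z" "\<not> E y z"
    and S: "stable S" "S \<subseteq> remote v y z"
    and dom: "\<And>t. t \<in> beyond v y \<Longrightarrow> \<exists>s\<in>S. E t s"
    and u: "u1 \<in> beyond v z" "u2 \<in> beyond v z" "u1 \<noteq> u2"
    and blk: "\<And>r. r \<in> beyond z u1 \<union> beyond z u2 \<Longrightarrow> \<exists>s\<in>S. E r s"
  shows "E u1 u2"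
proof (rule ccontr)
  assume u12: "\<not> E u1 u2"
  obtain M where M: "S \<subseteq> M" "M \<subseteq> remote v y z" "stable M"
      "\<And>x. x \<in> remote v y z \<Longrightarrow> x \<notin> M \<Longrightarrow> \<exists>y\<in>M. E x y"
    by (rule stable_extend[OF S]) (auto simp: remote_def)
  have alive: "\<not> E m u" if "m \<in> M" "u \<in> {u1, u2}" for m u
  proof
    assume "E m u"
    have r: "m \<in> remote v y z" using that M by auto
    have "E u m" "\<not> E z m" "m \<noteq> z"
      using \<open>E m u\<close> E_sym remote_not_adjacent(4)[OF r] remote_not_adjacent(1)[OF r] z by blast+
    then have "m \<in> beyond z u1 \<union> beyond z u2" using that by (auto simp: beyond_iff)
    then show False using blk M that(1) unfolding stable_def by blast
  qed
  \<comment> \<open>The survivors: vertices behind \<open>z\<close> that \<open>M\<close> leaves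
    undominated. By the hypothesis on \<open>beyond z u1\<close> and \<open>beyond z u2\<close>,
    both \<open>u1\<close> and \<open>u2\<close> are among them.\<close>
  let ?A = "{a \<in> beyond v z. \<forall>m\<in>M. \<not> E m a}"
  have "stable {u1, u2}"
    using u u12 E_V2 E_irrefl E_sym by (auto simp: stable_def beyond_iff)
  moreover have "{u1, u2} \<subseteq> ?A" using u alive by blast
  moreover have "?A \<subseteq> V" using E_V2 by (auto simp: beyond_iff)
  ultimately obtain I where I: "{u1, u2} \<subseteq> I" "I \<subseteq> ?A" "stable I"
      "\<And>x. x \<in> ?A \<Longrightarrow> x \<notin> I \<Longrightarrow> \<exists>y\<in>I. E x y"
    by (rule stable_extend[of "{u1, u2}" ?A]) (rule that)
  have Iz: "i \<in> beyond v z" if "i \<in> I" for i using I that by blast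
  have disj: "M \<inter> I = {}" using M(2) Iz by (auto simp: remote_def)
  have fin: "finite M" "finite I" using finite_stable M I by auto
  have nyz: "\<not> E m y" "\<not> E m z" "m \<noteq> y" "m \<noteq> z" "m \<noteq> v" "\<not> E m v" if "m \<in> M" for m
    using remote_not_adjacent[OF subsetD[OF M(2) that]] y z by auto
  have IzM: "\<not> E m i" if "m \<in> M" "i \<in> I" for m i using I that by blast
  have Iv: "\<not> E i v" "i \<noteq> v" if "i \<in> I" for i using Iz[OF that] E_sym by (auto simp: beyond_iff)
  have stMI: "stable (M \<union> I)"
    using M(3) I(3) IzM E_sym unfolding stable_def by blast
  have only: "w = z" if "i \<in> I" "E i w" "E v w" for i w
    using beyond_disjoint[OF that(3) z, of i] Iz[OF that(1)] that E_sym by (auto simp: beyond_iff)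
  have max1: "max_stable (insert v (M \<union> I))"
    unfolding max_stable_def
  proof (intro conjI ballI)
    show "stable (insert v (M \<union> I))"
      using stMI nyz Iv E_V[OF y] by (intro stable_insert) auto
    fix x assume x: "x \<in> V - insert v (M \<union> I)"
    consider "x \<in> remote v y z" | "E v x" | "x \<in> beyond v y" | "x \<in> beyond v z"
      using x by (auto simp: remote_def)
    then show "\<exists>y\<in>insert v (M \<union> I). E x y"
    proof cases
      case 4 then show ?thesis using I(4)[of x] x E_sym by blast
    qed (use M(1,4) x E_sym dom in blast)+
  qed
  have v: "v \<notin> M \<union> I" using nyz Iv by blast
  have iy: "\<not> E i y" if "i \<in> I" for i using only[OF that _ y] yz by auto
  have max2: "max_stable (insert y (insert z M))"
    unfolding max_stable_def
  proof (intro conjI ballI)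
    show "stable (insert y (insert z M))"
      using M(3) nyz y z yz E_V2 E_sym by (intro stable_insert) auto
    fix x assume x: "x \<in> V - insert y (insert z M)"
    consider "x \<in> remote v y z" | "x = v" | "E v x" | "x \<in> beyond v y" | "x \<in> beyond v z"
      using x by (auto simp: remote_def)
    then show "\<exists>y\<in>insert y (insert z M). E x y"
    proof cases
      case 1 then show ?thesis using M(4) x by blast
    next
      case 2 then show ?thesis using y by blast
    next
      case 3
      show ?thesis
      proof (cases "\<exists>s\<in>M \<union> I. E s x")
        case True
        then obtain s where s: "s \<in> M \<union> I" "E s x" by auto
        have "s \<notin> I" using only[of s x] s(2) 3 x by auto
        then show ?thesis using s E_sym by blast
      next
        case False
        \<comment> \<open>A neighbour \<open>x\<close> of \<open>v\<close> unseen by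
          \<open>M\<close> and \<open>I\<close> must be adjacent to \<open>y\<close>, since
          otherwise \<open>v\<close> could be exchanged for \<open>x\<close> and \<open>y\<close> in
          the first set.\<close>
        have "E y x"
          by (rule undominated_nbs_clique[OF wc max1 v y _ 3]) (use nyz iy False x in auto)
        then show ?thesis using E_sym by blast
      qed
    next
      case 4 then show ?thesis using E_sym by (auto simp: beyond_iff)
    next
      case 5 then show ?thesis using E_sym by (auto simp: beyond_iff)
    qed
  qed
  have "card (insert v (M \<union> I)) = card (insert y (insert z M))"
    using wc max1 max2 unfolding well_covered_def by blast
  moreover have "card (insert v (M \<union> I)) = Suc (card M + card I)"
    using v fin disj by (simp add: card_Un_disjoint)
  moreover have "y \<notin> M" "z \<notin> M" using nyz by blast+
  then have "card (insert y (insert z M)) = Suc (Suc (card M))"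
    using fin yz by simp
  moreover have "card {u1, u2} \<le> card I" using I fin by (intro card_mono)
  ultimately show False using u(3) by simp
qed

end

section \<open>Well-covered graphs in which no vertex lies in a simplex\<close>

locale no_simplex_graph = sgraph45 +
  assumes wc: well_covered and no_simplex: "x \<in> V \<Longrightarrow> \<not> in_simplex x"
begin

lemma E_neq: "E x y \<Longrightarrow> x \<noteq> y"
  using E_irrefl by blast

lemma beyond_nonempty: "E x y \<Longrightarrow> beyond x y \<noteq> {}"
  using nb_of_nb_subset_simplicial no_simplex E_V2 unfolding in_simplex_def by blast

lemma ex_nonadjacent_nb:
  assumes "E v y"
  obtains z where "E v z" "z \<noteq> y" "\<not> E y z"
  using beyond_nonempty[OF E_sym[OF assms]] by (auto simp: beyond_iff)

text \<open>For an edge \<open>E v y\<close> the chosen values lie at distance 3 from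
  \<open>v\<close> and form a stable set dominating \<open>beyond v y\<close>. Values of
  \<open>f\<close> elsewhere are arbitrary.\<close>

definition choice_beyond :: "'a \<Rightarrow> 'a \<Rightarrow> ('a \<Rightarrow> 'a) \<Rightarrow> bool" where
  "choice_beyond v y f \<longleftrightarrow> (\<forall>t\<in>beyond v y. f t \<in> beyond y t)"

text \<open>The obstruction supplied by \<open>blocked\<close>: the choice does not dominate
  \<open>u\<close>, and each vertex that could dominate \<open>u\<close> from distance 3 is adjacent
  to a chosen vertex.\<close>

definition blocks :: "'a \<Rightarrow> 'a \<Rightarrow> 'a \<Rightarrow> ('a \<Rightarrow> 'a) \<Rightarrow> 'a \<Rightarrow> bool" where
  "blocks v y z f u \<longleftrightarrow> u \<in> beyond v z \<and> (\<forall>t\<in>beyond v y. \<not> E (f t) u) \<and>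
    (\<forall>r\<in>beyond z u. \<exists>t\<in>beyond v y. E r (f t))"

lemma ex_choice_beyond: "\<exists>f. choice_beyond v y f"
proof -
  have "\<forall>t\<in>beyond v y. \<exists>r. r \<in> beyond y t"
  proof
    fix t assume "t \<in> beyond v y"
    then have "E y t" by (simp add: beyond_iff)
    then show "\<exists>r. r \<in> beyond y t" using beyond_nonempty by blast
  qed
  then show ?thesis unfolding choice_beyond_def by (rule bchoice)
qed

lemma choice_beyond_upd:
  "choice_beyond v y f \<Longrightarrow> r \<in> beyond y t \<Longrightarrow> choice_beyond v y (f(t := r))"
  by (auto simp: choice_beyond_def)

text \<open>Two such vertices would close the 4-cycle u, r, f t, r'.\<close>

lemma blocks_unique_left:
  assumes "E v y" "E v z" "choice_beyond v y f" "blocks v y z f u" "t \<in> beyond v y"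
    and "r \<in> beyond z u" "E r (f t)" "r' \<in> beyond z u" "E r' (f t)"
  shows "r = r'"
proof (rule ccontr)
  assume "r \<noteq> r'"
  have "f t \<in> beyond y t" "u \<in> beyond v z"
    using assms(3,4,5) by (auto simp: choice_beyond_def blocks_def)
  then have "f t \<noteq> u"
    using beyond_far(3)[OF assms(1,5) _ assms(2)] by blast
  moreover have "E u r" "E u r'" using assms by (auto simp: beyond_iff)
  ultimately show False
    using no_C4[of u r "f t" r'] assms(7,9) \<open>r \<noteq> r'\<close> E_sym by blast
qed

section \<open>An edge with the fewest vertices behind it\<close>

context
  fixes v y z
  assumes vy: "E v y" and vz: "E v z" and yz: "y \<noteq> z" "\<not> E y z"
    and minimal: "\<And>a b. E a b \<Longrightarrow> card (beyond v y) \<le> card (beyond a b)"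
begin

lemma ex_blocks: "choice_beyond v y f \<Longrightarrow> \<exists>u. blocks v y z f u"
  using blocked[OF wc vy vz yz, of f] unfolding choice_beyond_def blocks_def by blast

text \<open>Sending each \<open>r\<close> in \<open>beyond z u\<close> to some \<open>t\<close> with
  \<open>E r (f t)\<close> is injective by \<open>blocks_unique_left\<close>. As
  \<open>beyond z u\<close> cannot be smaller than \<open>beyond v y\<close>, the map is a
  bijection, and the edges between \<open>beyond z u\<close> and the chosen vertices form a perfect
  matching.\<close>

lemma blocks_matching:
  assumes f: "choice_beyond v y f" and u: "blocks v y z f u"
  shows "card (beyond z u) = card (beyond v y)"
    and "t \<in> beyond v y \<Longrightarrow> \<exists>r\<in>beyond z u. E r (f t)"
    and "\<lbrakk>t \<in> beyond v y; t' \<in> beyond v y; r \<in> beyond z u; E r (f t); E r (f t')\<rbrakk> \<Longrightarrow> t = t'"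
proof -
  have "\<forall>r\<in>beyond z u. \<exists>t. t \<in> beyond v y \<and> E r (f t)"
    using u unfolding blocks_def by blast
  then obtain k where k: "\<And>r. r \<in> beyond z u \<Longrightarrow> k r \<in> beyond v y \<and> E r (f (k r))"
    using bchoice[of "beyond z u" "\<lambda>r t. t \<in> beyond v y \<and> E r (f t)"] by blast
  have inj: "inj_on k (beyond z u)"
  proof (rule inj_onI)
    fix r r' assume r: "r \<in> beyond z u" "r' \<in> beyond z u" "k r = k r'"
    show "r = r'"
      using blocks_unique_left[OF vy vz f u, of "k r" r r'] k[OF r(1)] k[OF r(2)] r by auto
  qed
  have "E z u" using u by (simp add: blocks_def beyond_iff)
  then have le: "card (beyond v y) \<le> card (beyond z u)" by (rule minimal)
  have sub: "k ` beyond z u \<subseteq> beyond v y" using k by auto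
  have ge: "card (beyond z u) \<le> card (beyond v y)"
    using card_inj_on_le[OF inj sub] by simp
  then show "card (beyond z u) = card (beyond v y)" using le by simp
  then have surj: "k ` beyond z u = beyond v y"
    using card_subset_eq[OF _ sub] inj by (simp add: card_image)
  show ex: "\<exists>r\<in>beyond z u. E r (f t)" if "t \<in> beyond v y" for t
  proof -
    have "t \<in> k ` beyond z u" using surj that by simp
    then obtain r where r: "r \<in> beyond z u" "t = k r" by (rule imageE)
    show ?thesis using k[OF r(1)] r by auto
  qed
  have one: "k r = t" if "t \<in> beyond v y" "r \<in> beyond z u" "E r (f t)" for t r
  proof -
    have "t \<in> k ` beyond z u" using surj that by simp
    then obtain r' where r': "r' \<in> beyond z u" "t = k r'" by (rule imageE)
    then have "E r' (f t)" using k[OF r'(1)] by simp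
    then have "r = r'" by (rule blocks_unique_left[OF vy vz f u that r'(1)])
    then show ?thesis using r' by simp
  qed
  show "\<lbrakk>t \<in> beyond v y; t' \<in> beyond v y; r \<in> beyond z u; E r (f t); E r (f t')\<rbrakk> \<Longrightarrow> t = t'"
    using one by blast
qed

text \<open>The edge would close the hexagon v, y, t, r, u, z. Then \<open>r\<close> is an
  admissible value for \<open>f t\<close>; the blocker \<open>u'\<close> of such a choice differs
  from \<open>u\<close>, and the partner \<open>s\<close> of \<open>r\<close> behind
  \<open>u'\<close> closes the 5-cycle z, u, r, s, u'.\<close>

lemma no_hexagon:
  assumes t: "t \<in> beyond v y" and u: "u \<in> beyond v z" and r: "r \<in> beyond z u"
  shows "\<not> E r t"
proof
  assume rt: "E r t"
  have "r \<in> beyond y t"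
    using beyond_far(2)[OF vz u r] beyond_far(4)[OF vz u r vy] rt vy E_sym
    by (auto simp: beyond_iff)
  then obtain f where f: "choice_beyond v y f" "f t = r"
    using ex_choice_beyond[of v y] choice_beyond_upd[of v y _ r t] fun_upd_same by metis
  then obtain u' where u': "blocks v y z f u'" using ex_blocks by blast
  obtain s where s: "s \<in> beyond z u'" "E s r"
    using blocks_matching(2)[OF f(1) u' t] f by auto
  have "\<not> E r u'" using u' t f unfolding blocks_def by blast
  then have "u \<noteq> u'" using r E_sym by (auto simp: beyond_iff)
  moreover have "E z u" "E z u'" using u u' by (auto simp: blocks_def beyond_iff)
  ultimately show False
    using beyond_no_edge[of z u' u s r] s r by auto
qed

text \<open>The choice is changed at the single vertex \<open>t\<close>. With a common blocker, the
  partner of \<open>q\<close> would also be adjacent to an old value: to \<open>f t\<close>, which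
  closes a 4-cycle through \<open>t\<close>, or to a value kept by both choices, which contradicts
  the matching. For the second claim, a vertex \<open>p\<close> violating it would be adjacent to no
  old value and could be added to the old choice; the enlarged set serves both \<open>u\<close> and
  \<open>u'\<close> in \<open>two_survivors_adjacent\<close>.\<close>

lemma exchange_blocks:
  assumes f: "choice_beyond v y f" and t: "t \<in> beyond v y" and q: "q \<in> beyond y t" "q \<noteq> f t"
    and u: "blocks v y z f u" and u': "blocks v y z (f(t := q)) u'"
  shows "u \<noteq> u'"
    and "\<lbrakk>\<not> E u u'; r \<in> beyond z u'; E r q; p \<in> beyond u' r\<rbrakk> \<Longrightarrow> p = q \<and> E q (f t)"
proof -
  let ?f = "f(t := q)"
  have f': "choice_beyond v y ?f" by (rule choice_beyond_upd[OF f q(1)])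
  have ft: "f t \<in> beyond y t" using f t by (simp add: choice_beyond_def)
  have tq: "E t (f t)" "E t q" using ft q by (auto simp: beyond_iff)
  have ub: "u \<in> beyond v z" "u' \<in> beyond v z" using u u' by (auto simp: blocks_def)
  have C4: False if "E r q" "E r (f t)" "r \<noteq> t" for r
    using no_C4[of t q r "f t"] that tq q E_sym by blast
  have nott: "r \<noteq> t" if "r \<in> beyond z w" "w \<in> beyond v z" for r w
    using beyond_far(3)[OF vz that(2,1) vy] t by auto
  show neq: "u \<noteq> u'"
  proof
    assume "u = u'"
    obtain r where r: "r \<in> beyond z u" "E r q"
      using blocks_matching(2)[OF f' u' t] \<open>u = u'\<close> by auto
    then obtain t2 where t2: "t2 \<in> beyond v y" "E r (f t2)"
      using u unfolding blocks_def by blast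
    show False
    proof (cases "t2 = t")
      case True then show False using C4 r t2 nott ub by blast
    next
      case False
      then have "E r (?f t2)" "E r (?f t)" using t2 r by auto
      then show False
        using blocks_matching(3)[OF f' u' t2(1) t] r \<open>u = u'\<close> False by blast
    qed
  qed
  assume nadj: "\<not> E u u'" and r: "r \<in> beyond z u'" "E r q" and p: "p \<in> beyond u' r"
  show "p = q \<and> E q (f t)"
  proof (rule ccontr)
    assume neg: "\<not> (p = q \<and> E q (f t))"
    have zu': "E z u'" "E u' r" "E r p" "p \<noteq> u'" "\<not> E u' p" using ub r p by (auto simp: beyond_iff)
    have rt: "r \<noteq> t" "\<not> E r t" using nott r ub no_hexagon[OF t ub(2) r(1)] by auto
    have p1: "\<not> E p (f t)"
    proof
      assume pf: "E p (f t)"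
      then have "p \<noteq> q" using neg by blast
      moreover have "f t \<noteq> r" using rt tq E_sym by blast
      moreover have "p \<noteq> t" using rt zu' by blast
      moreover have "f t \<noteq> p" "t \<noteq> q" "t \<noteq> f t" "q \<noteq> r" "r \<noteq> p"
        using pf tq r zu' by (auto dest: E_neq)
      ultimately show False
        using no_C5[of "f t" t q r p] tq r zu' pf q(2) rt E_sym by auto
    qed
    have p2: "\<not> E p (f t2)" if t2: "t2 \<in> beyond v y" "t2 \<noteq> t" for t2
    proof
      assume pf: "E p (f t2)"
      obtain r2 where r2: "r2 \<in> beyond z u'" "E r2 (f t2)"
        using blocks_matching(2)[OF f' u' t2(1)] t2 by auto
      have "r2 \<noteq> r"
        using blocks_matching(3)[OF f' u' t2(1) t r(1)] r2 r t2 by auto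
      have ft2: "f t2 \<in> beyond y t2" using f t2 by (simp add: choice_beyond_def)
      then have "E t2 (f t2)" by (simp add: beyond_iff)
      then have "f t2 \<noteq> r" using no_hexagon[OF t2(1) ub(2) r(1)] E_sym by blast
      moreover have "f t2 \<noteq> u'" using beyond_far(3)[OF vy t2(1) ft2 vz] ub by blast
      moreover have "E u' r2" using r2 by (simp add: beyond_iff)
      moreover have "p \<noteq> r2" using zu' \<open>E u' r2\<close> by blast
      moreover have "p \<noteq> f t2" "f t2 \<noteq> r2" "r2 \<noteq> u'" "u' \<noteq> r" "r \<noteq> p"
        using pf r2 \<open>E u' r2\<close> zu' by (auto dest: E_neq)
      ultimately show False
        using no_C5[of p "f t2" r2 u' r] pf r2 zu' \<open>r2 \<noteq> r\<close> E_sym by auto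
    qed
    \<comment> \<open>In \<open>beyond z u'\<close> only \<open>r\<close> is matched to the new
      value \<open>q\<close>, and \<open>p\<close> dominates \<open>r\<close>; all other vertices
      there have partners shared by both choices.\<close>
    let ?S = "insert p (f ` beyond v y)"
    have ff: "\<not> E (f a) (f b)" if "a \<in> beyond v y" "b \<in> beyond v y" for a b
    proof (cases "a = b")
      case False
      then show ?thesis
        using beyond_no_edge[of y a b "f a" "f b"] f that
        by (auto simp: beyond_iff choice_beyond_def)
    qed (simp add: E_irrefl)
    have fV: "f ` beyond v y \<subseteq> remote v y z"
      using beyond_beyond_remote[OF vy vz _ _ vy] f unfolding choice_beyond_def by blast
    have pr: "p \<in> remote v y z"
    proof -
      have far: "r \<noteq> v" "\<not> E v r" "\<not> E r w" if "E v w" for w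
        using beyond_far[OF vz ub(2) r(1)] that by blast+
      have "p \<noteq> v" using far(2)[OF vz] zu' E_sym by blast
      moreover have "\<not> E v p" using far(3) zu' by blast
      moreover have "p \<notin> beyond v y" using no_hexagon[OF _ ub(2) r(1)] zu' by blast
      moreover have "p \<notin> beyond v z"
      proof
        assume "p \<in> beyond v z"
        then have "E z p" by (simp add: beyond_iff)
        moreover have "z \<noteq> r" using far(2) vz by blast
        ultimately show False using no_C4[of z u' r p] zu' E_sym by blast
      qed
      ultimately show ?thesis using zu' E_V2 by (auto simp: remote_def)
    qed
    have st: "stable ?S"
    proof (rule stable_insert)
      show "stable (f ` beyond v y)"
        using ff fV remote_not_adjacent(6) unfolding stable_def by blast
      show "p \<in> V" using zu' E_V2 by blast
      show "\<not> E s p" if s: "s \<in> f ` beyond v y" for s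
        using that p1 p2 E_sym by blast
    qed
    have "E u u'"
    proof (rule two_survivors_adjacent[OF wc vy vz yz st])
      show "?S \<subseteq> remote v y z" using fV pr by blast
      show "\<exists>s\<in>?S. E a s" if "a \<in> beyond v y" for a
      proof
        show "f a \<in> ?S" using that by blast
        have "f a \<in> beyond y a" using f that by (simp add: choice_beyond_def)
        then show "E a (f a)" by (simp add: beyond_iff)
      qed
      show "u \<in> beyond v z" "u' \<in> beyond v z" "u \<noteq> u'" using ub neq by auto
      show "\<exists>s\<in>?S. E a s" if a: "a \<in> beyond z u \<union> beyond z u'" for a
      proof (cases "a \<in> beyond z u")
        case True then show ?thesis using u by (auto simp: blocks_def)
      next
        case False
        then have a': "a \<in> beyond z u'" using a by blast
        then obtain b where b: "b \<in> beyond v y" "E a (?f b)" using u' unfolding blocks_def by blast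
        show ?thesis
        proof (cases "b = t")
          case True
          then have "a = r"
            using blocks_unique_left[OF vy vz f' u' t a' _ r(1)] b r by simp
          then show ?thesis using zu' by blast
        next
          case False then show ?thesis using b by auto
        qed
      qed
    qed
    then show False using nadj by blast
  qed
qed

text \<open>If there were two vertices behind every edge, \<open>f t\<close> could be changed to a
  second value \<open>q\<close> while \<open>f t2\<close> is kept. The two partners of
  \<open>f t2\<close> and an edge between the blockers would form a 5-cycle, so the blockers are not
  adjacent, and \<open>exchange_blocks\<close> leaves at most \<open>q\<close> in some set
  \<open>beyond u' r\<close>, which is too small.\<close>

lemma minimal_beyond_singleton: "card (beyond v y) = 1"
proof (rule ccontr)
  assume "card (beyond v y) \<noteq> 1"
  moreover have "card (beyond v y) \<noteq> 0" using beyond_nonempty[OF vy] by simp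
  ultimately have m: "2 \<le> card (beyond v y)" by linarith
  have two: "\<exists>b\<in>Y. b \<noteq> a" if "2 \<le> card Y" for Y and a :: 'a
  proof (rule ccontr)
    assume "\<not> ?thesis"
    then have "Y \<subseteq> {a}" by blast
    then have "card Y \<le> 1" using card_mono[of "{a}" Y] by simp
    then show False using that by simp
  qed
  obtain f where f: "choice_beyond v y f" using ex_choice_beyond by blast
  obtain t where t: "t \<in> beyond v y" using beyond_nonempty[OF vy] by blast
  obtain t2 where t2: "t2 \<in> beyond v y" "t2 \<noteq> t" using two[OF m] by blast
  have "E y t" using t by (simp add: beyond_iff)
  then obtain q where q: "q \<in> beyond y t" "q \<noteq> f t"
    using two[of "beyond y t"] m minimal[of y t] by (meson order_trans)
  let ?f = "f(t := q)"
  have f': "choice_beyond v y ?f" by (rule choice_beyond_upd[OF f q(1)])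
  obtain u u' where u: "blocks v y z f u" and u': "blocks v y z ?f u'"
    using ex_blocks f f' by blast
  note ex = exchange_blocks[OF f t q u u']
  have zu: "E z u" "E z u'" using u u' by (auto simp: blocks_def beyond_iff)
  obtain r2 where r2: "r2 \<in> beyond z u" "E r2 (f t2)" using blocks_matching(2)[OF f u t2(1)] by blast
  obtain r2' where r2': "r2' \<in> beyond z u'" "E r2' (f t2)"
    using blocks_matching(2)[OF f' u' t2(1)] t2 by auto
  have "\<not> E u u'"
  proof
    assume uu: "E u u'"
    have e: "E u r2" "E u' r2'" "\<not> E z r2" "\<not> E z r2'" "r2 \<noteq> z" "r2' \<noteq> z" using r2 r2' by (auto simp: beyond_iff)
    have "r2 \<noteq> r2'" using beyond_disjoint[OF zu, of r2] r2 r2' ex(1) by blast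
    moreover have "f t2 \<noteq> u" "f t2 \<noteq> u'"
      using beyond_far(3)[OF vy t2(1) _ vz, of "f t2"] f t2 u u'
      unfolding choice_beyond_def blocks_def by blast+
    moreover have "u \<noteq> r2" "u' \<noteq> r2'" "u \<noteq> r2'" "u' \<noteq> r2" "r2 \<noteq> f t2" "f t2 \<noteq> r2'" "u \<noteq> u'"
      using e zu r2 r2' uu by (auto dest: E_neq)
    ultimately show False
      using no_C5[of u r2 "f t2" r2' u'] e r2 r2' uu E_sym by auto
  qed
  moreover obtain r where r: "r \<in> beyond z u'" "E r q"
    using blocks_matching(2)[OF f' u' t] by auto
  ultimately have sub: "p = q" if "p \<in> beyond u' r" for p using ex(2) that by blast
  have "E u' r" using r by (simp add: beyond_iff)
  then obtain p where "p \<in> beyond u' r" "p \<noteq> q"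
    using two[of "beyond u' r"] m minimal[of u' r] by (meson order_trans)
  then show False using sub by blast
qed

end

end

section \<open>Thin edges and induced heptagons\<close>

context no_simplex_graph
begin

text \<open>An edge with exactly one vertex behind it. No edge has fewer, by
  \<open>beyond_nonempty\<close>, so everything shown for minimal edges applies to thin
  ones.\<close>

definition thin :: "'a \<Rightarrow> 'a \<Rightarrow> 'a \<Rightarrow> bool" where
  "thin v y t \<longleftrightarrow> E v y \<and> beyond v y = {t}"

lemma thinI:
  assumes "E v y" "E y t" "t \<noteq> v" "\<not> E v t" "\<And>x. E y x \<Longrightarrow> x = v \<or> E v x \<or> x = t"
  shows "thin v y t"
proof -
  have "beyond v y \<subseteq> {t}" using assms(5) by (auto simp: beyond_def)
  moreover have "t \<in> beyond v y" using assms by (simp add: beyond_iff)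
  ultimately show ?thesis using assms(1) unfolding thin_def by blast
qed

lemma thinD:
  assumes "thin v y t"
  shows "E v y" "E y t" "t \<noteq> v" "\<not> E v t" "\<lbrakk>E y x; x \<noteq> v; \<not> E v x\<rbrakk> \<Longrightarrow> x = t"
proof -
  have "t \<in> beyond v y" using assms by (simp add: thin_def)
  then show "E v y" "E y t" "t \<noteq> v" "\<not> E v t" using assms by (auto simp: thin_def beyond_iff)
  show "x = t" if "E y x" "x \<noteq> v" "\<not> E v x"
  proof -
    have "x \<in> beyond v y" using that by (simp add: beyond_iff)
    then show ?thesis using assms by (simp add: thin_def)
  qed
qed

lemma ex_thin:
  assumes "V \<noteq> {}"
  shows "\<exists>v y t. thin v y t"
proof -
  obtain x where "x \<in> V" using assms by blast
  then have "\<not> simplicial_vertex x" using no_simplex unfolding in_simplex_def by blast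
  then obtain y where "E x y" using \<open>x \<in> V\<close> unfolding simplicial_vertex_def by auto
  let ?c = "\<lambda>e. card (beyond (fst e) (snd e))"
  obtain e where e: "E (fst e) (snd e)" "\<And>a b. E a b \<Longrightarrow> ?c e \<le> card (beyond a b)"
    using exists_least_iff[of "\<lambda>n. \<exists>a b. E a b \<and> card (beyond a b) = n"] \<open>E x y\<close>
    by (metis fst_conv snd_conv not_le_imp_less)
  obtain z where z: "E (fst e) z" "z \<noteq> snd e" "\<not> E (snd e) z"
    using ex_nonadjacent_nb[OF e(1)] by blast
  have "?c e = 1"
    using minimal_beyond_singleton[OF e(1) z(1) _ z(3) e(2)] z(2) by blast
  then obtain t where "beyond (fst e) (snd e) = {t}" by (rule card_1_singletonE)
  then show ?thesis using e(1) unfolding thin_def by blast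
qed

lemma thin_minimal:
  assumes "thin v y t" "E a b"
  shows "card (beyond v y) \<le> card (beyond a b)"
proof -
  have "0 < card (beyond a b)" using beyond_nonempty[OF assms(2)] by (simp add: card_gt_0_iff)
  then show ?thesis using assms(1) by (simp add: thin_def)
qed

text \<open>A common neighbour of \<open>y\<close> and \<open>t\<close> is adjacent to
  \<open>v\<close>, which closes a 4-cycle, or it is a second vertex behind the edge.\<close>

lemma thin_no_common_nb:
  assumes "thin v y t" "E t r" "E y r"
  shows False
proof -
  have "r \<noteq> v" using thinD(4)[OF assms(1)] assms(2) E_sym by blast
  moreover have "\<not> E v r"
    using no_C4[of v y t r] thinD[OF assms(1)] assms(2,3) E_sym E_neq by blast
  ultimately have "r = t" using thinD(5)[OF assms(1)] assms(3) by blast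
  then show False using assms(2) E_irrefl by blast
qed

text \<open>A 7-cycle v, y, t, r, s, u, z with thin edges on both sides of \<open>v\<close>, one
  step apart from it on the side of \<open>z\<close>. Only the data delivered by a blocker are
  listed; that the cycle is induced follows in \<open>heptagon_nonedges\<close>.\<close>

definition heptagon :: "'a \<Rightarrow> 'a \<Rightarrow> 'a \<Rightarrow> 'a \<Rightarrow> 'a \<Rightarrow> 'a \<Rightarrow> 'a \<Rightarrow> bool" where
  "heptagon v y t r s u z \<longleftrightarrow> thin v y t \<and> E v z \<and> z \<noteq> y \<and> \<not> E y z \<and> E t r \<and> r \<noteq> y \<and>
    thin z u s \<and> u \<noteq> v \<and> \<not> E v u \<and> E r s \<and> \<not> E r u"

lemma thin_choice:
  assumes "thin v y t" "E t r" "r \<noteq> y"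
  shows "choice_beyond v y (\<lambda>_. r)" "r \<in> beyond y t"
proof -
  have "\<not> E y r" using thin_no_common_nb[OF assms(1,2)] by blast
  then show "r \<in> beyond y t" using assms by (simp add: beyond_iff)
  then show "choice_beyond v y (\<lambda>_. r)" using assms(1) by (simp add: choice_beyond_def thin_def)
qed

text \<open>Over a thin edge a choice is a single vertex \<open>r\<close>. Its blocker
  \<open>u\<close> has by the perfect matching exactly one vertex \<open>s\<close> behind it, and
  \<open>s\<close> is adjacent to \<open>r\<close>, which closes the cycle.\<close>

lemma ex_heptagon:
  assumes "thin v y t" "E v z" "z \<noteq> y" "\<not> E y z" "E t r" "r \<noteq> y"
  shows "\<exists>u s. heptagon v y t r s u z"
proof -
  note c = thin_choice[OF assms(1,5,6)]
  note vy = thinD(1)[OF assms(1)]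
  have m: "\<And>a b. E a b \<Longrightarrow> card (beyond v y) \<le> card (beyond a b)"
    using thin_minimal[OF assms(1)] .
  note ctx = vy assms(2) assms(3)[symmetric] assms(4) m
  obtain u where u: "blocks v y z (\<lambda>_. r) u" using ex_blocks[OF ctx c(1)] by blast
  have "card (beyond z u) = 1"
    using blocks_matching(1)[OF ctx c(1) u] assms(1) by (simp add: thin_def)
  then obtain s where s: "beyond z u = {s}" by (rule card_1_singletonE)
  have "u \<in> beyond v z" "\<not> E r u" "E s r"
    using u s assms(1) unfolding blocks_def thin_def by auto
  then have "heptagon v y t r s u z"
    using assms s E_sym by (auto simp: heptagon_def thin_def beyond_iff)
  then show ?thesis by blast
qed

lemma heptagon_edges:
  assumes "heptagon v y t r s u z"
  shows "E v y" "E y t" "E t r" "E r s" "E s u" "E u z" "E z v"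
    "E y v" "E t y" "E r t" "E s r" "E u s" "E z u" "E v z"
  using assms thinD(1,2)[of v y t] thinD(1,2)[of z u s] E_sym by (auto simp: heptagon_def)

text \<open>The chord between \<open>s\<close> and \<open>t\<close> would close a hexagon and is
  excluded by \<open>no_hexagon\<close>. The other chords contradict the position of the vertices
  relative to \<open>v\<close> or the defining data.\<close>

lemma heptagon_nonedges:
  assumes "heptagon v y t r s u z"
  shows "\<not> E v t" "\<not> E v r" "\<not> E v s" "\<not> E v u" "\<not> E y r" "\<not> E y s" "\<not> E y u" "\<not> E y z"
    "\<not> E t s" "\<not> E t u" "\<not> E t z" "\<not> E r u" "\<not> E r z" "\<not> E s z"
    "\<not> E t v" "\<not> E r v" "\<not> E s v" "\<not> E u v" "\<not> E r y" "\<not> E s y" "\<not> E u y" "\<not> E z y"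
    "\<not> E s t" "\<not> E u t" "\<not> E z t" "\<not> E u r" "\<not> E z r" "\<not> E z s"
    and "distinct [v, y, t, r, s, u, z]"
proof -
  note e = heptagon_edges[OF assms]
  have th: "thin v y t" "thin z u s" using assms by (auto simp: heptagon_def)
  have t: "t \<in> beyond v y" using th by (simp add: thin_def)
  have u: "u \<in> beyond v z" using assms e by (simp add: beyond_iff heptagon_def)
  have r: "r \<in> beyond y t" using thin_choice(2)[OF th(1)] assms by (simp add: heptagon_def)
  have s: "s \<in> beyond z u" using th by (simp add: thin_def)
  have yz: "y \<noteq> z" "\<not> E y z" using assms by (auto simp: heptagon_def)
  note R = beyond_far[OF e(1) t r] and S = beyond_far[OF e(14) u s]
  show vt: "\<not> E v t" and "\<not> E v r" and "\<not> E v s" and vu: "\<not> E v u" and "\<not> E y r"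
    "\<not> E y s" and yu: "\<not> E y u" and "\<not> E y z" "\<not> E t u" "\<not> E t z" "\<not> E r u" "\<not> E r z" "\<not> E s z"
    "\<not> E t v" "\<not> E r v" "\<not> E s v" "\<not> E u v" "\<not> E r y" "\<not> E s y" "\<not> E u y" "\<not> E z y"
    "\<not> E u t" "\<not> E z t" "\<not> E u r" "\<not> E z r" "\<not> E z s"
    using t u r s yz R(1,2) R(3,4)[OF e(1)] R(3,4)[OF e(14)] S(1,2) S(3,4)[OF e(1)] S(3,4)[OF e(14)] assms E_sym
      beyond_no_edge[OF e(1) e(14) t u yz(1)] beyond_disjoint[OF e(1) e(14)]
    unfolding beyond_iff heptagon_def by blast+
  show "\<not> E s t" "\<not> E t s"
    using no_hexagon[OF e(1) e(14) yz thin_minimal[OF th(1)] t u s] E_sym by blast+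
  show "distinct [v, y, t, r, s, u, z]"
    using e R(1,2) R(3,4)[OF e(1)] R(3,4)[OF e(14)] S(1,2) S(3,4)[OF e(1)] S(3,4)[OF e(14)] vt vu yz t u r s
      beyond_disjoint[OF e(1) e(14)] E_irrefl[of v] E_irrefl[of y] E_irrefl[of t] E_irrefl[of r]
      E_irrefl[of s] E_irrefl[of u] E_irrefl[of z]
    unfolding beyond_iff by auto
qed

lemma nb_beyond:
  assumes "thin v y t"
  shows "nb t = insert y (beyond y t)"
  using thin_no_common_nb[OF assms] thinD(2)[OF assms] E_sym unfolding nb_def beyond_def by blast

text \<open>Here \<open>u\<close> and \<open>u'\<close> block the constant choices \<open>r\<close>
  and \<open>q\<close>, which differ only at \<open>t\<close>, so \<open>exchange_blocks\<close>
  applies in both directions. If the blockers are not adjacent, it leaves one vertex behind the edge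
  from \<open>u\<close> to \<open>s\<close> and one behind the edge from \<open>u'\<close> to
  \<open>s'\<close>.\<close>

lemma two_heptagons:
  assumes h: "heptagon v y t r s u z" and h': "heptagon v y t q s' u' z" and "r \<noteq> q"
  shows "u \<noteq> u'" "s \<noteq> s'" "E u u' \<or> (E r q \<and> nb s = {u, r} \<and> nb s' = {u', q})"
proof -
  have th: "thin v y t" "thin z u s" "thin z u' s'" using h h' by (auto simp: heptagon_def)
  note ctx = heptagon_edges(1)[OF h] heptagon_edges(14)[OF h] _ heptagon_nonedges(8)[OF h]
    thin_minimal[OF th(1)]
  have yz: "y \<noteq> z" using h by (auto simp: heptagon_def)
  have c: "choice_beyond v y (\<lambda>_. r)" "r \<in> beyond y t" "choice_beyond v y (\<lambda>_. q)" "q \<in> beyond y t"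
    using thin_choice[OF th(1)] h h' by (auto simp: heptagon_def)
  have t: "t \<in> beyond v y" using th by (simp add: thin_def)
  have b: "blocks v y z (\<lambda>_. r) u"
    using h E_sym[of r s] heptagon_edges(13)[OF h] by (auto simp: blocks_def heptagon_def thin_def beyond_iff)
  have b': "blocks v y z (\<lambda>_. q) u'"
    using h' E_sym[of q s'] heptagon_edges(13)[OF h'] by (auto simp: blocks_def heptagon_def thin_def beyond_iff)
  have upd: "blocks v y z ((\<lambda>_. r)(t := q)) u'" "blocks v y z ((\<lambda>_. q)(t := r)) u"
    using b b' th by (auto simp: blocks_def thin_def)
  show neq: "u \<noteq> u'"
    by (rule exchange_blocks(1)[OF ctx(1,2) yz ctx(4) ctx(5) c(1) t c(4) _ b upd(1)])
      (use \<open>r \<noteq> q\<close> in auto)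
  show "s \<noteq> s'"
    using beyond_disjoint[of z u u' s] heptagon_edges(13)[OF h] heptagon_edges(13)[OF h'] th neq
    by (auto simp: thin_def)
  have ss: "s \<in> beyond z u" "s' \<in> beyond z u'" using th by (auto simp: thin_def)
  have 1: "p = q \<and> E q r" if "\<not> E u u'" "p \<in> beyond u' s'" for p
    using exchange_blocks(2)[OF ctx(1,2) yz ctx(4) ctx(5) c(1) t c(4) _ b upd(1) that(1) ss(2) _ that(2)]
      \<open>r \<noteq> q\<close> heptagon_edges(11)[OF h'] by auto
  have 2: "p = r \<and> E r q" if "\<not> E u u'" "p \<in> beyond u s" for p
    using exchange_blocks(2)[OF ctx(1,2) yz ctx(4) ctx(5) c(3) t c(2) _ b' upd(2) _ ss(1) _ that(2)]
      that(1) \<open>r \<noteq> q\<close> heptagon_edges(11)[OF h] E_sym by auto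
  show "E u u' \<or> (E r q \<and> nb s = {u, r} \<and> nb s' = {u', q})"
  proof (rule disjCI)
    assume "\<not> (E r q \<and> nb s = {u, r} \<and> nb s' = {u', q})"
    show "E u u'"
    proof (rule ccontr)
      assume n: "\<not> E u u'"
      have "beyond u s \<noteq> {}" "beyond u' s' \<noteq> {}"
        using beyond_nonempty heptagon_edges(12)[OF h] heptagon_edges(12)[OF h'] by auto
      then have "beyond u s = {r}" "beyond u' s' = {q}" "E r q"
        using 1[OF n] 2[OF n] by blast+
      then show False
        using \<open>\<not> (E r q \<and> nb s = {u, r} \<and> nb s' = {u', q})\<close> nb_beyond[OF th(2)] nb_beyond[OF th(3)]
        by simp
    qed
  qed
qed

text \<open>Three neighbours of \<open>t\<close> besides \<open>y\<close> would give three heptagons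
  with the same \<open>z\<close>. For each pair, the neighbours of \<open>t\<close> or the
  corresponding neighbours of \<open>z\<close> must be adjacent. But among three neighbours of one
  vertex at most one pair is adjacent, or a 4-cycle arises; so at most two of the three pairs can be
  served.\<close>

lemma thin_end_cases:
  assumes th: "thin v y t"
  obtains r where "r \<noteq> y" "nb t = {y, r}"
  | r q where "r \<noteq> y" "q \<noteq> y" "r \<noteq> q" "nb t = {y, r, q}"
proof -
  obtain r where r: "r \<in> beyond y t" using beyond_nonempty[OF thinD(2)[OF th]] by blast
  have nt: "E t a" "a \<noteq> y" if "a \<in> beyond y t" for a using that by (auto simp: beyond_iff)
  obtain z where z: "E v z" "z \<noteq> y" "\<not> E y z" using ex_nonadjacent_nb[OF thinD(1)[OF th]] .
  show ?thesis
  proof (cases "beyond y t = {r}")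
    case True
    then show ?thesis using that(1)[of r] nt[OF r] nb_beyond[OF th] by simp
  next
    case False
    then obtain q where q: "q \<in> beyond y t" "q \<noteq> r" using r by blast
    have "beyond y t \<subseteq> {r, q}"
    proof (rule ccontr)
      assume "\<not> beyond y t \<subseteq> {r, q}"
      then obtain p where p: "p \<in> beyond y t" "p \<noteq> r" "p \<noteq> q" by blast
      obtain u1 s1 u2 s2 u3 s3 where h: "heptagon v y t r s1 u1 z" "heptagon v y t q s2 u2 z"
          "heptagon v y t p s3 u3 z"
        using ex_heptagon[OF th z] nt r q(1) p(1) by metis
      have tr: "E t r" "E t q" "E t p" using nt r q p by auto
      have zu: "E z u1" "E z u2" "E z u3" using h heptagon_edges(13) by blast+
      have A: "\<not> (E a b \<and> E a c)" if "E x a" "E x b" "E x c" "b \<noteq> c" for x a b c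
        using no_C4[of x b a c] that E_sym E_neq by blast
      note T = two_heptagons[OF h(1,2) q(2)[symmetric]] two_heptagons[OF h(1,3) p(2)[symmetric]]
        two_heptagons[OF h(2,3) p(3)[symmetric]]
      show False
        using T A[OF tr(1,2,3)] A[OF tr(2,1,3)] A[OF tr(3,1,2)] A[OF zu(1,2,3)] A[OF zu(2,1,3)]
          A[OF zu(3,1,2)] p q E_sym by metis
    qed
    then have "nb t = {y, r, q}" using r q nb_beyond[OF th] by auto
    then show ?thesis using that(2)[of r q] nt r q by auto
  qed
qed

lemma nb_three:
  assumes "thin v y t" "E t a" "E t b" "a \<noteq> y" "b \<noteq> y" "a \<noteq> b"
  shows "nb t = {y, a, b}"
  using thin_end_cases[OF assms(1)]
proof cases
  case (1 r)
  then have "a = r" "b = r" using assms nb_iff by blast+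
  with assms show ?thesis by simp
next
  case (2 r q)
  then have "a \<in> {r, q}" "b \<in> {r, q}" using assms nb_iff by blast+
  with 2 assms show ?thesis by auto
qed

end

section \<open>Growing C_7 and T_10 from heptagons\<close>

context sgraph
begin

text \<open>Whole neighbourhoods are prescribed, so the seven vertices are closed under adjacency
  and exhaust a connected graph.\<close>

definition C7_at :: "'a \<Rightarrow> 'a \<Rightarrow> 'a \<Rightarrow> 'a \<Rightarrow> 'a \<Rightarrow> 'a \<Rightarrow> 'a \<Rightarrow> bool" where
  "C7_at v y t r s u z \<longleftrightarrow> distinct [v, y, t, r, s, u, z] \<and> nb v = {z, y} \<and> nb y = {v, t} \<and>
    nb t = {y, r} \<and> nb r = {t, s} \<and> nb s = {r, u} \<and> nb u = {s, z} \<and> nb z = {u, v}"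

definition T10_at ::
    "'a \<Rightarrow> 'a \<Rightarrow> 'a \<Rightarrow> 'a \<Rightarrow> 'a \<Rightarrow> 'a \<Rightarrow> 'a \<Rightarrow> 'a \<Rightarrow> 'a \<Rightarrow> 'a \<Rightarrow> bool" where
  "T10_at v a1 a2 a3 b1 b2 b3 c1 c2 c3 \<longleftrightarrow> distinct [v, a1, a2, a3, b1, b2, b3, c1, c2, c3] \<and>
    nb v = {a1, a2, a3} \<and> nb a1 = {v, b1} \<and> nb a2 = {v, b2} \<and> nb a3 = {v, b3} \<and>
    nb b1 = {a1, c1} \<and> nb b2 = {a2, c2} \<and> nb b3 = {a3, c3} \<and>
    nb c1 = {b1, c2, c3} \<and> nb c2 = {b2, c1, c3} \<and> nb c3 = {b3, c1, c2}"

lemma nb_eqD: "nb x = S \<Longrightarrow> E x w \<longleftrightarrow> w \<in> S"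
  by auto

end

context no_simplex_graph
begin

text \<open>The part of \<open>ex_heptagon\<close> that is iterated: thinness passes to the opposite
  side of a heptagon. In the uses below the new vertices are identified by elimination among known
  neighbourhoods.\<close>

lemma thin_step:
  assumes "thin v y t" "E v z" "z \<noteq> y" "\<not> E y z" "E t r" "r \<noteq> y"
  obtains u s where "thin z u s" "u \<noteq> v" "\<not> E v u" "E r s" "E z u" "s \<noteq> t" "\<not> E s z"
proof -
  obtain u s where h: "heptagon v y t r s u z" using ex_heptagon[OF assms] by blast
  then show thesis
    using that[of u s] heptagon_nonedges[OF h] heptagon_edges[OF h] by (auto simp: heptagon_def)
qed

lemma thin_nb_two:
  assumes "thin v y t" "nb t = {y, r}" "r \<noteq> y"
  shows "thin y t r"
proof (rule thinI)
  have tr: "E t r" using assms(2) by auto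
  then show "\<not> E y r" using thin_no_common_nb[OF assms(1)] by blast
  show "E y t" "E t r" "r \<noteq> y" using thinD(2)[OF assms(1)] tr assms by auto
  show "x = y \<or> E y x \<or> x = r" if "E t x" for x using nb_eqD[OF assms(2)] that by auto
qed

text \<open>At an end of degree 2 thinness moves one edge forward along the heptagon. A full turn
  determines all seven neighbourhoods.\<close>

lemma C7_if_thin_ends_two:
  assumes all: "\<And>a b c. thin a b c \<Longrightarrow> \<exists>d. d \<noteq> b \<and> nb c = {b, d}" and th: "thin v y t"
  shows "\<exists>r s u z. C7_at v y t r s u z"
proof -
  have step: "nb c = {b, d} \<and> thin b c d" if t: "thin a b c" "E c d" "d \<noteq> b" for a b c d
  proof -
    obtain d' where d': "d' \<noteq> b" "nb c = {b, d'}" using all[OF t(1)] by blast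
    then have "d' = d" using nb_eqD[OF d'(2)] t by auto
    then show ?thesis using d' thin_nb_two[OF t(1)] by blast
  qed
  obtain z where z: "E v z" "z \<noteq> y" "\<not> E y z" using ex_nonadjacent_nb[OF thinD(1)[OF th]] .
  obtain r where r: "r \<noteq> y" "nb t = {y, r}" using all[OF th] by blast
  have "E t r" using r(2) by auto
  then obtain s u where h: "heptagon v y t r s u z" using ex_heptagon[OF th z _ r(1)] by blast
  note e = heptagon_edges[OF h] and d = heptagon_nonedges(29)[OF h]
  have "r \<noteq> y" "s \<noteq> t" "u \<noteq> r" "z \<noteq> s" "v \<noteq> u" "y \<noteq> z" "t \<noteq> v" using d by auto
  note ne = this
  have 1: "nb t = {y, r} \<and> thin y t r" using step[OF th e(3) ne(1)] .
  then have 2: "nb r = {t, s} \<and> thin t r s" using step[OF _ e(4) ne(2)] by blast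
  then have 3: "nb s = {r, u} \<and> thin r s u" using step[OF _ e(5) ne(3)] by blast
  then have 4: "nb u = {s, z} \<and> thin s u z" using step[OF _ e(6) ne(4)] by blast
  then have 5: "nb z = {u, v} \<and> thin u z v" using step[OF _ e(7) ne(5)] by blast
  then have 6: "nb v = {z, y} \<and> thin z v y" using step[OF _ e(1) ne(6)] by blast
  then have 7: "nb y = {v, t}" using step[OF _ e(2) ne(7)] by blast
  have "C7_at v y t r s u z" using 1 2 3 4 5 6 7 d by (simp add: C7_at_def)
  then show ?thesis by blast
qed

lemma heptagon_pair_distinct:
  assumes h: "heptagon v y t r s u z" and h': "heptagon v y t q s' u' z" and "r \<noteq> q"
  shows "distinct [v, y, t, r, s, u, z, q, s', u']"
    "\<not> E u s'" "\<not> E u' s" "\<not> E q s" "\<not> E r s'" "\<not> E s' u" "\<not> E s u'" "\<not> E s q" "\<not> E s' r"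
proof -
  note t = two_heptagons(1,2)[OF h h' \<open>r \<noteq> q\<close>]
  note e = heptagon_edges[OF h] and e' = heptagon_edges[OF h']
  note n = heptagon_nonedges[OF h] and n' = heptagon_nonedges[OF h']
  have d: "distinct [v, y, t, r, s, u, z]" "distinct [v, y, t, q, s', u', z]" using n n' by blast+
  have th: "thin z u s" "thin z u' s'" using h h' by (auto simp: heptagon_def)
  show us: "\<not> E u s'" "\<not> E u' s"
    using thinD(5)[OF th(1), of s'] thinD(5)[OF th(2), of s] n n' d t by auto
  then show "\<not> E s' u" "\<not> E s u'" using E_sym by blast+
  have rq: "r \<noteq> s'" "q \<noteq> s" using e e' n n' by blast+
  moreover have "r \<noteq> u'" "q \<noteq> u" "s \<noteq> u'" "s' \<noteq> u" using e e' n n' by blast+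
  ultimately show "distinct [v, y, t, r, s, u, z, q, s', u']"
    using d t \<open>r \<noteq> q\<close> by auto
  have "t \<noteq> s" "t \<noteq> s'" using d by auto
  have qs: False if "E q s" using no_C4[of t r s q] e e' that \<open>r \<noteq> q\<close> \<open>t \<noteq> s\<close> E_sym by blast
  then show "\<not> E q s" "\<not> E s q" using E_sym by blast+
  have rs: False if "E r s'" using no_C4[of t q s' r] e e' that \<open>r \<noteq> q\<close> \<open>t \<noteq> s'\<close> E_sym by blast
  then show "\<not> E r s'" "\<not> E s' r" using E_sym by blast+
qed

text \<open>The triangle is t, r, q and \<open>z\<close> becomes the centre. The remaining
  neighbourhoods are found one by one: a thin edge with a known end gives another thin edge by
  \<open>thin_step\<close>, and the uniqueness of the vertex behind it excludes further
  neighbours.\<close>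

lemma T10_if_triangle_at_end:
  assumes h: "heptagon v y t r s u z" and h': "heptagon v y t q s' u' z" and rq: "r \<noteq> q" "E r q"
    and nt: "nb t = {y, r, q}" and ns: "nb s = {u, r}" "nb s' = {u', q}"
  shows "T10_at z v u u' y s s' t r q"
proof -
  note e = heptagon_edges[OF h] and e' = heptagon_edges[OF h']
  note n = heptagon_nonedges[OF h] and n' = heptagon_nonedges[OF h']
  note p = heptagon_pair_distinct[OF h h' rq(1)]
  have th: "thin v y t" "thin z u s" "thin z u' s'" using h h' by (auto simp: heptagon_def)
  have dist: "v \<noteq> y" "v \<noteq> t" "v \<noteq> r" "v \<noteq> s" "v \<noteq> u" "v \<noteq> z" "v \<noteq> q" "v \<noteq> s'" "v \<noteq> u'"
    "y \<noteq> t" "y \<noteq> r" "y \<noteq> s" "y \<noteq> u" "y \<noteq> z" "y \<noteq> q" "y \<noteq> s'" "y \<noteq> u'"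
    "t \<noteq> r" "t \<noteq> s" "t \<noteq> u" "t \<noteq> z" "t \<noteq> q" "t \<noteq> s'" "t \<noteq> u'"
    "r \<noteq> s" "r \<noteq> u" "r \<noteq> z" "r \<noteq> s'" "r \<noteq> u'" "s \<noteq> u" "s \<noteq> z" "s \<noteq> q" "s \<noteq> s'" "s \<noteq> u'"
    "u \<noteq> z" "u \<noteq> q" "u \<noteq> s'" "u \<noteq> u'" "z \<noteq> q" "z \<noteq> s'" "z \<noteq> u'" "q \<noteq> s'" "q \<noteq> u'" "s' \<noteq> u'"
    using p(1) by auto
  have "thin u s r"
    by (rule thinI) (use e n ns dist in \<open>auto dest: nb_eqD\<close>)
  from nb_three[OF this, of t q] have nr: "nb r = {s, t, q}" using e rq dist by auto
  have "thin u' s' q"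
    by (rule thinI) (use e' n' ns dist in \<open>auto dest: nb_eqD\<close>)
  from nb_three[OF this, of t r] have nq: "nb q = {s', t, r}" using e' rq dist E_sym by auto
  note ex = nb_eqD[OF nt] nb_eqD[OF ns(1)] nb_eqD[OF ns(2)] nb_eqD[OF nr] nb_eqD[OF nq]
  \<comment> \<open>Seen from \<open>q\<close>, the edge to \<open>r\<close> is thin because
    \<open>t\<close> is a common neighbour. The heptagon through \<open>s'\<close> and
    \<open>u\<close> turns this into a thin edge from \<open>s'\<close> to \<open>u'\<close>, behind
    which only \<open>z\<close> lies.\<close>
  have "thin q r s" by (rule thinI) (use e ex dist rq in auto)
  then obtain a b where ab: "thin s' a b" "a \<noteq> q" "E u b" "E s' a"
    by (rule thin_step[of q r s s' u]) (use e e' ex dist in auto)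
  have "a = u'" using ab ex by auto
  have bz: "b = z" using thinD(5)[OF ab(1), of z] \<open>a = u'\<close> e' n' dist by auto
  have t': "thin s' u' z" using ab \<open>a = u'\<close> bz by simp
  have nu': "nb u' = {s', z}"
  proof -
    have "w = s' \<or> w = z" if "E u' w" for w
      using thinD(5)[OF t' that] ex that n' E_neq[OF that] by auto
    then show ?thesis using e' by (auto simp: nb_def)
  qed
  have "thin r q s'" by (rule thinI) (use e' ex dist rq in auto)
  then obtain a b where ab: "thin s a b" "a \<noteq> r" "E u' b" "E s a"
    by (rule thin_step[of r q s' s u']) (use e e' ex dist in auto)
  have "a = u" using ab ex by auto
  have bz: "b = z" using thinD(5)[OF ab(1), of z] \<open>a = u\<close> e n dist by auto
  have t'': "thin s u z" using ab \<open>a = u\<close> bz by simp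
  have nu: "nb u = {s, z}"
  proof -
    have "w = s \<or> w = z" if "E u w" for w
      using thinD(5)[OF t'' that] ex that n E_neq[OF that] by auto
    then show ?thesis using e by (auto simp: nb_def)
  qed
  have tq: "thin q t y" by (rule thinI) (use e e' ex dist rq in auto)
  \<comment> \<open>A neighbour \<open>x\<close> of \<open>y\<close> other than \<open>t\<close>
    turns out to be adjacent to \<open>z\<close>, and unless \<open>x = v\<close> this closes the
    4-cycle y, v, z, x.\<close>
  have "x = t \<or> x = v" if x: "E y x" for x
  proof (cases "x = t")
    case False
    obtain a b where ab: "thin s' a b" "a \<noteq> q" "E x b" "E s' a"
      by (rule thin_step[OF tq, of s' x]) (use e' ex dist x False in auto)
    then have "a = u'" using ex by auto
    then have "b = z" using thinD(5)[OF ab(1), of z] e' n' dist by auto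
    then show ?thesis using no_C4[of y v z x] e x ab dist E_sym by blast
  qed simp
  then have ny: "nb y = {t, v}" using e by (auto simp: nb_def)
  have nz: "nb z = {u', v, u}" using nb_three[OF t', of v u] e e' dist by auto
  note ex' = ex nb_eqD[OF nu] nb_eqD[OF nu'] nb_eqD[OF ny]
  have ty: "thin t y v" by (rule thinI) (use e ex' n dist in auto)
  have "x = y \<or> x = z" if x: "E v x" for x
  proof (cases "x = y")
    case False
    obtain a b where ab: "thin r a b" "a \<noteq> t" "E x b" "E r a" "\<not> E t a"
      by (rule thin_step[OF ty, of r x]) (use e ex' dist x False in auto)
    then have "a = s" using ex' by auto
    then have "b = u" using thinD(5)[OF ab(1), of u] ex' dist by auto
    then have "E u x" using ab E_sym by blast
    then show ?thesis using ex' n x by auto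
  qed simp
  then have nv: "nb v = {z, y}" using e by (auto simp: nb_def)
  show ?thesis
    using nt ns nr nq nu nu' nz ny nv dist rq unfolding T10_at_def by (simp add: insert_commute)
qed

text \<open>Now z, u, u' form the triangle and \<open>t\<close> becomes the centre. The elimination
  starts from the thin edges between \<open>u\<close> and \<open>u'\<close>, whose common neighbour
  is \<open>z\<close>.\<close>

lemma T10_if_adjacent_inner:
  assumes h: "heptagon v y t r s u z" and h': "heptagon v y t q s' u' z" and rq: "r \<noteq> q"
    and uu: "E u u'" and nt: "nb t = {y, r, q}" and ns: "nb s = {u, r}" "nb s' = {u', q}"
  shows "T10_at t y r q v s s' z u u'"
proof -
  note e = heptagon_edges[OF h] and e' = heptagon_edges[OF h']
  note n = heptagon_nonedges[OF h] and n' = heptagon_nonedges[OF h']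
  note p = heptagon_pair_distinct[OF h h' rq(1)]
  have th: "thin v y t" "thin z u s" "thin z u' s'" using h h' by (auto simp: heptagon_def)
  have dist: "v \<noteq> y" "v \<noteq> t" "v \<noteq> r" "v \<noteq> s" "v \<noteq> u" "v \<noteq> z" "v \<noteq> q" "v \<noteq> s'" "v \<noteq> u'"
    "y \<noteq> t" "y \<noteq> r" "y \<noteq> s" "y \<noteq> u" "y \<noteq> z" "y \<noteq> q" "y \<noteq> s'" "y \<noteq> u'"
    "t \<noteq> r" "t \<noteq> s" "t \<noteq> u" "t \<noteq> z" "t \<noteq> q" "t \<noteq> s'" "t \<noteq> u'"
    "r \<noteq> s" "r \<noteq> u" "r \<noteq> z" "r \<noteq> s'" "r \<noteq> u'" "s \<noteq> u" "s \<noteq> z" "s \<noteq> q" "s \<noteq> s'" "s \<noteq> u'"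
    "u \<noteq> z" "u \<noteq> q" "u \<noteq> s'" "u \<noteq> u'" "z \<noteq> q" "z \<noteq> s'" "z \<noteq> u'" "q \<noteq> s'" "q \<noteq> u'" "s' \<noteq> u'"
    using p(1) by auto
  have nu: "nb u = {z, u', s}"
  proof -
    have "w = z \<or> w = u' \<or> w = s" if w: "E u w" for w
      using thinD(5)[OF th(2) w] no_C4[of z w u u'] e e' uu w E_sym dist by blast
    then show ?thesis using e uu by (auto simp: nb_def)
  qed
  have nu': "nb u' = {z, u, s'}"
  proof -
    have "w = z \<or> w = u \<or> w = s'" if w: "E u' w" for w
      using thinD(5)[OF th(3) w] no_C4[of z w u' u] e e' uu w E_sym dist by blast
    then show ?thesis using e' uu E_sym by (auto simp: nb_def)
  qed
  note ex = nb_eqD[OF nt] nb_eqD[OF ns(1)] nb_eqD[OF ns(2)] nb_eqD[OF nu] nb_eqD[OF nu']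
  have "thin u' u s" by (rule thinI) (use ex dist in auto)
  then obtain a b where ab: "thin s' a b" "a \<noteq> u'" "E r b" "E s' a"
    by (rule thin_step[of u' u s s' r]) (use ex dist in auto)
  have "a = q" using ab ex by auto
  then have "b = t" using thinD(5)[OF ab(1), of t] e' n' dist by auto
  have t': "thin s' q t" using ab \<open>a = q\<close> \<open>b = t\<close> by simp
  have "w = s' \<or> w = t" if "E q w" for w
    using thinD(5)[OF t' that] ex that n' E_neq[OF that] by auto
  then have nq: "nb q = {t, s'}" using e' by (auto simp: nb_def)
  have "thin u u' s'" by (rule thinI) (use ex dist in auto)
  then obtain a b where ab: "thin s a b" "a \<noteq> u" "E q b" "E s a"
    by (rule thin_step[of u u' s' s q]) (use ex dist in auto)
  have "a = r" using ab ex by auto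
  then have "b = t" using thinD(5)[OF ab(1), of t] e n dist by auto
  have t'': "thin s r t" using ab \<open>a = r\<close> \<open>b = t\<close> by simp
  have "w = s \<or> w = t" if "E r w" for w
    using thinD(5)[OF t'' that] ex that n E_neq[OF that] by auto
  then have nr: "nb r = {t, s}" using e by (auto simp: nb_def)
  note ex' = ex nb_eqD[OF nq] nb_eqD[OF nr]
  obtain a b where ab: "thin u a b" "a \<noteq> s" "E y b" "E u a"
    by (rule thin_step[OF t'', of u y]) (use ex' dist in auto)
  have "a \<noteq> u'"
  proof
    assume "a = u'"
    then have "b = s'" using thinD(5)[OF ab(1), of s'] ex' dist by auto
    then show False using ab n' by blast
  qed
  then have "a = z" using ab ex' by auto
  then have "b = v" using thinD(5)[OF ab(1), of v] ex' dist e by auto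
  have uz: "thin u z v" using ab \<open>a = z\<close> \<open>b = v\<close> by simp
  have "w = u \<or> w = v \<or> w = u'" if w: "E z w" for w
    using thinD(5)[OF uz w] ex' w n E_neq[OF w] by auto
  moreover have "E z v" "E z u" "E z u'" using e e' by auto
  ultimately have nz: "nb z = {v, u, u'}" by (auto simp: nb_def)
  have "x = z \<or> x = y" if x: "E v x" for x
  proof (cases "x = z")
    case False
    obtain a b where ab: "thin s a b" "a \<noteq> u" "E x b" "E s a"
      by (rule thin_step[OF uz, of s x]) (use ex' dist x False n in auto)
    then have "a = r" using ex' by auto
    then have "b = t" using thinD(5)[OF ab(1), of t] ex' dist by auto
    then have "E t x" using ab E_sym by blast
    then show ?thesis using ex' n n' x by auto
  qed simp
  then have nv: "nb v = {y, z}" using e by (auto simp: nb_def)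
  note ex2 = ex' nb_eqD[OF nz] nb_eqD[OF nv]
  have zv: "thin z v y" by (rule thinI) (use ex2 n dist in auto)
  have "x = v \<or> x = t" if x: "E y x" for x
  proof (cases "x = v")
    case False
    obtain a b where ab: "thin u a b" "a \<noteq> z" "\<not> E z a" "E x b" "E u a"
      by (rule thin_step[OF zv, of u x]) (use ex2 n dist x False in auto)
    then have "a = s" using ex2 by auto
    then have "b = r" using thinD(5)[OF ab(1), of r] ex2 dist by auto
    then have "E r x" using ab E_sym by blast
    then show ?thesis using ex2 n x by auto
  qed simp
  then have ny: "nb y = {t, v}" using e by (auto simp: nb_def)
  show ?thesis
    using nt ns nr nq nu nu' nz ny nv dist rq unfolding T10_at_def by (simp add: insert_commute)
qed

end

context sgraph
begin

definition has_T10 :: bool where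
  "has_T10 \<longleftrightarrow> (\<exists>v a1 a2 a3 b1 b2 b3 c1 c2 c3. T10_at v a1 a2 a3 b1 b2 b3 c1 c2 c3)"

lemma has_T10I: "T10_at v a1 a2 a3 b1 b2 b3 c1 c2 c3 \<Longrightarrow> has_T10"
  unfolding has_T10_def by blast

end

context no_simplex_graph
begin

lemma has_T10_or_inner_adjacent:
  assumes "heptagon v y t r s u z" "heptagon v y t q s' u' z" "r \<noteq> q" "nb t = {y, r, q}"
  shows "has_T10 \<or> E u u'"
  using two_heptagons(3)[OF assms(1-3)] T10_if_triangle_at_end[OF assms(1-3) _ assms(4)] has_T10I
  by blast

text \<open>A neighbour of \<open>u\<close> other than \<open>s\<close> is \<open>z\<close> or
  adjacent to \<open>z\<close>; in the second case it is \<open>u'\<close>, or z, x, u, u' would be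
  a 4-cycle.\<close>

lemma inner_nb:
  assumes h: "heptagon v y t r s u z" and h': "heptagon v y t q s' u' z" and rq: "r \<noteq> q"
    and uu: "E u u'" and nt: "nb t = {y, r, q}"
  shows "thin u' u s"
proof (rule thinI)
  note e = heptagon_edges[OF h] and e' = heptagon_edges[OF h']
  note p = heptagon_pair_distinct[OF h h' rq]
  show "E u' u" "E u s" "s \<noteq> u'" "\<not> E u' s" using uu e p E_sym by auto
  have th: "thin z u s" using h by (simp add: heptagon_def)
  fix x assume x: "E u x"
  show "x = u' \<or> E u' x \<or> x = s"
    using thinD(5)[OF th x] no_C4[of z x u u'] e e' uu x E_sym p(1) by fastforce
qed

text \<open>Suppose \<open>s\<close> has a third neighbour \<open>p\<close> and there is no T_10.
  Heptagons over the edge between \<open>u\<close> and \<open>u'\<close> give \<open>s'\<close>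
  degree 3 as well and put triangles at both \<open>s\<close> and \<open>s'\<close>;
  \<open>r\<close> and \<open>q\<close> lie on these triangles. A last heptagon through r, t, q then
  has no vertex left for one of its corners.\<close>

lemma inner_nb_two_or_T10:
  assumes h: "heptagon v y t r s u z" and h': "heptagon v y t q s' u' z" and rq: "r \<noteq> q"
    and uu: "E u u'" and nt: "nb t = {y, r, q}"
  shows "has_T10 \<or> nb s = {u, r}"
proof (rule disjCI)
  assume nsne: "nb s \<noteq> {u, r}"
  show has_T10
  proof (rule ccontr)
    assume noT: "\<not> has_T10"
    note e = heptagon_edges[OF h] and e' = heptagon_edges[OF h']
    note n = heptagon_nonedges[OF h] and n' = heptagon_nonedges[OF h']
    note P = heptagon_pair_distinct[OF h h' rq]
    have us: "thin u' u s" by (rule inner_nb[OF h h' rq uu nt])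
    have us': "thin u u' s'"
      by (rule inner_nb[OF h' h rq[symmetric] E_sym[OF uu]]) (use nt in auto)
    have ur: "u \<noteq> r" "u \<noteq> q" "u' \<noteq> q" "u \<noteq> s'" "s \<noteq> u'" using P(1) by auto
    obtain p where p: "p \<noteq> u" "p \<noteq> r" "nb s = {u, r, p}"
      using thin_end_cases[OF us]
    proof cases
      case (1 x)
      then have "x = r" using nb_eqD[OF 1(2), of r] e ur by auto
      then show thesis using 1 nsne by simp
    next
      case (2 a b)
      then have "r = a \<or> r = b" using nb_eqD[OF 2(4), of r] e ur by auto
      then show thesis using that[of a] that[of b] 2 by auto
    qed
    note exs = nb_eqD[OF p(3)]
    have sp: "E s r" "E s p" using exs by auto
    have nus: "\<not> E u s'" "\<not> E u' s" using P by auto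
    \<comment> \<open>Two heptagons over the thin edge from \<open>u'\<close> to \<open>u\<close>,
      through \<open>r\<close> and through \<open>p\<close>, both with \<open>s'\<close> as second
      neighbour of \<open>u'\<close>. Their vertices \<open>t1\<close> and \<open>m\<close> next to
      \<open>s'\<close> are adjacent in the absence of T_10.\<close>
    obtain s1 t1 where k1: "heptagon u' u s r s1 t1 s'"
      using ex_heptagon[OF us e'(12) ur(4)[symmetric] nus(1) sp(1) ur(1)[symmetric]] by blast
    obtain s2 m where k2: "heptagon u' u s p s2 m s'"
      using ex_heptagon[OF us e'(12) ur(4)[symmetric] nus(1) sp(2) p(1)] by blast
    have tm: "E t1 m" using has_T10_or_inner_adjacent[OF k1 k2 p(2)[symmetric] p(3)] noT by blast
    have tmn: "t1 \<noteq> m" using tm E_neq by blast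
    note f1 = heptagon_edges[OF k1] heptagon_nonedges[OF k1]
    note f2 = heptagon_edges[OF k2] heptagon_nonedges[OF k2]
    have ns': "nb s' = {u', t1, m}"
      by (rule nb_three[OF us']) (use f1 f2 tmn in auto)
    note exs' = nb_eqD[OF ns']
    \<comment> \<open>The mirrored heptagons, over the edge from \<open>u\<close> to
      \<open>u'\<close>, come back to \<open>s\<close>. Their vertices next to \<open>s\<close> can
      only be \<open>r\<close> and \<open>p\<close>, which are therefore adjacent.\<close>
    have "E s' t1" "E s' m" "t1 \<noteq> u'" "m \<noteq> u'" using f1 f2 by auto
    then obtain b1 a1 b2 a2 where k3: "heptagon u u' s' t1 b1 a1 s" "heptagon u u' s' m b2 a2 s"
      using ex_heptagon[OF us' e(12) ur(5) nus(2)] by meson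
    have aa: "E a1 a2" using has_T10_or_inner_adjacent[OF k3 tmn ns'] noT by blast
    have th3: "thin s a1 b1" "thin s a2 b2" using k3 by (auto simp: heptagon_def)
    have "a1 \<in> {r, p}" "a2 \<in> {r, p}"
      using exs[of a1] exs[of a2] thinD(1)[OF th3(1)] thinD(1)[OF th3(2)]
        heptagon_nonedges(29)[OF k3(1)] heptagon_nonedges(29)[OF k3(2)] by auto
    then have rp: "E r p" and sr: "\<exists>b. thin s r b"
      using aa th3 E_sym E_irrefl by auto
    have tr: "thin s r t" using sr thinD(5)[of s r _ t] e n P(1) by auto
    have npt: "\<not> E p t"
      using no_C4[of t r s p] e sp p(2) P(1) by auto
    have nr: "E r w \<Longrightarrow> w = s \<or> w = p \<or> w = t" for w
      using thinD(5)[OF tr, of w] exs[of w] n E_neq[of r w] by auto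
    have "q = t1 \<or> q = m" using exs'[of q] e' ur by auto
    moreover have th12: "thin s' t1 s1" "thin s' m s2" using k1 k2 by (auto simp: heptagon_def)
    ultimately have "\<exists>b. thin s' q b" by blast
    then have tq: "thin s' q t" using thinD(5)[of s' q _ t] e' n' P(1) by auto
    have "q \<noteq> m"
    proof
      assume "q = m"
      then have "s2 = t" using thinD(5)[OF th12(2), of t] thinD[OF tq] by blast
      then show False using npt f2(4) by blast
    qed
    then have qt: "q = t1" using \<open>q = t1 \<or> q = m\<close> by blast
    have nq: "E q w \<Longrightarrow> w = s' \<or> w = m \<or> w = t" for w
      using thinD(5)[OF tq, of w] exs'[of w] n' E_neq[of q w] qt by auto
    have tp: "thin p r t"
      by (rule thinI) (use rp E_sym tr thinD(2)[OF tr] npt nr sp n in blast)+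
    have tnm: "t \<noteq> m" using exs'[of t] exs'[of m] n' by auto
    have "s2 \<noteq> r"
      using no_C4[of t q m r] e e' tm qt f2(5) tnm rq E_sym by blast
    have nrs: "\<not> E r s2"
    proof
      assume "E r s2"
      then consider "s2 = s" | "s2 = p" | "s2 = t" using nr by blast
      then show False using f2 npt by cases auto
    qed
    \<comment> \<open>The corner \<open>c\<close> must be \<open>s'\<close>, since the other
      neighbours of \<open>q\<close> are excluded; but then each of the three neighbours of
      \<open>s'\<close> is excluded as \<open>d\<close>.\<close>
    obtain c d where k: "heptagon p r t q c d s2"
      using ex_heptagon[OF tp f2(4) \<open>s2 \<noteq> r\<close> nrs e'(3) rq[symmetric]] by blast
    note fk = heptagon_edges[OF k] heptagon_nonedges[OF k]
    have "c \<noteq> m" using fk f2 by blast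
    moreover have "c \<noteq> t" using fk by auto
    ultimately have "c = s'" using nq[OF fk(4)] by blast
    then have "d = u' \<or> d = t1 \<or> d = m" using exs'[of d] fk(5) by auto
    moreover have "d \<noteq> u'" using fk f2 by blast
    moreover have "d \<noteq> t1" using fk qt by auto
    moreover have "d \<noteq> m" using fk tm qt by blast
    ultimately show False by blast
  qed
qed

text \<open>If all ends of thin edges have degree 2, a C_7 closes up. An end of degree 3 gives two
  heptagons with a common \<open>z\<close>, and every branch of the analysis of this pair ends in a
  T_10.\<close>

theorem C7_or_T10:
  assumes "V \<noteq> {}"
  shows "(\<exists>v y t r s u z. C7_at v y t r s u z) \<or> has_T10"
proof (cases "\<forall>a b c. thin a b c \<longrightarrow> (\<exists>d. d \<noteq> b \<and> nb c = {b, d})")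
  case True
  obtain v y t where th: "thin v y t" using ex_thin[OF assms] by blast
  have "\<exists>r s u z. C7_at v y t r s u z"
    by (rule C7_if_thin_ends_two[OF _ th]) (use True in blast)
  then show ?thesis by blast
next
  case False
  then obtain v y t where th: "thin v y t" and no: "\<nexists>d. d \<noteq> y \<and> nb t = {y, d}" by blast
  obtain r q where rq: "r \<noteq> y" "q \<noteq> y" "r \<noteq> q" "nb t = {y, r, q}"
    using thin_end_cases[OF th] no by metis
  have t: "E t r" "E t q" using rq by auto
  obtain z where z: "E v z" "z \<noteq> y" "\<not> E y z" using ex_nonadjacent_nb[OF thinD(1)[OF th]] .
  obtain u s where h: "heptagon v y t r s u z" using ex_heptagon[OF th z t(1) rq(1)] by blast
  obtain u' s' where h': "heptagon v y t q s' u' z" using ex_heptagon[OF th z t(2) rq(2)] by blast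
  have nt': "nb t = {y, q, r}" using rq(4) by auto
  have "has_T10"
  proof (rule ccontr)
    assume no: "\<not> has_T10"
    then have uu: "E u u'" using has_T10_or_inner_adjacent[OF h h' rq(3,4)] by blast
    have "nb s = {u, r}" using inner_nb_two_or_T10[OF h h' rq(3) uu rq(4)] no by blast
    moreover have "nb s' = {u', q}"
      using inner_nb_two_or_T10[OF h' h rq(3)[symmetric] E_sym[OF uu] nt'] no by blast
    ultimately show False
      using T10_if_adjacent_inner[OF h h' rq(3) uu rq(4)] no has_T10I by blast
  qed
  then show ?thesis by blast
qed

end

context sgraph45
begin

text \<open>By \<open>bad_nb\<close> the vertices outside all simplices are closed under adjacency,
  so in a connected graph they are none or all. In the second case the C_7 or T_10 that is found is
  closed under adjacency too and is the whole graph.\<close>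

theorem well_covered_classification:
  assumes wc: well_covered
    and conn: "\<And>S. \<lbrakk>S \<subseteq> V; S \<noteq> {}; \<And>x y. \<lbrakk>x \<in> S; E x y\<rbrakk> \<Longrightarrow> y \<in> S\<rbrakk> \<Longrightarrow> S = V"
  shows "(\<forall>x\<in>V. in_simplex x) \<or>
    (\<exists>v y t r s u z. C7_at v y t r s u z \<and> V = {v, y, t, r, s, u, z}) \<or>
    (\<exists>v a1 a2 a3 b1 b2 b3 c1 c2 c3. T10_at v a1 a2 a3 b1 b2 b3 c1 c2 c3 \<and>
       V = {v, a1, a2, a3, b1, b2, b3, c1, c2, c3})"
proof (rule disjCI)
  assume no: "\<not> ((\<exists>v y t r s u z. C7_at v y t r s u z \<and> V = {v, y, t, r, s, u, z}) \<or>
    (\<exists>v a1 a2 a3 b1 b2 b3 c1 c2 c3. T10_at v a1 a2 a3 b1 b2 b3 c1 c2 c3 \<and>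
       V = {v, a1, a2, a3, b1, b2, b3, c1, c2, c3}))"
  show "\<forall>x\<in>V. in_simplex x"
  proof (rule ccontr)
    assume "\<not> (\<forall>x\<in>V. in_simplex x)"
    then obtain x where "x \<in> V" "\<not> in_simplex x" by blast
    then have "{x \<in> V. \<not> in_simplex x} = V"
      using bad_nb[OF wc] E_V2 by (intro conn) auto
    then interpret no_simplex_graph V E using wc by unfold_locales auto
    \<comment> \<open>The neighbourhoods are required to be non-empty because it is an incident edge
      that puts a vertex into \<open>V\<close>.\<close>
    have cl: "S = V" if S: "\<And>x. x \<in> S \<Longrightarrow> nb x \<subseteq> S \<and> nb x \<noteq> {}" "S \<noteq> {}" for S
    proof (rule conn)
      show "S \<subseteq> V" using S(1) E_V by (fastforce simp: nb_def)
      show "b \<in> S" if "a \<in> S" "E a b" for a b using S(1)[OF that(1)] that(2) by auto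
    qed (use S(2) in auto)
    from C7_or_T10 \<open>x \<in> V\<close> consider v y t r s u z where "C7_at v y t r s u z"
      | v a1 a2 a3 b1 b2 b3 c1 c2 c3 where "T10_at v a1 a2 a3 b1 b2 b3 c1 c2 c3"
      unfolding has_T10_def by blast
    then show False
    proof cases
      case 1
      have "{v, y, t, r, s, u, z} = V"
      proof (rule cl)
        fix x assume "x \<in> {v, y, t, r, s, u, z}"
        then show "nb x \<subseteq> {v, y, t, r, s, u, z} \<and> nb x \<noteq> {}"
          using 1 unfolding C7_at_def by (elim insertE emptyE) simp_all
      qed simp
      then show False using 1 no by blast
    next
      case 2
      have "{v, a1, a2, a3, b1, b2, b3, c1, c2, c3} = V"
      proof (rule cl)
        fix x assume "x \<in> {v, a1, a2, a3, b1, b2, b3, c1, c2, c3}"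
        then show "nb x \<subseteq> {v, a1, a2, a3, b1, b2, b3, c1, c2, c3} \<and> nb x \<noteq> {}"
          using 2 unfolding T10_at_def by (elim insertE emptyE) simp_all
      qed simp
      then show False using 2 no by blast
    qed
  qed
qed

end

section \<open>Monomial ideals and their associated primes\<close>

abbreviation lookup :: "('a \<Rightarrow>\<^sub>0 'b::zero) \<Rightarrow> 'a \<Rightarrow> 'b" where "lookup \<equiv> Poly_Mapping.lookup"
abbreviation keys :: "('a \<Rightarrow>\<^sub>0 'b::zero) \<Rightarrow> 'a set" where "keys \<equiv> Poly_Mapping.keys"
abbreviation single :: "'a \<Rightarrow> 'b::zero \<Rightarrow> 'a \<Rightarrow>\<^sub>0 'b" where "single \<equiv> Poly_Mapping.single"

lemma keys_add_nat: "keys (m + m' :: 'v \<Rightarrow>\<^sub>0 nat) = keys m \<union> keys m'"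
  by (auto simp: in_keys_iff lookup_add)

lemma sum_monomials: "p = (\<Sum>m\<in>keys p. single m (lookup p m))"
proof (rule poly_mapping_eqI)
  fix k
  have "(\<Sum>m\<in>keys p. lookup (single m (lookup p m)) k) = (\<Sum>m\<in>keys p. if m = k then lookup p m else 0)"
    by (intro sum.cong) (auto simp: lookup_single when_def)
  also have "\<dots> = lookup p k" by (auto simp: sum.delta in_keys_iff)
  finally show "lookup p k = lookup (\<Sum>m\<in>keys p. single m (lookup p m)) k"
    by (simp add: lookup_sum)
qed

lemma mult_sum_monomials:
  fixes f g :: "'m::comm_monoid_add \<Rightarrow>\<^sub>0 'k::comm_semiring_0"
  shows "f * g = (\<Sum>a\<in>keys f. \<Sum>b\<in>keys g. single (a + b) (lookup f a * lookup g b))"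
proof -
  have "f * g = (\<Sum>a\<in>keys f. single a (lookup f a)) * (\<Sum>b\<in>keys g. single b (lookup g b))"
    using sum_monomials[of f] sum_monomials[of g] by simp
  then show ?thesis by (simp add: sum_product mult_single)
qed

lemma lookup_mult_unique:
  fixes f g :: "'m::comm_monoid_add \<Rightarrow>\<^sub>0 'k::comm_semiring_0"
  assumes "a \<in> keys f" "b \<in> keys g"
    and u: "\<And>a' b'. \<lbrakk>a' \<in> keys f; b' \<in> keys g; a' + b' = a + b\<rbrakk> \<Longrightarrow> a' = a \<and> b' = b"
  shows "lookup (f * g) (a + b) = lookup f a * lookup g b"
proof -
  have "lookup (f * g) (a + b) = (\<Sum>a'\<in>keys f. \<Sum>b'\<in>keys g.
      (if a' = a then if b' = b then lookup f a * lookup g b else 0 else 0))"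
    unfolding mult_sum_monomials[of f g] lookup_sum
    by (intro sum.cong refl) (use u in \<open>force simp: lookup_single when_def\<close>)
  also have "\<dots> = (\<Sum>a'\<in>keys f. if a' = a then lookup f a * lookup g b else 0)"
    using assms by (intro sum.cong refl) simp
  also have "\<dots> = lookup f a * lookup g b" using assms by simp
  finally show ?thesis .
qed

lemma ex_index_first:
  assumes "finite V" "C \<subseteq> V"
  obtains i :: "'v \<Rightarrow> nat" where "inj_on i V" "\<And>x k. \<lbrakk>x \<in> C; k < i x\<rbrakk> \<Longrightarrow> k \<in> i ` C"
proof -
  have "finite C" "finite (V - C)" using assms finite_subset by auto
  from finite_imp_inj_to_nat_seg[OF this(1)] finite_imp_inj_to_nat_seg[OF this(2)]
  obtain c n d l where c: "c ` C = {k. k < (n::nat)}" "inj_on c C"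
    and d: "d ` (V - C) = {k. k < (l::nat)}" "inj_on d (V - C)" by blast
  let ?i = "\<lambda>x. if x \<in> C then c x else n + d x"
  have lt: "c x < n" if "x \<in> C" for x using c that by blast
  have "inj_on ?i V"
  proof (rule inj_onI)
    fix x y assume "x \<in> V" "y \<in> V" "?i x = ?i y"
    then show "x = y"
      using lt[of x] lt[of y] inj_onD[OF c(2), of x y] inj_onD[OF d(2), of x y]
      by (auto split: if_splits)
  qed
  moreover have "k \<in> ?i ` C" if "x \<in> C" "k < ?i x" for x k
  proof -
    have "k \<in> c ` C" using c lt[of x] that by auto
    then show ?thesis by auto
  qed
  ultimately show thesis using that by blast
qed

text \<open>Renaming the variables to natural numbers makes the monomials linearly ordered, and the product
  of the smallest terms cannot cancel. If the variables of \<open>C\<close> come first, then the monomials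
  without variables of \<open>C\<close> are smaller than the others.\<close>

lemma smallest_terms:
  fixes A B :: "('v \<Rightarrow>\<^sub>0 nat) set"
  assumes V: "finite V" "C \<subseteq> V" and A: "finite A" "A \<noteq> {}" "\<And>m. m \<in> A \<Longrightarrow> keys m \<subseteq> V"
    and B: "finite B" "B \<noteq> {}" "\<And>m. m \<in> B \<Longrightarrow> keys m \<subseteq> V"
  obtains a b where "a \<in> A" "b \<in> B"
    "\<And>a' b'. \<lbrakk>a' \<in> A; b' \<in> B; a' + b' = a + b\<rbrakk> \<Longrightarrow> a' = a \<and> b' = b"
    "\<And>b'. \<lbrakk>b' \<in> B; keys b' \<inter> C = {}\<rbrakk> \<Longrightarrow> keys b \<inter> C = {}"
proof -
  obtain i :: "'v \<Rightarrow> nat" where i: "inj_on i V" "\<And>x k. \<lbrakk>x \<in> C; k < i x\<rbrakk> \<Longrightarrow> k \<in> i ` C"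
    using ex_index_first[OF V] by blast
  \<comment> \<open>The monomial is renamed along \<open>i\<close>. This map is additive and, on
    monomials over \<open>V\<close>, injective; its values are compared in the lexicographic order
    in which small indices dominate.\<close>
  define \<psi> where "\<psi> m = (\<Sum>x\<in>V. single (i x) (lookup m x))" for m :: "'v \<Rightarrow>\<^sub>0 nat"
  have add: "\<psi> (m + m') = \<psi> m + \<psi> m'" for m m'
    by (simp add: \<psi>_def lookup_add single_add sum.distrib)
  have look: "lookup (\<psi> m) (i x) = lookup m x" if "x \<in> V" for m x
  proof -
    have "lookup (\<psi> m) (i x) = (\<Sum>y\<in>V. if y = x then lookup m x else 0)"
      unfolding \<psi>_def lookup_sum
      by (intro sum.cong refl) (use inj_onD[OF i(1)] that in \<open>auto simp: lookup_single when_def\<close>)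
    then show ?thesis using that V by simp
  qed
  have inj: "m = m'" if "keys m \<subseteq> V" "keys m' \<subseteq> V" "\<psi> m = \<psi> m'" for m m'
  proof (rule poly_mapping_eqI)
    fix x show "lookup m x = lookup m' x"
    proof (cases "x \<in> V")
      case True then show ?thesis using look[OF True, of m] look[OF True, of m'] that by simp
    next
      case False then have "x \<notin> keys m" "x \<notin> keys m'" using that by auto
      then show ?thesis by (simp add: in_keys_iff)
    qed
  qed
  have least: "\<exists>a\<in>Y. \<forall>x\<in>Y. \<psi> a \<le> \<psi> x" if "finite Y" "Y \<noteq> {}" for Y
  proof -
    have "Min (\<psi> ` Y) \<in> \<psi> ` Y" using that by (intro Min_in) auto
    then obtain a where "a \<in> Y" "\<psi> a = Min (\<psi> ` Y)" by auto
    then show ?thesis using that by (intro bexI[of _ a]) auto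
  qed
  obtain a where a: "a \<in> A" "\<And>x. x \<in> A \<Longrightarrow> \<psi> a \<le> \<psi> x" using least[OF A(1,2)] by blast
  obtain b where b: "b \<in> B" "\<And>x. x \<in> B \<Longrightarrow> \<psi> b \<le> \<psi> x" using least[OF B(1,2)] by blast
  show thesis
  proof (rule that[OF a(1) b(1)])
    fix a' b' assume *: "a' \<in> A" "b' \<in> B" "a' + b' = a + b"
    then have "\<psi> a' + \<psi> b' = \<psi> a + \<psi> b" using add by metis
    then have "\<psi> a = \<psi> a'"
      using a(2)[OF *(1)] b(2)[OF *(2)] add_less_le_mono[of "\<psi> a" "\<psi> a'" "\<psi> b" "\<psi> b'"]
      by (metis order_le_less order_less_irrefl)
    then have "a = a'" using inj A(3) *(1) a(1) by blast
    then show "a' = a \<and> b' = b" using *(3) by simp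
  next
    fix b' assume b': "b' \<in> B" "keys b' \<inter> C = {}"
    show "keys b \<inter> C = {}"
    proof (rule ccontr)
      assume ne: "keys b \<inter> C \<noteq> {}"
      \<comment> \<open>At the least index of a variable of \<open>C\<close> in \<open>b\<close>
        only \<open>b\<close> has a positive exponent; all smaller indices belong to
        \<open>C\<close>, where both exponents vanish. So the renamed \<open>b'\<close> would be
        smaller than the renamed \<open>b\<close>.\<close>
      let ?X = "i ` (keys b \<inter> C)"
      have "Min ?X \<in> ?X" using ne by (intro Min_in) auto
      then obtain x where x: "x \<in> keys b" "x \<in> C" "i x = Min ?X" by auto
      have zero: "lookup (\<psi> b') (i y) = 0" if "y \<in> C" for y
      proof -
        have "y \<notin> keys b'" "y \<in> V" using that V b' by auto
        then show ?thesis using look[of y b'] by (simp add: in_keys_iff)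
      qed
      have "x \<in> V" using x V by blast
      then have "lookup (\<psi> b') (i x) < lookup (\<psi> b) (i x)"
        using zero[OF x(2)] look[of x b] x(1) by (simp add: in_keys_iff)
      moreover have "lookup (\<psi> b') k = lookup (\<psi> b) k" if k: "k < i x" for k
      proof -
        obtain y where y: "y \<in> C" "k = i y" using i(2)[OF x(2) k] by blast
        have "y \<notin> keys b"
        proof
          assume "y \<in> keys b"
          then have "Min ?X \<le> i y" using y by (intro Min_le) auto
          then show False using k x y by simp
        qed
        moreover have "y \<in> V" using y V by blast
        ultimately show ?thesis using zero[OF y(1)] look[of y b] y(2) by (simp add: in_keys_iff)
      qed
      ultimately have "\<psi> b' < \<psi> b" unfolding less_poly_mapping.rep_eq less_fun_def by blast
      then show False using b(2)[OF b'(1)] by simp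
    qed
  qed
qed

text \<open>The smallest monomial of \<open>f\<close> outside \<open>P\<close> times the smallest
  monomial of \<open>g\<close> cannot cancel: terms of \<open>f\<close> inside \<open>P\<close> only
  produce monomials inside \<open>P\<close>. The smallest monomial of \<open>g\<close> has no
  variable of \<open>C\<close>, because some monomial of \<open>g\<close> has none. One instance of
  \<open>P\<close> yields primality of \<open>var_prime\<close>, another controls the components of
  the edge ideal.\<close>

lemma mult_key_outside:
  fixes f g :: "('v, 'k::field) mvpoly"
  assumes V: "finite V" "C \<subseteq> V"
    and f: "\<And>m. m \<in> keys f \<Longrightarrow> keys m \<subseteq> V" and g: "\<And>m. m \<in> keys g \<Longrightarrow> keys m \<subseteq> V"
    and up: "\<And>m m'. P m \<Longrightarrow> P (m + m')" and out: "\<And>m m'. \<lbrakk>keys m' \<inter> C = {}; P (m + m')\<rbrakk> \<Longrightarrow> P m"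
    and a: "a0 \<in> keys f" "\<not> P a0" and b: "b0 \<in> keys g" "keys b0 \<inter> C = {}"
  shows "\<exists>k\<in>keys (f * g). \<not> P k"
proof -
  let ?A = "{a \<in> keys f. \<not> P a}"
  have A: "finite ?A" "?A \<noteq> {}" "\<And>m. m \<in> ?A \<Longrightarrow> keys m \<subseteq> V" using a f by auto
  have B: "finite (keys g)" "keys g \<noteq> {}" using b by auto
  obtain a b where ab: "a \<in> ?A" "b \<in> keys g"
      "\<And>a' b'. \<lbrakk>a' \<in> ?A; b' \<in> keys g; a' + b' = a + b\<rbrakk> \<Longrightarrow> a' = a \<and> b' = b"
      "\<And>b'. \<lbrakk>b' \<in> keys g; keys b' \<inter> C = {}\<rbrakk> \<Longrightarrow> keys b \<inter> C = {}"
    by (rule smallest_terms[OF V A B g], assumption, assumption) (rule that)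
  have nP: "\<not> P (a + b)" using ab(1) out[OF ab(4)[OF b]] by blast
  have "lookup (f * g) (a + b) = lookup f a * lookup g b"
  proof (rule lookup_mult_unique)
    fix a' b' assume *: "a' \<in> keys f" "b' \<in> keys g" "a' + b' = a + b"
    then have "\<not> P a'" using up[of a' b'] nP by auto
    then show "a' = a \<and> b' = b" using ab(3) * by blast
  qed (use ab in auto)
  then have "a + b \<in> keys (f * g)" using ab by (simp add: in_keys_iff)
  then show ?thesis using nP by blast
qed

lemma mvpoly_ring_simps [simp]:
  "carrier (mvpoly_ring V) = {p. \<forall>m\<in>keys p. keys m \<subseteq> V}"
  "p \<otimes>\<^bsub>mvpoly_ring V\<^esub> q = p * q" "p \<oplus>\<^bsub>mvpoly_ring V\<^esub> q = p + q"
  "\<one>\<^bsub>mvpoly_ring V\<^esub> = 1" "\<zero>\<^bsub>mvpoly_ring V\<^esub> = 0"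
  by (simp_all add: mvpoly_ring_def ring_of_type_algebra_def)

lemma keys_mult_nat_subset:
  fixes p q :: "('v, 'k::field) mvpoly"
  assumes "\<forall>m\<in>keys p. keys m \<subseteq> V" "\<forall>m\<in>keys q. keys m \<subseteq> V" "m \<in> keys (p * q)"
  shows "keys m \<subseteq> V"
proof -
  obtain a b where "a \<in> keys p" "b \<in> keys q" "m = a + b" using keys_mult[of p q] assms(3) by blast
  then show ?thesis using assms(1,2) by (auto simp: keys_add_nat)
qed

lemma keys_add_cases: "m \<in> keys (p + q) \<Longrightarrow> m \<in> keys p \<or> m \<in> keys q"
  using Poly_Mapping.keys_add[of p q] by blast

lemma keys_uminus: "keys (- p) = keys (p :: 'a \<Rightarrow>\<^sub>0 'b::ab_group_add)"
  by (auto simp: in_keys_iff)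

lemma cring_mvpoly_ring: "cring (mvpoly_ring V :: ('v, 'k::field) mvpoly ring)"
proof (rule cringI)
  show "abelian_group (mvpoly_ring V :: ('v, 'k::field) mvpoly ring)"
  proof (rule abelian_groupI)
    fix x :: "('v, 'k) mvpoly" assume "x \<in> carrier (mvpoly_ring V)"
    then show "\<exists>y\<in>carrier (mvpoly_ring V). y \<oplus>\<^bsub>mvpoly_ring V\<^esub> x = \<zero>\<^bsub>mvpoly_ring V\<^esub>"
      by (intro bexI[of _ "- x"]) (auto simp: keys_uminus)
  qed (auto dest!: keys_add_cases simp: algebra_simps)
  show "Group.comm_monoid (mvpoly_ring V :: ('v, 'k::field) mvpoly ring)"
    by (rule comm_monoidI) (auto intro: keys_mult_nat_subset[THEN subsetD] simp: algebra_simps)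
qed (simp add: algebra_simps)

text \<open>Given by a predicate on monomials instead of generators, so that membership is checked
  term by term; it is an ideal when \<open>P\<close> is closed under multiplication by
  monomials.\<close>

definition monomial_ideal :: "'v set \<Rightarrow> (('v \<Rightarrow>\<^sub>0 nat) \<Rightarrow> bool) \<Rightarrow> ('v, 'k::field) mvpoly set" where
  "monomial_ideal V P = {p. \<forall>m\<in>keys p. keys m \<subseteq> V \<and> P m}"

lemma monomial_ideal_ideal:
  assumes up: "\<And>m m'. P m \<Longrightarrow> P (m + m')"
  shows "ideal (monomial_ideal V P) (mvpoly_ring V :: ('v, 'k::field) mvpoly ring)"
proof -
  let ?R = "mvpoly_ring V :: ('v, 'k::field) mvpoly ring"
  let ?I = "monomial_ideal V P :: ('v, 'k) mvpoly set"
  interpret R: cring ?R by (rule cring_mvpoly_ring)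
  have mult: "x * a \<in> ?I" if "a \<in> ?I" "x \<in> carrier ?R" for a x
    unfolding monomial_ideal_def
  proof (intro CollectI ballI conjI)
    fix m assume m: "m \<in> keys (x * a)"
    then obtain b c where bc: "b \<in> keys x" "c \<in> keys a" "m = b + c" using keys_mult[of x a] by blast
    then show "keys m \<subseteq> V" "P m"
      using that up[of c b] by (auto simp: monomial_ideal_def keys_add_nat add.commute)
  qed
  show ?thesis
  proof (rule idealI)
    show "ring ?R" by unfold_locales
    show "subgroup ?I (add_monoid ?R)"
    proof (rule R.add.subgroupI)
      show "?I \<subseteq> carrier ?R" by (auto simp: monomial_ideal_def)
      have "0 \<in> ?I" by (simp add: monomial_ideal_def)
      then show "?I \<noteq> {}" by blast
      show "\<ominus>\<^bsub>?R\<^esub> a \<in> ?I" if "a \<in> ?I" for a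
      proof -
        have "\<ominus>\<^bsub>?R\<^esub> a = - a"
          by (rule R.minus_equality) (use that in \<open>auto simp: monomial_ideal_def keys_uminus\<close>)
        then show ?thesis using that by (simp add: monomial_ideal_def keys_uminus)
      qed
      show "a \<oplus>\<^bsub>?R\<^esub> b \<in> ?I" if "a \<in> ?I" "b \<in> ?I" for a b
        using that by (auto simp: monomial_ideal_def dest!: keys_add_cases)
    qed
    show "x \<otimes>\<^bsub>?R\<^esub> a \<in> ?I" "a \<otimes>\<^bsub>?R\<^esub> x \<in> ?I" if "a \<in> ?I" "x \<in> carrier ?R" for a x
      using mult[OF that] by (simp_all add: mult.commute)
  qed
qed

lemma ideal_sum_closed:
  assumes I: "ideal I (mvpoly_ring V :: ('v, 'k::field) mvpoly ring)" and "\<And>x. x \<in> A \<Longrightarrow> f x \<in> I"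
  shows "(\<Sum>x\<in>A. f x) \<in> I"
proof -
  note sub = ideal.axioms(1)[OF I]
  have "0 \<in> I" "\<And>a b. a \<in> I \<Longrightarrow> b \<in> I \<Longrightarrow> a + b \<in> I"
    using additive_subgroup.zero_closed[OF sub] additive_subgroup.a_closed[OF sub] by simp_all
  then show ?thesis using assms(2) by (induction A rule: infinite_finite_induct) auto
qed

lemma monomial_ideal_subset:
  assumes I: "ideal I (mvpoly_ring V :: ('v, 'k::field) mvpoly ring)"
    and gen: "\<And>m. \<lbrakk>keys m \<subseteq> V; P m\<rbrakk> \<Longrightarrow> \<exists>a b. m = a + b \<and> single b 1 \<in> I"
  shows "monomial_ideal V P \<subseteq> I"
proof
  fix p :: "('v, 'k) mvpoly" assume p: "p \<in> monomial_ideal V P"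
  interpret ideal I "mvpoly_ring V" by (rule I)
  have "single m (lookup p m) \<in> I" if "m \<in> keys p" for m
  proof -
    have "keys m \<subseteq> V" "P m" using p that by (auto simp: monomial_ideal_def)
    then obtain a b where ab: "m = a + b" "single b 1 \<in> I" using gen[of m] by blast
    have "keys a \<subseteq> V" using \<open>keys m \<subseteq> V\<close> by (simp add: ab(1) keys_add_nat)
    then have "single a (lookup p m) \<in> carrier (mvpoly_ring V)" by simp
    from I_l_closed[OF ab(2) this] show ?thesis by (simp add: mult_single ab(1))
  qed
  then have "(\<Sum>m\<in>keys p. single m (lookup p m)) \<in> I" by (rule ideal_sum_closed[OF I])
  then show "p \<in> I" using sum_monomials[of p] by simp
qed

text \<open>The ideal generated by the variables in \<open>C\<close>, written through its
  monomials.\<close>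

definition var_prime :: "'v set \<Rightarrow> 'v set \<Rightarrow> ('v, 'k::field) mvpoly set" where
  "var_prime V C = monomial_ideal V (\<lambda>m. keys m \<inter> C \<noteq> {})"

lemma var_prime_iff:
  "p \<in> var_prime V C \<longleftrightarrow> p \<in> carrier (mvpoly_ring V) \<and> (\<forall>m\<in>keys p. keys m \<inter> C \<noteq> {})"
  by (auto simp: var_prime_def monomial_ideal_def)

lemma primeideal_var_prime:
  assumes "finite V" "C \<subseteq> V"
  shows "primeideal (var_prime V C) (mvpoly_ring V :: ('v, 'k::field) mvpoly ring)"
proof (rule primeidealI)
  show "ideal (var_prime V C) (mvpoly_ring V)"
    unfolding var_prime_def by (rule monomial_ideal_ideal) (auto simp: keys_add_nat)
  show "cring (mvpoly_ring V)" by (rule cring_mvpoly_ring)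
  have "1 \<notin> var_prime V C" by (simp add: var_prime_iff)
  moreover have "1 \<in> carrier (mvpoly_ring V)" by simp
  ultimately show "carrier (mvpoly_ring V) \<noteq> var_prime V C" by blast
  fix f g :: "('v, 'k) mvpoly"
  assume fg: "f \<in> carrier (mvpoly_ring V)" "g \<in> carrier (mvpoly_ring V)"
    "f \<otimes>\<^bsub>mvpoly_ring V\<^esub> g \<in> var_prime V C"
  show "f \<in> var_prime V C \<or> g \<in> var_prime V C"
  proof (rule ccontr)
    assume "\<not> ?thesis"
    then obtain a b where "a \<in> keys f" "keys a \<inter> C = {}" "b \<in> keys g" "keys b \<inter> C = {}"
      using fg by (auto simp: var_prime_iff)
    then have "\<exists>k\<in>keys (f * g). \<not> keys k \<inter> C \<noteq> {}"
      using fg by (intro mult_key_outside[OF assms, of f g _ a b]) (auto simp: keys_add_nat)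
    then show False using fg by (auto simp: var_prime_iff)
  qed
qed

section \<open>The height of an ideal generated by variables\<close>

lemma card_monomials:
  assumes W: "finite W"
  shows "finite {m :: 'v \<Rightarrow>\<^sub>0 nat. keys m \<subseteq> W \<and> (\<forall>x. lookup m x \<le> d)}"
    and "card {m :: 'v \<Rightarrow>\<^sub>0 nat. keys m \<subseteq> W \<and> (\<forall>x. lookup m x \<le> d)} = Suc d ^ card W"
proof -
  let ?M = "{m :: 'v \<Rightarrow>\<^sub>0 nat. keys m \<subseteq> W \<and> (\<forall>x. lookup m x \<le> d)}"
  let ?h = "\<lambda>m. restrict (lookup m) W"
  have "bij_betw ?h ?M (PiE W (\<lambda>_. {..d}))"
  proof (rule bij_betwI')
    fix m m' assume m: "m \<in> ?M" "m' \<in> ?M"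
    show "?h m = ?h m' \<longleftrightarrow> m = m'"
    proof
      assume eq: "?h m = ?h m'"
      show "m = m'"
      proof (rule poly_mapping_eqI)
        fix x show "lookup m x = lookup m' x"
        proof (cases "x \<in> W")
          case True then show ?thesis using fun_cong[OF eq, of x] by simp
        next
          case False
          then have "x \<notin> keys m" "x \<notin> keys m'" using m by auto
          then show ?thesis by (simp add: in_keys_iff)
        qed
      qed
    qed simp
  next
    fix m assume "m \<in> ?M" then show "?h m \<in> PiE W (\<lambda>_. {..d})" by auto
  next
    fix g assume g: "g \<in> PiE W (\<lambda>_. {..d})"
    let ?m = "Abs_poly_mapping (\<lambda>x. if x \<in> W then g x else 0)"
    have "finite {x. (if x \<in> W then g x else 0) \<noteq> 0}" by (rule finite_subset[OF _ W]) auto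
    then have l: "lookup ?m x = (if x \<in> W then g x else 0)" for x by simp
    have "?m \<in> ?M" using g by (auto simp: l in_keys_iff split: if_splits)
    moreover have "g = ?h ?m"
    proof
      show "g x = ?h ?m x" for x using PiE_arb[OF g, of x] by (simp add: l)
    qed
    ultimately show "\<exists>m\<in>?M. g = ?h m" by blast
  qed
  note b = this
  show "finite ?M" using bij_betw_finite[OF b] W by (simp add: finite_PiE)
  show "card ?M = Suc d ^ card W" using bij_betw_same_card[OF b] W by (simp add: card_PiE)
qed

text \<open>Gaussian elimination: an equation with a non-zero coefficient at \<open>p\<close>
  removes the unknown \<open>p\<close> from the others, and the value at \<open>p\<close> is
  computed at the end.\<close>

lemma ex_nontrivial_relation:
  fixes a :: "'i \<Rightarrow> 'j \<Rightarrow> 'k::field"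
  assumes "finite A" "finite J" "card A < card J"
  shows "\<exists>c. (\<exists>j\<in>J. c j \<noteq> 0) \<and> (\<forall>i\<in>A. (\<Sum>j\<in>J. c j * a i j) = 0)"
  using assms
proof (induction A arbitrary: J a rule: finite_induct)
  case empty
  then have "J \<noteq> {}" by auto
  then show ?case by (intro exI[of _ "\<lambda>_. 1"]) auto
next
  case (insert i0 A)
  show ?case
  proof (cases "\<exists>p\<in>J. a i0 p \<noteq> 0")
    case False
    have "card A < card J" using insert by simp
    from insert.IH[OF insert.prems(1) this, of a]
    obtain c where "\<exists>j\<in>J. c j \<noteq> 0" "\<forall>i\<in>A. (\<Sum>j\<in>J. c j * a i j) = 0" by blast
    then show ?thesis using False by (intro exI[of _ c]) auto
  next
    case True
    then obtain p where p: "p \<in> J" "a i0 p \<noteq> 0" by blast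
    let ?J = "J - {p}"
    let ?a = "\<lambda>i j. a i j - a i p * a i0 j / a i0 p"
    have "card A < card ?J" using insert p by simp
    from insert.IH[OF _ this, of ?a] insert.prems(1)
    obtain c where c: "\<exists>j\<in>?J. c j \<noteq> 0" "\<And>i. i \<in> A \<Longrightarrow> (\<Sum>j\<in>?J. c j * ?a i j) = 0" by auto
    define S where "S = (\<Sum>j\<in>?J. c j * a i0 j)"
    let ?c = "\<lambda>j. if j = p then - S / a i0 p else c j"
    have sum: "(\<Sum>j\<in>J. ?c j * a i j) = (\<Sum>j\<in>?J. c j * a i j) - S / a i0 p * a i p" for i
    proof -
      have "(\<Sum>j\<in>J. ?c j * a i j) = ?c p * a i p + (\<Sum>j\<in>?J. ?c j * a i j)"
        using insert.prems(1) p(1) by (rule sum.remove)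
      moreover have "(\<Sum>j\<in>?J. ?c j * a i j) = (\<Sum>j\<in>?J. c j * a i j)"
        by (intro sum.cong) auto
      ultimately show ?thesis by simp
    qed
    have "(\<Sum>j\<in>J. ?c j * a i j) = 0" if "i \<in> insert i0 A" for i
    proof (cases "i = i0")
      case True then show ?thesis unfolding sum using p(2) by (simp add: S_def)
    next
      case False
      then have "(\<Sum>j\<in>?J. c j * ?a i j) = 0" using c that by blast
      moreover have "(\<Sum>j\<in>?J. c j * ?a i j) = (\<Sum>j\<in>?J. c j * a i j) - (\<Sum>j\<in>?J. (c j * a i0 j) * (a i p / a i0 p))"
        unfolding sum_subtractf[symmetric] by (intro sum.cong) (auto simp: algebra_simps)
      moreover have "(\<Sum>j\<in>?J. (c j * a i0 j) * (a i p / a i0 p)) = S * (a i p / a i0 p)"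
        by (simp only: S_def sum_distrib_right)
      ultimately show ?thesis unfolding sum by simp
    qed
    moreover have "\<exists>j\<in>J. ?c j \<noteq> 0" using c(1) by auto
    ultimately show ?thesis by (intro exI[of _ ?c] conjI ballI)
  qed
qed

text \<open>Linear independence over the field in the quotient by \<open>Q\<close>;
  \<open>single 0 (c j)\<close> is the constant polynomial \<open>c j\<close>.\<close>

definition independent_mod ::
    "('v, 'k::field) mvpoly set \<Rightarrow> 'i set \<Rightarrow> ('i \<Rightarrow> ('v, 'k) mvpoly) \<Rightarrow> bool" where
  "independent_mod Q J b \<longleftrightarrow> (\<forall>c. (\<Sum>j\<in>J. single 0 (c j) * b j) \<in> Q \<longrightarrow> (\<forall>j\<in>J. c j = 0))"

text \<open>A bound on the degree in each variable separately, so that the admissible monomials form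
  a box and are counted by a power.\<close>

definition exponents_le :: "nat \<Rightarrow> ('v, 'k::field) mvpoly \<Rightarrow> bool" where
  "exponents_le e p \<longleftrightarrow> (\<forall>m\<in>keys p. \<forall>x. lookup m x \<le> e)"

lemma exponents_le_mult:
  "exponents_le d p \<Longrightarrow> exponents_le e q \<Longrightarrow> exponents_le (d + e) (p * q)"
  using keys_mult[of p q] unfolding exponents_le_def
  by (force simp: lookup_add intro: add_mono)

lemma exponents_le_power: "exponents_le e p \<Longrightarrow> exponents_le (e * k) (p ^ k)"
proof (induction k)
  case (Suc k)
  then show ?case using exponents_le_mult[of e p "e * k" "p ^ k"] by simp
qed (simp add: exponents_le_def)

lemma exponents_le_mono: "exponents_le d p \<Longrightarrow> d \<le> e \<Longrightarrow> exponents_le e p"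
  unfolding exponents_le_def by (meson order_trans)

lemma ex_exponents_le: "\<exists>e. exponents_le e p"
proof -
  let ?S = "(\<lambda>(m, x). lookup m x) ` (SIGMA m:keys p. keys m)"
  have "lookup m x \<le> Max (insert 0 ?S)" if "m \<in> keys p" for m x
  proof (cases "x \<in> keys m")
    case True
    then have "lookup m x \<in> ?S" using that by force
    then show ?thesis by (intro Max_ge) auto
  next
    case False then show ?thesis by (simp add: in_keys_iff)
  qed
  then show ?thesis unfolding exponents_le_def by blast
qed

lemma independent_mod_reindex:
  fixes Q :: "('v, 'k::field) mvpoly set"
  assumes h: "bij_betw h I J" and b: "independent_mod Q J b"
  shows "independent_mod Q I (\<lambda>i. b (h i))"
  unfolding independent_mod_def
proof (intro allI impI ballI)
  fix c i
  assume c: "(\<Sum>j\<in>I. single 0 (c j) * b (h j)) \<in> Q" and i: "i \<in> I"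
  let ?c = "\<lambda>j. c (inv_into I h j)"
  have "(\<Sum>j\<in>J. single 0 (?c j) * b j) = (\<Sum>j\<in>I. single 0 (?c (h j)) * b (h j))"
    by (rule sum.reindex_bij_betw[OF h, symmetric])
  also have "\<dots> = (\<Sum>j\<in>I. single 0 (c j) * b (h j))"
    using h by (intro sum.cong) (auto simp: bij_betw_def)
  finally have "(\<Sum>j\<in>J. single 0 (?c j) * b j) \<in> Q" using c by simp
  then have "\<forall>j\<in>J. ?c j = 0" by (rule b[unfolded independent_mod_def, THEN spec, THEN mp])
  moreover have "h i \<in> J" using h i by (auto simp: bij_betw_def)
  ultimately show "c i = 0" using h i by (auto simp: bij_betw_def)
qed

text \<open>Modulo \<open>Q'\<close> only the part with \<open>k = 0\<close> of a relation survives,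
  since \<open>f \<in> Q'\<close>, and its coefficients vanish. The rest is a multiple of
  \<open>f\<close>, which can be cancelled because \<open>Q\<close> is prime and
  \<open>f \<notin> Q\<close>; induction on the highest power of \<open>f\<close> finishes.\<close>

lemma independent_mod_powers:
  fixes b :: "nat \<Rightarrow> ('v, 'k::field) mvpoly"
  assumes Q: "primeideal Q (mvpoly_ring V)" and Q': "ideal Q' (mvpoly_ring V)" "Q \<subseteq> Q'"
    and f: "f \<in> Q'" "f \<notin> Q" "f \<in> carrier (mvpoly_ring V)"
    and b: "independent_mod Q' {..<N} b" "\<And>i. i < N \<Longrightarrow> b i \<in> carrier (mvpoly_ring V)"
  shows "independent_mod Q ({..d} \<times> {..<N}) (\<lambda>(k, i). f ^ k * b i)"
proof -
  let ?R = "mvpoly_ring V :: ('v, 'k) mvpoly ring"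
  interpret R: cring ?R by (rule cring_mvpoly_ring)
  have mult: "p * q \<in> carrier ?R" if "p \<in> carrier ?R" "q \<in> carrier ?R" for p q
    using R.m_closed[OF that] by simp
  have add: "p + q \<in> carrier ?R" if "p \<in> carrier ?R" "q \<in> carrier ?R" for p q
    using R.a_closed[OF that] by simp
  have diff: "p - q \<in> X'" if "ideal X' ?R" "p \<in> X'" "q \<in> X'" for p q X'
  proof -
    interpret ideal X' ?R by (rule that(1))
    have "- q \<in> X'" using I_l_closed[OF that(3), of "- 1"] by (simp add: keys_uminus)
    then have "p \<oplus>\<^bsub>?R\<^esub> (- q) \<in> X'" by (intro a_closed that)
    then show ?thesis by simp
  qed
  have sumc: "(\<Sum>x\<in>A. g x) \<in> carrier ?R" if "\<And>x. x \<in> A \<Longrightarrow> g x \<in> carrier ?R" for A and g :: "'z \<Rightarrow> _"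
    by (rule ideal_sum_closed[OF R.oneideal]) (use that in auto)
  let ?h = "\<lambda>c k. \<Sum>i<N. single 0 (c k i) * b i"
  have hc: "?h c k \<in> carrier ?R" for c :: "nat \<Rightarrow> nat \<Rightarrow> 'k" and k
    by (rule sumc, rule mult) (use b(2) in auto)
  have powc: "f ^ k \<in> carrier ?R" for k
  proof (induction k)
    case (Suc k) then show ?case using mult[OF f(3) Suc] by simp
  qed simp
  have fc: "(\<Sum>k\<le>d. f ^ k * ?h c k) \<in> carrier ?R" for c d
    by (rule sumc, rule mult) (use powc hc in auto)
  have main: "(\<Sum>k\<le>d. f ^ k * ?h c k) \<in> Q \<Longrightarrow> k \<le> d \<Longrightarrow> i < N \<Longrightarrow> c k i = 0"
    for c :: "nat \<Rightarrow> nat \<Rightarrow> 'k" and d k i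
  proof (induction d arbitrary: c k)
    case 0
    then have "?h c 0 \<in> Q'" using Q'(2) by auto
    then have "\<forall>i\<in>{..<N}. c 0 i = 0"
      by (rule b(1)[unfolded independent_mod_def, THEN spec, THEN mp])
    then show ?case using 0 by simp
  next
    case (Suc d)
    let ?T = "\<Sum>k\<le>d. f ^ k * ?h (\<lambda>k. c (Suc k)) k"
    have eq: "(\<Sum>k\<le>Suc d. f ^ k * ?h c k) = ?h c 0 + f * ?T"
      by (simp only: sum.atMost_Suc_shift sum_distrib_left) (simp add: mult.assoc)
    interpret I': ideal Q' ?R by (rule Q'(1))
    have "f * ?T \<in> Q'" using I'.I_r_closed[OF f(1) fc] by simp
    moreover have "?h c 0 + f * ?T \<in> Q'" using Suc.prems(1) Q'(2) eq by auto
    ultimately have "?h c 0 \<in> Q'" using diff[OF Q'(1)] by fastforce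
    then have "\<forall>i\<in>{..<N}. c 0 i = 0"
      by (rule b(1)[unfolded independent_mod_def, THEN spec, THEN mp])
    then have c0: "\<And>i. i < N \<Longrightarrow> c 0 i = 0" by simp
    then have "?h c 0 = 0" by simp
    then have "f * ?T \<in> Q" using Suc.prems(1) eq by simp
    then have "f \<otimes>\<^bsub>?R\<^esub> ?T \<in> Q" by simp
    then have "f \<in> Q \<or> ?T \<in> Q" by (rule primeideal.I_prime[OF Q f(3) fc])
    then have "?T \<in> Q" using f(2) by blast
    from Suc.IH[OF this] have "\<And>k. k \<le> d \<Longrightarrow> c (Suc k) i = 0" using Suc.prems by blast
    then show ?case using c0 Suc.prems by (cases k) auto
  qed
  show ?thesis
    unfolding independent_mod_def
  proof (intro allI impI ballI)
    fix c :: "nat \<times> nat \<Rightarrow> 'k" and j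
    assume "(\<Sum>j\<in>{..d} \<times> {..<N}. single 0 (c j) * (case j of (k, i) \<Rightarrow> f ^ k * b i)) \<in> Q"
      and j: "j \<in> {..d} \<times> {..<N}"
    then have "(\<Sum>k\<le>d. f ^ k * ?h (\<lambda>k i. c (k, i)) k) \<in> Q"
      by (simp only: sum_distrib_left sum.cartesian_product split_def mult.left_commute fst_conv snd_conv
          prod.collapse)
    from main[OF this] j show "c j = 0" by auto
  qed
qed

text \<open>With more elements than monomials in the box, a non-trivial combination is the zero
  polynomial, which lies in \<open>Q\<close>.\<close>

lemma independent_mod_card_le:
  fixes b :: "nat \<Rightarrow> ('v, 'k::field) mvpoly"
  assumes V: "finite V" and Q: "0 \<in> Q" and b: "independent_mod Q {..<N} b"
    "\<And>i. i < N \<Longrightarrow> b i \<in> carrier (mvpoly_ring V)" "\<And>i. i < N \<Longrightarrow> exponents_le e (b i)"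
  shows "N \<le> Suc e ^ card V"
proof (rule ccontr)
  let ?M = "{m :: 'v \<Rightarrow>\<^sub>0 nat. keys m \<subseteq> V \<and> (\<forall>x. lookup m x \<le> e)}"
  assume "\<not> ?thesis"
  then have "card ?M < card {..<N}" using card_monomials(2)[OF V, of e] by simp
  from ex_nontrivial_relation[OF card_monomials(1)[OF V] _ this, of "\<lambda>m j. lookup (b j) m"]
  obtain c where c: "\<exists>j\<in>{..<N}. c j \<noteq> 0" "\<And>m. m \<in> ?M \<Longrightarrow> (\<Sum>j<N. c j * lookup (b j) m) = 0"
    by auto
  have "(\<Sum>j<N. single 0 (c j) * b j) = 0"
  proof (rule poly_mapping_eqI)
    fix m
    have l: "lookup (single 0 (c j) * b j) m = c j * lookup (b j) m" for j
      by (simp add: mult_map_scale_conv_mult[symmetric] Poly_Mapping.map.rep_eq when_def)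
    have "(\<Sum>j<N. c j * lookup (b j) m) = 0"
    proof (cases "m \<in> ?M")
      case False
      then have "m \<notin> keys (b j)" if "j < N" for j
        using b(2,3)[OF that] by (auto simp: exponents_le_def)
      then show ?thesis by (simp add: in_keys_iff)
    qed (rule c(2))
    then show "lookup (\<Sum>j<N. single 0 (c j) * b j) m = lookup 0 m" by (simp add: lookup_sum l)
  qed
  then have "(\<Sum>j<N. single 0 (c j) * b j) \<in> Q" using Q by simp
  then have "\<forall>j\<in>{..<N}. c j = 0" by (rule b(1)[unfolded independent_mod_def, THEN spec, THEN mp])
  then show False using c(1) by blast
qed

text \<open>At the top of the chain the monomials in the variables outside \<open>C\<close> are
  independent. Each step down multiplies the number of independent elements by \<open>Suc d\<close>,
  through the powers of one element, while the bound on exponents stays linear in \<open>d\<close>.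
  The exponent \<open>n + card (V - C)\<close> thus acts like the degree of a Hilbert
  function.\<close>

lemma ex_independent_family:
  fixes Q :: "nat \<Rightarrow> ('v, 'k::field) mvpoly set"
  assumes V: "finite V" and "C \<subseteq> V"
    and "\<And>i. i \<le> n \<Longrightarrow> primeideal (Q i) (mvpoly_ring V)" "\<And>i. i < n \<Longrightarrow> Q i \<subset> Q (Suc i)"
    and "Q n = var_prime V C"
  shows "\<exists>e. \<forall>d. \<exists>b. independent_mod (Q 0) {..<Suc d ^ (n + card (V - C))} b \<and>
    (\<forall>i<Suc d ^ (n + card (V - C)). b i \<in> carrier (mvpoly_ring V) \<and> exponents_le (e * d) (b i))"
  using assms(3-5)
proof (induction n arbitrary: Q)
  case 0
  have fin: "finite (V - C)" using V by simp
  have "\<exists>b. independent_mod (Q 0) {..<Suc d ^ card (V - C)} b \<and>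
    (\<forall>i<Suc d ^ card (V - C). b i \<in> carrier (mvpoly_ring V) \<and> exponents_le d (b i))" for d
  proof -
    let ?M = "{m :: 'v \<Rightarrow>\<^sub>0 nat. keys m \<subseteq> V - C \<and> (\<forall>x. lookup m x \<le> d)}"
    note M = card_monomials[OF fin, of d]
    obtain h where h: "bij_betw h {..<Suc d ^ card (V - C)} ?M"
      using ex_bij_betw_nat_finite[OF M(1)] M(2) by (auto simp: atLeast0LessThan)
    have "independent_mod (Q 0) ?M (\<lambda>m. single m 1)"
      unfolding independent_mod_def
    proof (intro allI impI ballI)
      fix c m assume c: "(\<Sum>j\<in>?M. single 0 (c j) * single j 1) \<in> Q 0" and m: "m \<in> ?M"
      have "lookup (\<Sum>j\<in>?M. single 0 (c j) * single j 1) m = (\<Sum>j\<in>?M. if j = m then c m else 0)"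
        unfolding lookup_sum mult_single
        by (intro sum.cong) (auto simp: lookup_single when_def)
      also have "\<dots> = c m" using M(1) m by simp
      finally have "c m \<noteq> 0 \<Longrightarrow> m \<in> keys (\<Sum>j\<in>?M. single 0 (c j) * single j 1)"
        by (simp add: in_keys_iff)
      moreover have "keys m \<inter> C = {}" using m by auto
      moreover have "(\<Sum>j\<in>?M. single 0 (c j) * single j 1) \<in> var_prime V C" using c 0(3) by simp
      ultimately show "c m = 0" unfolding var_prime_iff by blast
    qed
    from independent_mod_reindex[OF h this]
    have "independent_mod (Q 0) {..<Suc d ^ card (V - C)} (\<lambda>i. single (h i) 1)" .
    moreover have "single (h i) 1 \<in> carrier (mvpoly_ring V) \<and> exponents_le d (single (h i) (1::'k))"
      if "i < Suc d ^ card (V - C)" for i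
    proof -
      have "h i \<in> ?M" using h that by (auto simp: bij_betw_def)
      then show ?thesis by (auto simp: exponents_le_def)
    qed
    ultimately show ?thesis by blast
  qed
  then show ?case by (intro exI[of _ 1]) simp
next
  case (Suc n)
  from Suc.IH[of "\<lambda>i. Q (Suc i)"] Suc.prems obtain e where
    e: "\<And>d. \<exists>b. independent_mod (Q (Suc 0)) {..<Suc d ^ (n + card (V - C))} b \<and>
    (\<forall>i<Suc d ^ (n + card (V - C)). b i \<in> carrier (mvpoly_ring V) \<and> exponents_le (e * d) (b i))"
    by auto
  have sub: "Q 0 \<subset> Q (Suc 0)" using Suc.prems(2)[of 0] by simp
  then obtain f where f: "f \<in> Q (Suc 0)" "f \<notin> Q 0" by blast
  have Q: "primeideal (Q 0) (mvpoly_ring V)" using Suc.prems(1)[of 0] by simp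
  have "primeideal (Q (Suc 0)) (mvpoly_ring V)" using Suc.prems(1)[of "Suc 0"] by simp
  then have Q': "ideal (Q (Suc 0)) (mvpoly_ring V)" by (rule primeideal.axioms)
  have fc: "f \<in> carrier (mvpoly_ring V)" using ideal.Icarr[OF Q' f(1)] .
  obtain e' where e': "exponents_le e' f" using ex_exponents_le by blast
  have "\<exists>b. independent_mod (Q 0) {..<Suc d ^ (Suc n + card (V - C))} b \<and>
    (\<forall>i<Suc d ^ (Suc n + card (V - C)). b i \<in> carrier (mvpoly_ring V) \<and> exponents_le ((e' + e) * d) (b i))" for d
  proof -
    let ?N = "Suc d ^ (n + card (V - C))"
    let ?J = "{..d} \<times> {..<?N}"
    obtain b where b: "independent_mod (Q (Suc 0)) {..<?N} b"
      "\<And>i. i < ?N \<Longrightarrow> b i \<in> carrier (mvpoly_ring V)" "\<And>i. i < ?N \<Longrightarrow> exponents_le (e * d) (b i)"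
      using e[of d] by blast
    have "card ?J = Suc d ^ (Suc n + card (V - C))" by (simp add: card_cartesian_product)
    then obtain h where h: "bij_betw h {..<Suc d ^ (Suc n + card (V - C))} ?J"
      using ex_bij_betw_nat_finite[of ?J] by (auto simp: atLeast0LessThan)
    have ind: "independent_mod (Q 0) ?J (\<lambda>(k, i). f ^ k * b i)"
      using sub by (intro independent_mod_powers[OF Q Q' _ f fc b(1,2)]) auto
    have ok: "(\<lambda>(k, i). f ^ k * b i) j \<in> carrier (mvpoly_ring V) \<and>
        exponents_le ((e' + e) * d) ((\<lambda>(k, i). f ^ k * b i) j)" if jJ: "j \<in> ?J" for j
    proof -
      obtain k i where j: "j = (k, i)" "k \<le> d" "i < ?N" using jJ by (elim SigmaE) simp
      interpret R: cring "mvpoly_ring V :: ('v, 'k) mvpoly ring" by (rule cring_mvpoly_ring)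
      have "f ^ l \<in> carrier (mvpoly_ring V)" for l
      proof (induction l)
        case (Suc l) then show ?case using R.m_closed[OF fc Suc] by simp
      qed simp
      from R.m_closed[OF this b(2)[OF j(3)]] have "f ^ k * b i \<in> carrier (mvpoly_ring V)" by simp
      moreover have "exponents_le (e' * k + e * d) (f ^ k * b i)"
        using exponents_le_mult[OF exponents_le_power[OF e'] b(3)[OF j(3)]] .
      moreover have "e' * k + e * d \<le> (e' + e) * d" using j(2) by (simp add: algebra_simps)
      ultimately show ?thesis using j exponents_le_mono by auto
    qed
    have "h i \<in> ?J" if "i < Suc d ^ (Suc n + card (V - C))" for i
      using h that by (auto simp: bij_betw_def)
    then show ?thesis using independent_mod_reindex[OF h ind] ok by blast
  qed
  then show ?case by blast
qed

text \<open>Growth of order \<open>n + card (V - C)\<close> in \<open>d\<close> cannot exceed the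
  growth of order \<open>card V\<close> of the number of all monomials in the box.\<close>

lemma prime_chain_length:
  fixes Q :: "nat \<Rightarrow> ('v, 'k::field) mvpoly set"
  assumes V: "finite V" "C \<subseteq> V"
    and Q: "\<And>i. i \<le> n \<Longrightarrow> primeideal (Q i) (mvpoly_ring V)" "\<And>i. i < n \<Longrightarrow> Q i \<subset> Q (Suc i)"
      "Q n = var_prime V C"
  shows "n \<le> card C"
proof (rule ccontr)
  assume "\<not> n \<le> card C"
  moreover have "card V = card C + card (V - C)"
    using V by (metis card_Diff_subset card_mono finite_subset le_add_diff_inverse)
  ultimately have gt: "Suc (card V) \<le> n + card (V - C)" by linarith
  obtain e where e: "\<And>d. \<exists>b. independent_mod (Q 0) {..<Suc d ^ (n + card (V - C))} b \<and>
    (\<forall>i<Suc d ^ (n + card (V - C)). b i \<in> carrier (mvpoly_ring V) \<and> exponents_le (e * d) (b i))"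
    using ex_independent_family[OF V Q] by blast
  \<comment> \<open>Chosen so that the constant factor \<open>Suc e ^ card V\<close>, lost by
    comparing \<open>Suc (e * d)\<close> with \<open>Suc e * Suc d\<close>, is beaten by one more
    factor \<open>Suc d\<close>.\<close>
  define d where "d = Suc e ^ card V"
  have "primeideal (Q 0) (mvpoly_ring V)" using Q(1)[of 0] by simp
  then have "ideal (Q 0) (mvpoly_ring V)" by (rule primeideal.axioms)
  from additive_subgroup.zero_closed[OF ideal.axioms(1)[OF this]] have "0 \<in> Q 0" by simp
  then have le: "Suc d ^ (n + card (V - C)) \<le> Suc (e * d) ^ card V"
    using e[of d] independent_mod_card_le[OF V(1), of "Q 0" "Suc d ^ (n + card (V - C))" _ "e * d"]
    by blast
  have "Suc (e * d) ^ card V \<le> (Suc e * Suc d) ^ card V" by (intro power_mono) auto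
  also have "\<dots> = d * Suc d ^ card V" by (simp only: power_mult_distrib d_def)
  also have "\<dots> < Suc d ^ Suc (card V)" by simp
  also have "\<dots> \<le> Suc d ^ (n + card (V - C))" using gt by (intro power_increasing) auto
  finally show False using le by simp
qed

text \<open>Adding the variables of \<open>C\<close> one at a time gives a chain of length
  \<open>card C\<close>, and \<open>prime_chain_length\<close> allows no longer one.\<close>

lemma height_var_prime:
  assumes V: "finite V" "C \<subseteq> V"
  shows "ring_height (mvpoly_ring V :: ('v, 'k::field) mvpoly ring) (var_prime V C) = enat (card C)"
  unfolding ring_height_def
proof (rule antisym)
  let ?R = "mvpoly_ring V :: ('v, 'k) mvpoly ring"
  show "Sup {enat n | n. \<exists>Q :: nat \<Rightarrow> ('v, 'k) mvpoly set. (\<forall>i\<le>n. primeideal (Q i) ?R) \<and>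
      (\<forall>i<n. Q i \<subset> Q (Suc i)) \<and> Q n = var_prime V C} \<le> enat (card C)"
  proof (rule Sup_least)
    fix h assume "h \<in> {enat n | n. \<exists>Q :: nat \<Rightarrow> ('v, 'k) mvpoly set. (\<forall>i\<le>n. primeideal (Q i) ?R) \<and>
      (\<forall>i<n. Q i \<subset> Q (Suc i)) \<and> Q n = var_prime V C}"
    then obtain n and Q :: "nat \<Rightarrow> ('v, 'k) mvpoly set" where "h = enat n"
      "\<forall>i\<le>n. primeideal (Q i) ?R" "\<forall>i<n. Q i \<subset> Q (Suc i)" "Q n = var_prime V C" by blast
    then show "h \<le> enat (card C)" using prime_chain_length[OF V, of n Q] by auto
  qed
  have "finite C" using V finite_subset by blast
  then obtain c where c: "bij_betw c {0..<card C} C" using ex_bij_betw_nat_finite by blast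
  let ?Q = "\<lambda>i. var_prime V (c ` {0..<i}) :: ('v, 'k) mvpoly set"
  have sub: "c ` {0..<i} \<subseteq> V" if "i \<le> card C" for i
    using c V that by (fastforce simp: bij_betw_def)
  have "?Q i \<subset> ?Q (Suc i)" if i: "i < card C" for i
  proof -
    have ci: "c i \<in> V" "c i \<notin> c ` {0..<i}"
      using c V i by (auto simp: bij_betw_def dest!: inj_onD)
    then have "mvar (c i) \<in> ?Q (Suc i)" "mvar (c i) \<notin> ?Q i"
      by (auto simp: var_prime_iff mvar_def)
    moreover have "?Q i \<subseteq> ?Q (Suc i)" by (fastforce simp: var_prime_iff)
    ultimately show ?thesis by blast
  qed
  moreover have "?Q (card C) = var_prime V C" using c by (simp add: bij_betw_def)
  ultimately show "enat (card C) \<le> Sup {enat n | n. \<exists>Q :: nat \<Rightarrow> ('v, 'k) mvpoly set.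
      (\<forall>i\<le>n. primeideal (Q i) ?R) \<and> (\<forall>i<n. Q i \<subset> Q (Suc i)) \<and> Q n = var_prime V C}"
    using primeideal_var_prime[OF V(1) sub]
    by (intro Sup_upper CollectI exI[of _ "card C"] exI[of _ ?Q] conjI refl) auto
qed

text \<open>The vertices of a cover are usually divided into \<open>L_1\<close> (some out-neighbour
  outside \<open>C\<close>), \<open>L_3\<close> (all neighbours in \<open>C\<close>) and the rest
  \<open>L_2\<close>. The last clause says that each vertex of \<open>L_3\<close> has an
  in-neighbour in \<open>C\<close> of weight above 1 that does not belong to
  \<open>L_1\<close>.\<close>

definition strong_cover :: "'v pair_pre_digraph \<Rightarrow> ('v \<Rightarrow> nat) \<Rightarrow> 'v set \<Rightarrow> bool" where
  "strong_cover D w C \<longleftrightarrow> C \<subseteq> pverts D \<and> (\<forall>x y. (x, y) \<in> parcs D \<longrightarrow> x \<in> C \<or> y \<in> C) \<and>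
    (\<forall>x\<in>C. nbrs D x \<subseteq> C \<longrightarrow> (\<exists>y\<in>C. (y, x) \<in> parcs D \<and> 1 < w y \<and> out_nbrs D y \<subseteq> C))"

text \<open>Stated for plain exponent functions, which can be capped and updated at a
  vertex.\<close>

definition edge_monomial :: "'v pair_pre_digraph \<Rightarrow> ('v \<Rightarrow> nat) \<Rightarrow> ('v \<Rightarrow> nat) \<Rightarrow> bool" where
  "edge_monomial D w e \<longleftrightarrow> (\<exists>x y. (x, y) \<in> parcs D \<and> 1 \<le> e x \<and> w y \<le> e y)"

text \<open>The monomials of the irreducible component of the edge ideal at the cover \<open>C\<close>.\<close>

definition cover_monomial :: "'v pair_pre_digraph \<Rightarrow> ('v \<Rightarrow> nat) \<Rightarrow> 'v set \<Rightarrow> ('v \<Rightarrow> nat) \<Rightarrow> bool" where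
  "cover_monomial D w C e \<longleftrightarrow> (\<exists>x\<in>C. if out_nbrs D x \<subseteq> C then w x \<le> e x else 1 \<le> e x)"

lemma mvar_power: "(mvar x :: ('v, 'k::field) mvpoly) ^ k = single (single x k) 1"
proof (induction k)
  case (Suc k)
  then show ?case by (simp add: mvar_def mult_single single_add[symmetric])
qed simp

lemma ex_finite_maximum:
  fixes g :: "'a \<Rightarrow> nat"
  assumes "finite F" "a \<in> F"
  shows "\<exists>e\<in>F. \<forall>e'\<in>F. g e' \<le> g e"
proof -
  have "Max (g ` F) \<in> g ` F" using assms by (intro Max_in) auto
  then obtain e where "e \<in> F" "Max (g ` F) = g e" by blast
  then show ?thesis using assms Max_ge[of "g ` F"] by (metis finite_imageI imageI)
qed

section \<open>Components and associated primes of the edge ideal\<close>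

context weighted_oriented_graph
begin

lemma arc_verts: "(x, y) \<in> parcs D \<Longrightarrow> x \<in> pverts D" "(x, y) \<in> parcs D \<Longrightarrow> y \<in> pverts D"
  using in_arcsD1 in_arcsD2 by blast+

lemma arc_neq: "(x, y) \<in> parcs D \<Longrightarrow> x \<noteq> y"
  using pair_no_loops by fastforce

lemma edge_monomialI: "\<lbrakk>(x, y) \<in> parcs D; 1 \<le> e x; w y \<le> e y\<rbrakk> \<Longrightarrow> edge_monomial D w e"
  unfolding edge_monomial_def by blast

lemma edge_monomial_add: "edge_monomial D w (lookup m) \<Longrightarrow> edge_monomial D w (lookup (m + m'))"
  unfolding edge_monomial_def lookup_add by (meson trans_le_add1)

lemma cover_monomial_add:
  assumes "cover_monomial D w C (lookup m)"
  shows "cover_monomial D w C (lookup (m + m'))"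
proof -
  obtain x where "x \<in> C" "if out_nbrs D x \<subseteq> C then w x \<le> lookup m x else 1 \<le> lookup m x"
    using assms unfolding cover_monomial_def by blast
  then show ?thesis
    unfolding cover_monomial_def
    by (intro bexI[of _ x]) (auto simp: lookup_add split: if_splits)
qed

lemma edge_ideal_monomial_ideal:
  "(edge_ideal D w :: ('v, 'k::field) mvpoly set) =
    monomial_ideal (pverts D) (\<lambda>m. edge_monomial D w (lookup m))"
proof -
  let ?R = "mvpoly_ring (pverts D) :: ('v, 'k) mvpoly ring"
  let ?G = "{mvar x * mvar y ^ w y | x y. (x, y) \<in> parcs D} :: ('v, 'k) mvpoly set"
  interpret R: cring ?R by (rule cring_mvpoly_ring)
  have gen: "(mvar x * mvar y ^ w y :: ('v, 'k) mvpoly) = single (single x 1 + single y (w y)) 1" for x y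
    by (simp add: mvar_power mult_single) (simp add: mvar_def mult_single)
  have G: "?G \<subseteq> carrier ?R"
    using arc_verts by (auto simp: gen keys_add_nat split: if_splits)
  have I: "ideal (edge_ideal D w) ?R" unfolding edge_ideal_def by (rule R.genideal_ideal[OF G])
  let ?I = "edge_ideal D w :: ('v, 'k) mvpoly set"
  let ?M = "monomial_ideal (pverts D) (\<lambda>m. edge_monomial D w (lookup m)) :: ('v, 'k) mvpoly set"
  show ?thesis
  proof
    have "ideal ?M ?R"
      by (rule monomial_ideal_ideal) (rule edge_monomial_add)
    then show "?I \<subseteq> ?M"
      unfolding edge_ideal_def
    proof (rule R.genideal_minimal)
      show "?G \<subseteq> ?M"
      proof
        fix p assume "p \<in> ?G"
        then obtain x y where p: "p = mvar x * mvar y ^ w y" "(x, y) \<in> parcs D" by blast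
        have "edge_monomial D w (lookup (single x 1 + single y (w y)))"
          unfolding edge_monomial_def
          using p(2) by (intro exI[of _ x] exI[of _ y]) (simp add: lookup_add)
        moreover have "keys (single x 1 + single y (w y)) \<subseteq> pverts D"
          using arc_verts[OF p(2)] by (auto simp: keys_add_nat)
        ultimately show "p \<in> ?M"
          unfolding p(1) gen monomial_ideal_def by simp
      qed
    qed
    show "?M \<subseteq> ?I"
    proof (rule monomial_ideal_subset[OF I])
      fix m :: "'v \<Rightarrow>\<^sub>0 nat" assume "edge_monomial D w (lookup m)"
      then obtain x y where xy: "(x, y) \<in> parcs D" "1 \<le> lookup m x" "w y \<le> lookup m y"
        by (auto simp: edge_monomial_def)
      let ?b = "single x 1 + single y (w y)"
      have "m = (m - ?b) + ?b"
        using xy arc_neq[OF xy(1)]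
        by (intro poly_mapping_eqI) (auto simp: lookup_add lookup_minus lookup_single when_def)
      moreover have "single ?b 1 \<in> ?G" unfolding gen[symmetric] using xy(1) by blast
      then have "single ?b 1 \<in> ?I"
        unfolding edge_ideal_def using R.genideal_self[OF G] by blast
      ultimately show "\<exists>a b. m = a + b \<and> single b (1::'k) \<in> ?I" by blast
    qed
  qed
qed

text \<open>If the head of the arc is in \<open>C\<close>, its exponent reaches the weight, which is
  enough in both cases of the definition. Otherwise the tail is in \<open>C\<close> with an
  out-neighbour outside, where exponent 1 is enough.\<close>

lemma edge_monomial_imp_cover_monomial:
  assumes "strong_cover D w C" "edge_monomial D w e"
  shows "cover_monomial D w C e"
proof -
  obtain x y where xy: "(x, y) \<in> parcs D" "1 \<le> e x" "w y \<le> e y"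
    using assms(2) by (auto simp: edge_monomial_def)
  have wy: "1 \<le> w y" using weight_pos arc_verts(2)[OF xy(1)] by blast
  show ?thesis
  proof (cases "y \<in> C")
    case True
    then show ?thesis using xy wy unfolding cover_monomial_def by (intro bexI[of _ y]) auto
  next
    case False
    then have "x \<in> C" using assms(1) xy(1) by (auto simp: strong_cover_def)
    moreover have "\<not> out_nbrs D x \<subseteq> C" using False xy(1) by (auto simp: out_nbrs_def)
    ultimately show ?thesis using xy(2) unfolding cover_monomial_def by (intro bexI[of _ x]) auto
  qed
qed

text \<open>Exponents above the weights are irrelevant, so one may raise the exponents as long as no edge
  monomial divides; \<open>C\<close> is the set of the variables with exponent below the weight.\<close>

lemma ex_strong_cover_avoiding:
  assumes "\<not> edge_monomial D w m"
  shows "\<exists>C. strong_cover D w C \<and> \<not> cover_monomial D w C m"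
proof -
  let ?V = "pverts D"
  \<comment> \<open>Exponents lie between the capped values of \<open>m\<close> and the weights. At
    a member with the largest sum, raising any exponent that is below its weight creates an edge
    monomial.\<close>
  let ?F = "{e \<in> PiE ?V (\<lambda>x. {min (m x) (w x)..w x}). \<not> edge_monomial D w e}"
  have finV: "finite ?V" by (rule pair_finite_verts)
  have "finite ?F" by (rule finite_subset[of _ "PiE ?V (\<lambda>x. {min (m x) (w x)..w x})"])
    (use finV in \<open>auto intro: finite_PiE\<close>)
  moreover have "restrict (\<lambda>x. min (m x) (w x)) ?V \<in> ?F"
  proof -
    have "\<not> edge_monomial D w (restrict (\<lambda>x. min (m x) (w x)) ?V)"
      using assms arc_verts unfolding edge_monomial_def by fastforce
    then show ?thesis by auto
  qed
  ultimately obtain e where e: "e \<in> ?F" and max: "\<forall>e'\<in>?F. sum e' ?V \<le> sum e ?V"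
    using ex_finite_maximum[of ?F _ "\<lambda>e. sum e ?V"] by blast
  have e1: "min (m x) (w x) \<le> e x" "e x \<le> w x" if "x \<in> ?V" for x
    using e that by (auto simp: PiE_iff)
  have ne: "\<not> edge_monomial D w e" using e by blast
  have raise: "edge_monomial D w (e(x := Suc (e x)))" if x: "x \<in> ?V" "e x < w x" for x
  proof (rule ccontr)
    assume n: "\<not> edge_monomial D w (e(x := Suc (e x)))"
    have "e(x := Suc (e x)) \<in> PiE ?V (\<lambda>x. {min (m x) (w x)..w x})"
      using e x by (auto simp: PiE_iff extensional_def le_Suc_eq)
    then have "e(x := Suc (e x)) \<in> ?F" using n by blast
    then have "sum (e(x := Suc (e x))) ?V \<le> sum e ?V" by (rule max[THEN bspec])
    moreover have "sum (e(x := Suc (e x))) ?V = Suc (sum e ?V)"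
      using finV x(1) by (simp add: sum.remove[of ?V x])
    ultimately show False by simp
  qed
  let ?C = "{x \<in> ?V. e x < w x}"
  have out: "e y = w y" if "y \<in> ?V" "y \<notin> ?C" for y using e1[OF that(1)] that by simp
  have zero: "e x = 0" if x: "x \<in> ?C" "\<not> out_nbrs D x \<subseteq> ?C" for x
  proof -
    obtain y where y: "(x, y) \<in> parcs D" "y \<notin> ?C" using x(2) by (auto simp: out_nbrs_def)
    then have "e y = w y" using out arc_verts by blast
    then show ?thesis using ne y(1) unfolding edge_monomial_def by force
  qed
  have "strong_cover D w ?C"
    unfolding strong_cover_def
  proof (intro conjI allI impI ballI)
    show "?C \<subseteq> ?V" by blast
    fix x y assume xy: "(x, y) \<in> parcs D"
    show "x \<in> ?C \<or> y \<in> ?C"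
    proof (rule ccontr)
      assume "\<not> (x \<in> ?C \<or> y \<in> ?C)"
      then have "e x = w x" "e y = w y" using out arc_verts[OF xy] by blast+
      moreover have "1 \<le> w x" using weight_pos arc_verts[OF xy] by blast
      ultimately show False using ne xy unfolding edge_monomial_def by force
    qed
  next
    fix x assume x: "x \<in> ?C" "nbrs D x \<subseteq> ?C"
    \<comment> \<open>The arc of the edge monomial created by raising \<open>x\<close> cannot start
      at \<open>x\<close>, so it ends there; its tail has positive exponent and is the in-neighbour
      that a strong cover demands.\<close>
    have "edge_monomial D w (e(x := Suc (e x)))" using raise x(1) by blast
    then obtain a b where ab: "(a, b) \<in> parcs D" "1 \<le> (e(x := Suc (e x))) a" "w b \<le> (e(x := Suc (e x))) b"
      unfolding edge_monomial_def by blast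
    have "a \<noteq> x"
    proof
      assume "a = x"
      then have "b \<in> ?C" using ab(1) x(2) by (auto simp: nbrs_def out_nbrs_def)
      then show False using ab \<open>a = x\<close> arc_neq[OF ab(1)] by auto
    qed
    moreover have "b = x"
    proof (rule ccontr)
      assume "b \<noteq> x"
      then show False using ab \<open>a \<noteq> x\<close> ne unfolding edge_monomial_def by auto
    qed
    ultimately have a: "(a, x) \<in> parcs D" "1 \<le> e a" using ab by auto
    then have aC: "a \<in> ?C" using x(2) by (auto simp: nbrs_def in_nbrs_def)
    have "out_nbrs D a \<subseteq> ?C" using zero[OF aC] a(2) by fastforce
    moreover have "1 < w a" using aC a(2) by auto
    ultimately show "\<exists>y\<in>?C. (y, x) \<in> parcs D \<and> 1 < w y \<and> out_nbrs D y \<subseteq> ?C"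
      using a(1) aC by blast
  qed
  moreover have "\<not> cover_monomial D w ?C m"
  proof
    assume "cover_monomial D w ?C m"
    then obtain x where x: "x \<in> ?C" "if out_nbrs D x \<subseteq> ?C then w x \<le> m x else 1 \<le> m x"
      unfolding cover_monomial_def by blast
    have b: "min (m x) (w x) \<le> e x" "e x < w x" using x(1) e1 by blast+
    show False
    proof (cases "out_nbrs D x \<subseteq> ?C")
      case True then show False using x(2) b by simp
    next
      case False then show False using x(2) b zero[OF x(1)] by simp
    qed
  qed
  ultimately show ?thesis by blast
qed

text \<open>If for each strong cover some \<open>g\<close> outside \<open>P\<close> multiplied
  \<open>f\<close> into the component, the product of all these would multiply \<open>f\<close> into
  the edge ideal and lie in \<open>P\<close>, against primality. So for one \<open>C\<close> the
  colon of the component by \<open>f\<close> is contained in \<open>P\<close>. It contains a power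
  of each variable of \<open>C\<close>, hence \<open>P\<close> contains these variables;
  \<open>mult_key_outside\<close> gives the other inclusion.\<close>

lemma associated_prime_strong_cover:
  fixes P :: "('v, 'k::field) mvpoly set"
  assumes P: "primeideal P (mvpoly_ring (pverts D))" and f: "f \<in> carrier (mvpoly_ring (pverts D))"
    and eq: "P = {g \<in> carrier (mvpoly_ring (pverts D)). g \<otimes>\<^bsub>mvpoly_ring (pverts D)\<^esub> f \<in> edge_ideal D w}"
  shows "\<exists>C. strong_cover D w C \<and> P = var_prime (pverts D) C"
proof -
  let ?V = "pverts D"
  let ?R = "mvpoly_ring ?V :: ('v, 'k) mvpoly ring"
  let ?I = "\<lambda>C. monomial_ideal ?V (\<lambda>m. cover_monomial D w C (lookup m)) :: ('v, 'k) mvpoly set"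
  interpret R: cring ?R by (rule cring_mvpoly_ring)
  interpret P: primeideal P ?R by (rule P)
  have finV: "finite ?V" by (rule pair_finite_verts)
  have mult: "p * q \<in> carrier ?R" if "p \<in> carrier ?R" "q \<in> carrier ?R" for p q
    using R.m_closed[OF that] by simp
  have prime: "p \<in> P \<or> q \<in> P" if "p * q \<in> P" "p \<in> carrier ?R" "q \<in> carrier ?R" for p q
    using P.I_prime[OF that(2,3)] that(1) by simp
  have one: "1 \<notin> P"
    using P.I_notcarr P.one_imp_carrier by auto
  have memP: "g \<in> P \<longleftrightarrow> g \<in> carrier ?R \<and> g * f \<in> edge_ideal D w" for g unfolding eq by simp
  have Iid: "ideal (?I C) ?R" for C by (rule monomial_ideal_ideal) (rule cover_monomial_add)
  have "\<exists>C. strong_cover D w C \<and> (\<forall>g\<in>carrier ?R. g * f \<in> ?I C \<longrightarrow> g \<in> P)"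
  proof (rule ccontr)
    assume "\<not> ?thesis"
    then have "\<forall>C. \<exists>g. strong_cover D w C \<longrightarrow> g \<in> carrier ?R \<and> g * f \<in> ?I C \<and> g \<notin> P" by blast
    then obtain g where g: "\<And>C. strong_cover D w C \<Longrightarrow> g C \<in> carrier ?R \<and> g C * f \<in> ?I C \<and> g C \<notin> P"
      by metis
    let ?S = "{C. strong_cover D w C}"
    have "finite ?S" by (rule finite_subset[of _ "Pow ?V"]) (use finV in \<open>auto simp: strong_cover_def\<close>)
    have G: "prod g T \<in> carrier ?R \<and> prod g T \<notin> P" if "T \<subseteq> ?S" for T
    proof -
      have "finite T" using that \<open>finite ?S\<close> finite_subset by blast
      then show ?thesis using that
      proof (induction T rule: finite_induct)
        case empty then show ?case using one by simp
      next
        case (insert C T)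
        then have IH: "prod g T \<in> carrier ?R" "prod g T \<notin> P" "g C \<in> carrier ?R" "g C \<notin> P"
          using g[of C] by auto
        then have "g C * prod g T \<in> carrier ?R" "g C * prod g T \<notin> P" using mult prime by blast+
        then show ?case using insert.hyps by simp
      qed
    qed
    have "prod g ?S * f \<in> edge_ideal D w"
      unfolding edge_ideal_monomial_ideal monomial_ideal_def
    proof (intro CollectI ballI conjI)
      fix m assume m: "m \<in> keys (prod g ?S * f)"
      have "prod g ?S * f \<in> carrier ?R" using mult G f by blast
      then show "keys m \<subseteq> ?V" using m by simp
      show "edge_monomial D w (lookup m)"
      proof (rule ccontr)
        assume "\<not> edge_monomial D w (lookup m)"
        then obtain C where C: "strong_cover D w C" "\<not> cover_monomial D w C (lookup m)"
          using ex_strong_cover_avoiding by blast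
        have "prod g ?S * f = prod g (?S - {C}) * (g C * f)"
          using C(1) \<open>finite ?S\<close> by (simp add: prod.remove[of ?S C] mult_ac)
        moreover have "prod g (?S - {C}) * (g C * f) \<in> ?I C"
          using ideal.I_l_closed[OF Iid, of "g C * f" C "prod g (?S - {C})"] g[OF C(1)] G[of "?S - {C}"]
          by simp
        ultimately show False using m C(2) by (auto simp: monomial_ideal_def)
      qed
    qed
    then show False using G[of ?S] memP by blast
  qed
  then obtain C where C: "strong_cover D w C" and CP: "\<And>g. \<lbrakk>g \<in> carrier ?R; g * f \<in> ?I C\<rbrakk> \<Longrightarrow> g \<in> P"
    by blast
  have CV: "C \<subseteq> ?V" using C by (simp add: strong_cover_def)
  have "f \<notin> ?I C" using CP[of 1] one by auto
  then obtain a where a: "a \<in> keys f" "\<not> cover_monomial D w C (lookup a)"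
    using f by (auto simp: monomial_ideal_def)
  have "P \<subseteq> var_prime ?V C"
  proof
    fix g assume g: "g \<in> P"
    then have gc: "g \<in> carrier ?R" "g * f \<in> edge_ideal D w" using memP by blast+
    show "g \<in> var_prime ?V C"
    proof (rule ccontr)
      assume "g \<notin> var_prime ?V C"
      then obtain b where b: "b \<in> keys g" "keys b \<inter> C = {}" using gc by (auto simp: var_prime_iff)
      have "\<exists>k\<in>keys (f * g). \<not> cover_monomial D w C (lookup k)"
      proof (rule mult_key_outside[OF finV CV _ _ cover_monomial_add _ a b])
        show "keys m \<subseteq> ?V" if "m \<in> keys f" for m using f that by simp
        show "keys m \<subseteq> ?V" if "m \<in> keys g" for m using gc(1) that by simp
        fix m m' assume m: "keys m' \<inter> C = {}" "cover_monomial D w C (lookup (m + m'))"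
        have "lookup (m + m') x = lookup m x" if "x \<in> C" for x
          using m(1) that by (auto simp: in_keys_iff lookup_add)
        moreover obtain x where "x \<in> C"
          "if out_nbrs D x \<subseteq> C then w x \<le> lookup (m + m') x else 1 \<le> lookup (m + m') x"
          using m(2) unfolding cover_monomial_def by blast
        ultimately show "cover_monomial D w C (lookup m)"
          unfolding cover_monomial_def by (intro bexI[of _ x]) (auto split: if_splits)
      qed
      then obtain k where k: "k \<in> keys (g * f)" "\<not> cover_monomial D w C (lookup k)"
        by (auto simp: mult.commute)
      then have "edge_monomial D w (lookup k)"
        using gc(2) unfolding edge_ideal_monomial_ideal monomial_ideal_def by blast
      then show False using k(2) edge_monomial_imp_cover_monomial[OF C] by blast
    qed
  qed
  moreover have "var_prime ?V C \<subseteq> P"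
    unfolding var_prime_def
  proof (rule monomial_ideal_subset[OF P.is_ideal])
    fix m :: "'v \<Rightarrow>\<^sub>0 nat" assume "keys m \<subseteq> ?V" "keys m \<inter> C \<noteq> {}"
    then obtain x where x: "x \<in> keys m" "x \<in> C" "x \<in> ?V" by blast
    have mc: "(mvar x :: ('v, 'k) mvpoly) ^ k \<in> carrier ?R" for k using x(3) by (simp add: mvar_power)
    have w1: "1 \<le> w x" using weight_pos x by blast
    have "mvar x ^ w x * f \<in> ?I C"
      unfolding monomial_ideal_def
    proof (intro CollectI ballI conjI)
      fix k assume k: "k \<in> keys (mvar x ^ w x * f)"
      then show "keys k \<subseteq> ?V" using mult[OF mc f] by simp
      obtain b where "k = single x (w x) + b"
        using k keys_mult[of "mvar x ^ w x" f] by (auto simp: mvar_power)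
      then have "w x \<le> lookup k x" by (simp add: lookup_add)
      then show "cover_monomial D w C (lookup k)"
        unfolding cover_monomial_def using x(2) w1 by (intro bexI[of _ x]) auto
    qed
    then have "mvar x ^ w x \<in> P" using CP mc by blast
    moreover have "(mvar x :: ('v, 'k) mvpoly) \<in> P" if "(mvar x :: ('v, 'k) mvpoly) ^ k \<in> P" for k
      using that
    proof (induction k)
      case (Suc k)
      then show ?case using prime[of "mvar x" "mvar x ^ k"] mc[of 1] mc[of k] by auto
    qed (use one in simp)
    ultimately have "(mvar x :: ('v, 'k) mvpoly) \<in> P" by blast
    moreover have "m = (m - single x 1) + single x 1"
      using x(1) by (intro poly_mapping_eqI)
        (auto simp: lookup_add lookup_minus lookup_single when_def in_keys_iff)
    ultimately show "\<exists>a b. m = a + b \<and> single b 1 \<in> P" unfolding mvar_def by blast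
  qed
  ultimately show ?thesis using C by blast
qed

text \<open>The witness is a monomial just outside the component of \<open>C\<close>: exponent
  \<open>w x\<close> outside \<open>C\<close>, \<open>w x - 1\<close> at a vertex of
  \<open>C\<close> whose out-neighbours all lie in \<open>C\<close>, and 0 at the other vertices of
  \<open>C\<close>. One more variable of \<open>C\<close> completes an edge monomial; variables
  outside \<open>C\<close> never do.\<close>

lemma strong_cover_associated_prime:
  assumes C: "strong_cover D w C"
  shows "\<exists>f\<in>carrier (mvpoly_ring (pverts D)). (var_prime (pverts D) C :: ('v, 'k::field) mvpoly set) =
    {g \<in> carrier (mvpoly_ring (pverts D)). g \<otimes>\<^bsub>mvpoly_ring (pverts D)\<^esub> f \<in> edge_ideal D w}"
proof -
  let ?V = "pverts D"
  let ?R = "mvpoly_ring ?V :: ('v, 'k) mvpoly ring"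
  interpret R: cring ?R by (rule cring_mvpoly_ring)
  let ?e = "\<lambda>x. if x \<in> ?V then if x \<in> C then if out_nbrs D x \<subseteq> C then w x - 1 else 0 else w x else 0"
  have "finite {x. ?e x \<noteq> 0}" by (rule finite_subset[OF _ pair_finite_verts]) (auto split: if_splits)
  then have "lookup (Abs_poly_mapping ?e) x = ?e x" for x by simp
  then obtain e where e: "\<And>x. lookup e x = ?e x" by blast
  have ke: "keys e \<subseteq> ?V" by (auto simp: in_keys_iff e split: if_splits)
  let ?f = "single e 1 :: ('v, 'k) mvpoly"
  have f: "?f \<in> carrier ?R" using ke by simp
  have raise: "edge_monomial D w (lookup (b + e))" if x: "x \<in> keys b" "x \<in> C" for b x
  proof -
    have bx: "1 \<le> lookup b x" using x(1) by (simp add: in_keys_iff)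
    have xV: "x \<in> ?V" using x C by (auto simp: strong_cover_def)
    \<comment> \<open>The position of \<open>x\<close> in the cover decides which arc is completed:
      one to an out-neighbour outside \<open>C\<close>, one from an in-neighbour outside
      \<open>C\<close>, or one from the in-neighbour in \<open>C\<close> of weight above 1, whose
      exponent \<open>w y - 1\<close> is positive.\<close>
    consider y where "(x, y) \<in> parcs D" "y \<notin> C"
      | y where "(y, x) \<in> parcs D" "y \<notin> C" "out_nbrs D x \<subseteq> C" | "nbrs D x \<subseteq> C"
      unfolding nbrs_def out_nbrs_def in_nbrs_def by blast
    then show ?thesis
    proof cases
      case 1
      then have "w y \<le> lookup (b + e) y" using arc_verts(2)[OF 1(1)] by (simp add: lookup_add e)
      then show ?thesis using 1 bx by (intro edge_monomialI[of x y]) (auto simp: lookup_add)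
    next
      case 2
      then have "y \<in> ?V" using arc_verts by blast
      then have "w y \<le> lookup (b + e) y" "1 \<le> w y"
        using 2 weight_pos by (simp_all add: lookup_add e)
      moreover have "w x \<le> lookup (b + e) x" using 2 xV x bx by (simp add: lookup_add e)
      ultimately show ?thesis using 2 by (intro edge_monomialI[of y x]) auto
    next
      case 3
      then obtain y where y: "y \<in> C" "(y, x) \<in> parcs D" "1 < w y" "out_nbrs D y \<subseteq> C"
        using C x(2) unfolding strong_cover_def by blast
      then have "1 \<le> lookup (b + e) y" using arc_verts(1)[OF y(2)] by (simp add: lookup_add e)
      moreover have "w x \<le> lookup (b + e) x" using 3 xV x bx by (simp add: lookup_add e nbrs_def)
      ultimately show ?thesis using y(2) by (intro edge_monomialI[of y x])
    qed
  qed
  have low: "\<not> edge_monomial D w (lookup (b + e))" if b: "keys b \<inter> C = {}" for b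
  proof
    assume "edge_monomial D w (lookup (b + e))"
    then obtain x y where xy: "(x, y) \<in> parcs D" "1 \<le> lookup (b + e) x" "w y \<le> lookup (b + e) y"
      unfolding edge_monomial_def by blast
    have zero: "lookup b z = 0" if "z \<in> C" for z using b that by (auto simp: in_keys_iff)
    have wy: "1 \<le> w y" using weight_pos arc_verts[OF xy(1)] by blast
    show False
    proof (cases "y \<in> C")
      case True then show False using xy(3) zero wy by (auto simp: lookup_add e split: if_splits)
    next
      case False
      then have "x \<in> C" using C xy(1) unfolding strong_cover_def by blast
      moreover have "\<not> out_nbrs D x \<subseteq> C" using xy(1) False by (auto simp: out_nbrs_def)
      ultimately show False using xy(2) zero[of x] by (auto simp: lookup_add e split: if_splits)
    qed
  qed
  have look: "lookup (g * ?f) (b + e) = lookup g b" if "b \<in> keys g" for g :: "('v, 'k) mvpoly" and b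
    using lookup_mult_unique[of b g e ?f] that by auto
  have "g \<in> var_prime ?V C \<longleftrightarrow> g \<in> carrier ?R \<and> g * ?f \<in> edge_ideal D w" for g
  proof
    assume g: "g \<in> var_prime ?V C"
    then have gc: "g \<in> carrier ?R" by (simp add: var_prime_iff)
    have "g * ?f \<in> edge_ideal D w"
      unfolding edge_ideal_monomial_ideal monomial_ideal_def
    proof (intro CollectI ballI conjI)
      fix m assume m: "m \<in> keys (g * ?f)"
      show "keys m \<subseteq> ?V" using R.m_closed[OF gc f] m by simp
      obtain b where "b \<in> keys g" "m = b + e" using keys_mult[of g ?f] m by auto
      then show "edge_monomial D w (lookup m)" using raise g by (fastforce simp: var_prime_iff)
    qed
    then show "g \<in> carrier ?R \<and> g * ?f \<in> edge_ideal D w" using gc by blast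
  next
    assume g: "g \<in> carrier ?R \<and> g * ?f \<in> edge_ideal D w"
    have "keys b \<inter> C \<noteq> {}" if b: "b \<in> keys g" for b
    proof -
      have "b + e \<in> keys (g * ?f)" using look[OF b] b by (simp add: in_keys_iff)
      then have "edge_monomial D w (lookup (b + e))"
        using g unfolding edge_ideal_monomial_ideal monomial_ideal_def by blast
      then show ?thesis using low by blast
    qed
    then show "g \<in> var_prime ?V C" using g by (simp add: var_prime_iff)
  qed
  then show ?thesis using f by (intro bexI[of _ ?f]) auto
qed

theorem unmixed_iff_strong_covers:
  "unmixed_ideal (mvpoly_ring (pverts D)) (edge_ideal D w :: ('v, 'k::field) mvpoly set) \<longleftrightarrow>
    (\<forall>C C'. strong_cover D w C \<longrightarrow> strong_cover D w C' \<longrightarrow> card C = card C')"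
proof -
  let ?R = "mvpoly_ring (pverts D) :: ('v, 'k) mvpoly ring"
  have CV: "C \<subseteq> pverts D" if "strong_cover D w C" for C using that by (simp add: strong_cover_def)
  have assoc: "associated_primes ?R (edge_ideal D w) = var_prime (pverts D) ` {C. strong_cover D w C}"
  proof
    show "associated_primes ?R (edge_ideal D w) \<subseteq> var_prime (pverts D) ` {C. strong_cover D w C}"
      unfolding associated_primes_def using associated_prime_strong_cover by blast
    show "var_prime (pverts D) ` {C. strong_cover D w C} \<subseteq> associated_primes ?R (edge_ideal D w)"
      unfolding associated_primes_def
      using strong_cover_associated_prime primeideal_var_prime[OF pair_finite_verts CV] by blast
  qed
  have ht: "ring_height ?R (var_prime (pverts D) C) = enat (card C)" if "strong_cover D w C" for C
    using height_var_prime[OF pair_finite_verts CV[OF that]] .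
  show ?thesis
    unfolding unmixed_ideal_def assoc
  proof (intro iffI ballI allI impI)
    fix C C'
    assume "\<forall>P\<in>var_prime (pverts D) ` {C. strong_cover D w C}.
      \<forall>Q\<in>var_prime (pverts D) ` {C. strong_cover D w C}. ring_height ?R P = ring_height ?R Q"
      and C: "strong_cover D w C" "strong_cover D w C'"
    then have "ring_height ?R (var_prime (pverts D) C) = ring_height ?R (var_prime (pverts D) C')"
      by blast
    then show "card C = card C'" using ht C by simp
  next
    fix P Q :: "('v, 'k) mvpoly set"
    assume eq: "\<forall>C C'. strong_cover D w C \<longrightarrow> strong_cover D w C' \<longrightarrow> card C = card C'"
      and PQ: "P \<in> var_prime (pverts D) ` {C. strong_cover D w C}"
        "Q \<in> var_prime (pverts D) ` {C. strong_cover D w C}"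
    from PQ obtain C C' where C: "strong_cover D w C" "strong_cover D w C'"
      and "P = var_prime (pverts D) C" "Q = var_prime (pverts D) C'" by blast
    moreover have "card C = card C'" using eq C by blast
    ultimately show "ring_height ?R P = ring_height ?R Q" using ht[OF C(1)] ht[OF C(2)] by simp
  qed
qed

end

section \<open>Strong vertex covers and semi-forests\<close>

lemma mk_symmetric_arc [simp]:
  "(x, y) \<in> parcs (mk_symmetric (with_proj G)) \<longleftrightarrow> y \<in> nbrs G x"
  by (simp add: mk_symmetric_def nbrs_def out_nbrs_def in_nbrs_def Bex_def split_paired_Ex) blast

lemma mk_symmetric_verts [simp]: "pverts (mk_symmetric (with_proj G)) = pverts G"
  by (simp add: mk_symmetric_def)

lemma nbrs_sym: "y \<in> nbrs G x \<Longrightarrow> x \<in> nbrs G y"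
  by (auto simp: nbrs_def out_nbrs_def in_nbrs_def)

lemma nbrs_arc: "(x, y) \<in> parcs G \<Longrightarrow> y \<in> nbrs G x" "(x, y) \<in> parcs G \<Longrightarrow> x \<in> nbrs G y"
  by (auto simp: nbrs_def out_nbrs_def in_nbrs_def)

lemma subgraph_with_proj_iff:
  "subgraph (with_proj H) (with_proj D) \<longleftrightarrow> pverts H \<subseteq> pverts D \<and> parcs H \<subseteq> parcs D \<and>
    wf_digraph (with_proj D) \<and> wf_digraph (with_proj H)"
  by (simp add: subgraph_def compatible_def)

lemma wf_digraph_with_proj_iff:
  "wf_digraph (with_proj H) \<longleftrightarrow> (\<forall>x y. (x, y) \<in> parcs H \<longrightarrow> x \<in> pverts H \<and> y \<in> pverts H)"
  by (force simp: wf_digraph_def)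

lemma pcas_map: "pcas u p v \<Longrightarrow> u # map snd p = map fst p @ [v]"
  by (induction p arbitrary: u) auto

lemma pawalk_verts_pcas: "pcas u p v \<Longrightarrow> pawalk_verts u p = u # map snd p"
  by (induction p arbitrary: u) auto

lemma with_proj_apath_iff:
  "pre_digraph.apath (with_proj G) u p v \<longleftrightarrow>
    u \<in> pverts G \<and> set p \<subseteq> parcs G \<and> pcas u p v \<and> distinct (pawalk_verts u p)"
  by (simp add: pre_digraph.apath_def pre_digraph.awalk_def cas_with_proj_eq awalk_verts_with_proj_eq)

lemma with_proj_cycle_iff:
  "pre_digraph.cycle (with_proj G) p \<longleftrightarrow>
    (\<exists>u\<in>pverts G. set p \<subseteq> parcs G \<and> pcas u p u \<and> distinct (map snd p) \<and> p \<noteq> [])"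
  by (auto simp: pre_digraph.cycle_def pre_digraph.awalk_def cas_with_proj_eq awalk_verts_with_proj_eq
      pawalk_verts_pcas)

text \<open>The heads along a closed walk are its tails shifted by one place, so each tail is also a
  head.\<close>

lemma cycle_predecessor:
  assumes "pre_digraph.cycle (with_proj G) c" "x \<in> fst ` set c"
  shows "\<exists>y. (y, x) \<in> set c \<and> (y, x) \<in> parcs G"
proof -
  obtain u where u: "set c \<subseteq> parcs G" "pcas u c u" "c \<noteq> []"
    using assms(1) by (auto simp: with_proj_cycle_iff)
  have m: "u # map snd c = map fst c @ [u]" by (rule pcas_map[OF u(2)])
  have "set (map snd c) = set (map fst c)"
  proof -
    have "map snd c = tl (map fst c) @ [u]" using m u(3) by (cases c) auto
    moreover have "map fst c = u # tl (map fst c)" using m u(3) by (cases c) auto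
    ultimately show ?thesis by (metis set_append list.simps(15) Un_insert_right list.set(1) sup_bot.right_neutral)
  qed
  then have "x \<in> snd ` set c" using assms(2) by simp
  then show ?thesis using u(1) by force
qed

text \<open>Only the last arc of a path matters for semi-forests: its tail is the root or has an arc
  into it, so the condition on out-neighbours applies to it.\<close>

lemma apath_last_arc:
  assumes "pre_digraph.apath (with_proj T) r p x" "x \<noteq> r"
  shows "\<exists>y. (y, x) \<in> parcs T \<and> (y = r \<or> (\<exists>a. (a, y) \<in> parcs T \<and> a \<noteq> x))"
proof -
  have "set p \<subseteq> parcs T" "pcas r p x" "distinct (pawalk_verts r p)"
    using assms(1) by (auto simp: with_proj_apath_iff)
  then show ?thesis using assms(2)
  proof (induction p arbitrary: r)
    case (Cons e p)
    obtain b where e: "e = (r, b)" using Cons.prems(2) by (cases e) auto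
    show ?case
    proof (cases "x = b")
      case True then show ?thesis using Cons.prems(1) e by auto
    next
      case False
      then obtain y where "(y, x) \<in> parcs T" "y = b \<or> (\<exists>a. (a, y) \<in> parcs T \<and> a \<noteq> x)"
        using Cons.IH[of b] Cons.prems e by auto
      then show ?thesis using Cons.prems(1,4) e by auto
    qed
  qed auto
qed

context weighted_oriented_graph
begin

lemma sgraph_nbrs: "sgraph (pverts D) (\<lambda>x y. y \<in> nbrs D x)"
proof
  show "finite (pverts D)" by (rule pair_finite_verts)
  show "x \<in> nbrs D y" if "y \<in> nbrs D x" for x y using that by (rule nbrs_sym)
  show "x \<notin> nbrs D x" for x using arc_neq by (auto simp: nbrs_def out_nbrs_def in_nbrs_def)
  show "x \<in> pverts D" if "y \<in> nbrs D x" for x y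
    using that arc_verts by (auto simp: nbrs_def out_nbrs_def in_nbrs_def)
qed

sublocale G: sgraph "pverts D" "\<lambda>x y. y \<in> nbrs D x"
  by (rule sgraph_nbrs)

text \<open>By maximality no vertex of the complement has all its neighbours there, and the weight
  condition is vacuous.\<close>

lemma max_stable_strong_cover:
  assumes "G.max_stable M"
  shows "strong_cover D w (pverts D - M)"
proof -
  have st: "M \<subseteq> pverts D" "\<And>x y. x \<in> M \<Longrightarrow> y \<in> M \<Longrightarrow> y \<notin> nbrs D x"
    and max: "\<And>x. x \<in> pverts D - M \<Longrightarrow> \<exists>y\<in>M. y \<in> nbrs D x"
    using assms by (auto simp: G.max_stable_def G.stable_def)
  show ?thesis
    unfolding strong_cover_def
  proof (intro conjI allI impI ballI)
    show "x \<in> pverts D - M \<or> y \<in> pverts D - M" if "(x, y) \<in> parcs D" for x y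
      using st(2)[of x y] nbrs_arc(1)[OF that] arc_verts[OF that] by blast
    fix x assume "x \<in> pverts D - M" "nbrs D x \<subseteq> pverts D - M"
    then have False using max by blast
    then show "\<exists>y\<in>pverts D - M. (y, x) \<in> parcs D \<and> 1 < w y \<and> out_nbrs D y \<subseteq> pverts D - M" ..
  qed simp
qed

section \<open>From semi-forests to strong covers\<close>

lemma oriented_two_step: "(y, x) \<in> parcs D \<Longrightarrow> (a, y) \<in> parcs D \<Longrightarrow> a \<noteq> x"
  using oriented by blast

text \<open>The cover is the complement of a stable set \<open>S\<close> that contains
  \<open>W1\<close> and is maximal outside \<open>H\<close> and outside the set \<open>N\<close> of
  out-neighbours of \<open>W2 \<union> H'\<close>. A vertex all of whose neighbours lie in the cover
  belongs to \<open>N\<close>: outside \<open>H\<close> by maximality of \<open>S\<close>; in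
  \<open>H\<close> because every vertex lies in \<open>N\<close> or is a root attached to a vertex
  of \<open>W1 \<subseteq> S\<close>. The members of \<open>W2 \<union> H'\<close> have weight above
  1 and out-neighbours in \<open>N\<close>, so they are the required in-neighbours.\<close>

lemma forest_strong_cover_aux:
  fixes r s :: nat and u :: "nat \<Rightarrow> 'v" and T B :: "nat \<Rightarrow> 'v pair_pre_digraph"
  assumes HD: "subgraph (with_proj H) (with_proj D)"
    and T': "\<forall>i<r. ROT D w (T i) (v i)" and B': "\<forall>j<s. unicycle D w (B j)"
    and pH: "pverts H = (\<Union>i<r. pverts (T i)) \<union> (\<Union>j<s. pverts (B j))"
    and aH: "parcs H = (\<Union>i<r. parcs (T i)) \<union> (\<Union>j<s. parcs (B j))"
    and TT': "\<forall>i<r. \<forall>i'<r. i \<noteq> i' \<longrightarrow> pverts (T i) \<inter> pverts (T i') = {}"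
    and BB': "\<forall>j<s. \<forall>j'<s. j \<noteq> j' \<longrightarrow> pverts (B j) \<inter> pverts (B j') = {}"
    and TB': "\<forall>i<r. \<forall>j<s. pverts (T i) \<inter> pverts (B j) = {}"
    and u': "\<forall>i<r. u i \<in> pverts D - pverts H \<and> u i \<in> nbrs D (v i)"
    and W: "u ` {..<r} = W1 \<union> W2" "W1 \<inter> W2 = {}" "stable_set D W1" "W2 \<subseteq> V_plus D w"
    and uW2': "\<forall>i<r. u i \<in> W2 \<longrightarrow> (u i, v i) \<in> parcs D"
    and out: "(\<Union>x\<in>W2 \<union> ({x \<in> pverts H. 2 \<le> deg H x} \<union> {v i | i. i < r \<and> deg H (v i) = 1}).
      out_nbrs D x) \<inter> W1 = {}"
  shows "\<exists>C. strong_cover D w C \<and> pverts H \<subseteq> C"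
proof -
  note T = T'[rule_format] and B = B'[rule_format] and TT = TT'[rule_format] and BB = BB'[rule_format]
    and TB = TB'[rule_format] and u = u'[rule_format] and uW2 = uW2'[rule_format]
  define H' where "H' = {x \<in> pverts H. 2 \<le> deg H x} \<union> {v i | i. i < r \<and> deg H (v i) = 1}"
  define N where "N = (\<Union>x\<in>W2 \<union> H'. out_nbrs D x)"
  have HsubD: "pverts H \<subseteq> pverts D" "parcs H \<subseteq> parcs D"
    using HD by (auto simp: subgraph_with_proj_iff)
  have wfT: "(x, y) \<in> parcs (T i) \<Longrightarrow> x \<in> pverts (T i) \<and> y \<in> pverts (T i)" if "i < r" for i x y
    using T[OF that] unfolding ROT_def subgraph_with_proj_iff wf_digraph_with_proj_iff by blast
  have wfB: "(x, y) \<in> parcs (B j) \<Longrightarrow> x \<in> pverts (B j) \<and> y \<in> pverts (B j)" if "j < s" for j x y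
    using B[OF that] unfolding unicycle_def subgraph_with_proj_iff wf_digraph_with_proj_iff by blast
  have vT: "v i \<in> pverts (T i)" if "i < r" for i using T[OF that] by (simp add: ROT_def)
  have TH: "parcs (T i) \<subseteq> parcs H" "pverts (T i) \<subseteq> pverts H" if "i < r" for i
    using that aH pH by auto
  have BH: "parcs (B i) \<subseteq> parcs H" "pverts (B i) \<subseteq> pverts H" if "i < s" for i
    using that aH pH by auto
  have arcH: "(x, y) \<in> parcs (T i)" if "(x, y) \<in> parcs H" "i < r" "x \<in> pverts (T i) \<or> y \<in> pverts (T i)" for i x y
  proof -
    have "\<exists>i'<r. (x, y) \<in> parcs (T i')" using that aH wfB TB[OF that(2)] by blast
    then show ?thesis using that wfT TT by blast
  qed
  have arcHB: "(x, y) \<in> parcs (B j)" if "(x, y) \<in> parcs H" "j < s" "x \<in> pverts (B j) \<or> y \<in> pverts (B j)" for j x y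
  proof -
    have "\<exists>j'<s. (x, y) \<in> parcs (B j')" using that aH wfT TB[OF _ that(2)] by blast
    then show ?thesis using that wfB BB by blast
  qed
  have degT: "deg H x = deg (T i) x" if "i < r" "x \<in> pverts (T i)" for i x
  proof -
    have "nbrs H x = nbrs (T i) x"
      using arcH that TH(1)[OF that(1)] unfolding nbrs_def out_nbrs_def in_nbrs_def by blast
    then show ?thesis by (simp add: deg_def)
  qed
  have degB: "deg H x = deg (B j) x" if "j < s" "x \<in> pverts (B j)" for j x
  proof -
    have "nbrs H x = nbrs (B j) x"
      using arcHB that BH(1)[OF that(1)] unfolding nbrs_def out_nbrs_def in_nbrs_def by blast
    then show ?thesis by (simp add: deg_def)
  qed
  have w1: "1 \<le> w x" if "x \<in> pverts H" for x using that HsubD weight_pos by blast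
  have H'H: "y \<in> pverts H" if "y \<in> H'" for y using that vT TH unfolding H'_def by blast
  \<comment> \<open>A vertex of weight 1 is a leaf that is not a root, or a tree by itself with
    degree 0; neither occurs in \<open>H'\<close>.\<close>
  have H'w: "1 < w y" if y: "y \<in> H'" for y
  proof (rule ccontr)
    assume "\<not> 1 < w y"
    then have wy: "w y = 1" using w1[OF H'H[OF y]] by simp
    have "y \<in> (\<Union>i<r. pverts (T i)) \<union> (\<Union>j<s. pverts (B j))" using H'H[OF y] pH by simp
    then consider i where "i < r" "y \<in> pverts (T i)" | j where "j < s" "y \<in> pverts (B j)" by blast
    then show False
    proof cases
      case 1
      have "\<forall>x\<in>pverts (T i). w x = 1 \<longrightarrow> deg (T i) x = 1 \<and> x \<noteq> v i \<or> pverts (T i) = {v i} \<and> x = v i"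
        using T[OF 1(1)] unfolding ROT_def by blast
      then consider "deg (T i) y = 1" "y \<noteq> v i" | "pverts (T i) = {v i}" using wy 1 by blast
      then show False
      proof cases
        case 1
        then have "\<exists>i'<r. y = v i'" using y degT \<open>i < r\<close> \<open>y \<in> pverts (T i)\<close> unfolding H'_def by auto
        then show False using vT TT \<open>i < r\<close> \<open>y \<in> pverts (T i)\<close> 1(2) by blast
      next
        case 2
        have "nbrs (T i) y = {}"
        proof (rule ccontr)
          assume "nbrs (T i) y \<noteq> {}"
          then obtain z where "(y, z) \<in> parcs (T i) \<or> (z, y) \<in> parcs (T i)"
            unfolding nbrs_def out_nbrs_def in_nbrs_def by blast
          then have "z \<in> pverts (T i)" "(y, z) \<in> parcs D \<or> (z, y) \<in> parcs D"
            using wfT[OF \<open>i < r\<close>] TH(1)[OF \<open>i < r\<close>] HsubD(2) by blast+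
          moreover have "z = y" using 2 \<open>y \<in> pverts (T i)\<close> calculation(1) by simp
          ultimately show False using arc_neq by blast
        qed
        then have "deg H y = 0" using degT[OF \<open>i < r\<close> \<open>y \<in> pverts (T i)\<close>] by (simp add: deg_def)
        then show False using y unfolding H'_def by auto
      qed
    next
      case 2
      have "deg (B j) y = 1" using B[OF 2(1)] wy 2(2) unfolding unicycle_def by blast
      then have "\<exists>i<r. y = v i" using y degB[OF 2] unfolding H'_def by auto
      then show False using vT TB 2 by blast
    qed
  qed
  have finH: "finite (nbrs H y)" for y
  proof -
    have "nbrs H y \<subseteq> pverts D" using HsubD(2) arc_verts by (auto simp: nbrs_def out_nbrs_def in_nbrs_def)
    then show ?thesis using pair_finite_verts finite_subset by blast
  qed
  \<comment> \<open>The two neighbours are different because an arc is never reversed in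
    \<open>D\<close>.\<close>
  have deg2: "y \<in> H'" if "(a, y) \<in> parcs H" "(y, x) \<in> parcs H" for a x y
  proof -
    have ax: "a \<noteq> x" using oriented_two_step that HsubD(2) by blast
    have "{a, x} \<subseteq> nbrs H y" using nbrs_arc(2)[OF that(1)] nbrs_arc(1)[OF that(2)] by simp
    then have "card {a, x} \<le> deg H y" unfolding deg_def by (rule card_mono[OF finH])
    moreover have "y \<in> pverts H"
      using that(1) HD unfolding subgraph_with_proj_iff wf_digraph_with_proj_iff by blast
    ultimately show ?thesis using ax by (simp add: H'_def)
  qed
  have inN: "x \<in> N" if "y \<in> H'" "(y, x) \<in> parcs H" for x y
    using that HsubD(2) by (auto simp: N_def out_nbrs_def)
  \<comment> \<open>Except for a root attached to \<open>W1\<close>, each vertex has an arc from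
    \<open>H'\<close> or \<open>W2\<close>: the last arc of a path from the root or the cycle, the
    arc on the cycle, or the arc from the attached vertex.\<close>
  have V_H: "x \<in> N \<or> (\<exists>i<r. x = v i \<and> u i \<in> W1)" if x: "x \<in> pverts H" for x
  proof -
    consider i where "i < r" "x \<in> pverts (T i)" | j where "j < s" "x \<in> pverts (B j)"
      using x pH by blast
    then show ?thesis
    proof cases
      case 1
      show ?thesis
      proof (cases "x = v i")
        case True
        have "u i \<in> W1 \<or> u i \<in> W2" using W(1) 1(1) by blast
        moreover have "x \<in> N" if "u i \<in> W2"
          using uW2[OF 1(1) that] that True by (auto simp: N_def out_nbrs_def)
        ultimately show ?thesis using True 1(1) by blast
      next
        case False
        then obtain p where "pre_digraph.apath (with_proj (T i)) (v i) p x"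
          using T[OF 1(1)] 1(2) unfolding ROT_def by blast
        from apath_last_arc[OF this False] obtain y where
          y: "(y, x) \<in> parcs (T i)" "y = v i \<or> (\<exists>a. (a, y) \<in> parcs (T i) \<and> a \<noteq> x)" by blast
        have yH: "(y, x) \<in> parcs H" using y TH[OF 1(1)] by blast
        have "y \<in> H'"
        proof (cases "y = v i")
          case True
          note finH[of y]
          moreover have "x \<in> nbrs H y" by (rule nbrs_arc(1)[OF yH])
          ultimately have "deg H (v i) \<noteq> 0" using True unfolding deg_def by auto
          then have "deg H (v i) = 1 \<or> 2 \<le> deg H (v i)" by linarith
          then show ?thesis using True 1(1) vT TH unfolding H'_def by blast
        next
          case False
          then show ?thesis using y(2) yH deg2 TH[OF 1(1)] by blast
        qed
        then show ?thesis using inN yH by blast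
      qed
    next
      case 2
      obtain c where c: "pre_digraph.cycle (with_proj (B j)) c"
        and p: "\<forall>x\<in>pverts (B j) - fst ` set c. \<exists>y\<in>fst ` set c. \<exists>p. pre_digraph.apath (with_proj (B j)) y p x"
        using B[OF 2(1)] unfolding unicycle_def by blast
      note BHj = BH(1)[OF 2(1)]
      show ?thesis
      proof (cases "x \<in> fst ` set c")
        case True
        then obtain y where y: "(y, x) \<in> set c" "(y, x) \<in> parcs (B j)" using cycle_predecessor[OF c] by blast
        then have "y \<in> fst ` set c" by force
        then obtain a where "(a, y) \<in> parcs (B j)" using cycle_predecessor[OF c] by blast
        then show ?thesis using inN deg2 y(2) BHj by blast
      next
        case False
        then obtain y0 q where y0: "y0 \<in> fst ` set c" and q: "pre_digraph.apath (with_proj (B j)) y0 q x"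
          using p 2(2) by blast
        have "x \<noteq> y0" using False y0 by blast
        from apath_last_arc[OF q this] obtain y where
          y: "(y, x) \<in> parcs (B j)" "y = y0 \<or> (\<exists>a. (a, y) \<in> parcs (B j) \<and> a \<noteq> x)" by blast
        then have "\<exists>a. (a, y) \<in> parcs (B j)" using cycle_predecessor[OF c y0] by blast
        then show ?thesis using inN deg2 y(1) BHj by blast
      qed
    qed
  qed
  let ?U = "pverts D - pverts H - N"
  have W1U: "W1 \<subseteq> ?U"
  proof
    fix z assume z: "z \<in> W1"
    then have "z \<in> u ` {..<r}" using W(1) by simp
    then obtain i where "i < r" "z = u i" by blast
    then have "z \<in> pverts D - pverts H" using u[of i] by simp
    moreover have "N \<inter> W1 = {}" using out unfolding N_def H'_def .
    ultimately show "z \<in> ?U" using z by blast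
  qed
  have "G.stable W1"
    unfolding G.stable_def
  proof (intro conjI ballI)
    show "W1 \<subseteq> pverts D" using W1U by blast
    show "y \<notin> nbrs D x" if "x \<in> W1" "y \<in> W1" for x y
      using W(3) that by (simp add: stable_set_def nbrs_def out_nbrs_def in_nbrs_def)
  qed
  then obtain S where S: "W1 \<subseteq> S" "S \<subseteq> ?U" "G.stable S" "\<And>x. x \<in> ?U \<Longrightarrow> x \<notin> S \<Longrightarrow> \<exists>y\<in>S. y \<in> nbrs D x"
    by (rule G.stable_extend[OF _ W1U]) (blast, rule that)
  have "strong_cover D w (pverts D - S)"
    unfolding strong_cover_def
  proof (intro conjI allI impI ballI)
    show "x \<in> pverts D - S \<or> y \<in> pverts D - S" if "(x, y) \<in> parcs D" for x y
      using S(3) nbrs_arc(1)[OF that] arc_verts[OF that] unfolding G.stable_def by blast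
    fix x assume x: "x \<in> pverts D - S" "nbrs D x \<subseteq> pverts D - S"
    have "x \<notin> ?U" using S(4) x by blast
    then have "x \<in> N \<or> x \<in> pverts H" using x by blast
    moreover have "x \<in> N" if xH: "x \<in> pverts H"
    proof (rule ccontr)
      assume "x \<notin> N"
      then obtain i where "i < r" "x = v i" "u i \<in> W1" using V_H[OF xH] by blast
      then show False using u x(2) S(1) by blast
    qed
    ultimately obtain y where y: "y \<in> W2 \<union> H'" "(y, x) \<in> parcs D" by (auto simp: N_def out_nbrs_def)
    have "y \<in> pverts D - S" using x(2) nbrs_arc(2)[OF y(2)] by blast
    moreover have "1 < w y" using y(1) H'w W(4) by (auto simp: V_plus_def)
    moreover have "out_nbrs D y \<subseteq> N" using y(1) by (auto simp: N_def)
    then have "out_nbrs D y \<subseteq> pverts D - S" using S(2) arc_verts by (fastforce simp: out_nbrs_def)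
    ultimately show "\<exists>y\<in>pverts D - S. (y, x) \<in> parcs D \<and> 1 < w y \<and> out_nbrs D y \<subseteq> pverts D - S"
      using y(2) by blast
  qed simp
  moreover have "pverts H \<subseteq> pverts D - S" using S(2) HsubD by blast
  ultimately show ?thesis by blast
qed

lemma forest_strong_cover:
  assumes "star_semi_forest D w H"
  shows "\<exists>C. strong_cover D w C \<and> pverts H \<subseteq> C"
  using assms unfolding star_semi_forest_def Let_def
  by (elim exE conjE) (rule forest_strong_cover_aux, assumption+)

end

text \<open>The tails of the arcs form the vertex list; the index modulo the length accounts for the
  closing arc.\<close>

lemma ucycle_vertex_list:
  assumes "ucycle G p" "parcs G \<subseteq> pverts G \<times> pverts G"
  shows "\<exists>L. distinct L \<and> length L = length p \<and> 3 \<le> length L \<and> set L \<subseteq> pverts G \<and>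
    (\<forall>i<length L. L ! (Suc i mod length L) \<in> nbrs G (L ! i)) \<and>
    uedges p = {{L ! i, L ! (Suc i mod length L)} | i. i < length L}"
proof -
  obtain u where u: "u \<in> pverts G" "set p \<subseteq> parcs (mk_symmetric (with_proj G))" "pcas u p u"
      "distinct (map snd p)" "3 \<le> length p"
    using assms(1) by (auto simp: ucycle_def with_proj_cycle_iff)
  let ?L = "map fst p"
  let ?n = "length p"
  have m: "u # map snd p = ?L @ [u]" by (rule pcas_map[OF u(3)])
  have snd: "snd (p ! i) = ?L ! (Suc i mod ?n)" if i: "i < ?n" for i
  proof -
    have "snd (p ! i) = (u # map snd p) ! Suc i" using i by simp
    also have "\<dots> = (?L @ [u]) ! Suc i" by (simp only: m)
    also have "\<dots> = ?L ! (Suc i mod ?n)"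
    proof (cases "Suc i < ?n")
      case True then show ?thesis by (simp add: nth_append)
    next
      case False
      then have "Suc i = ?n" using i by simp
      moreover have "?L ! 0 = u" using m i by (cases p) auto
      ultimately show ?thesis by (simp add: nth_append)
    qed
    finally show ?thesis .
  qed
  have arc: "p ! i = (?L ! i, ?L ! (Suc i mod ?n))" if "i < ?n" for i
    using snd[OF that] that by (simp add: prod_eq_iff)
  have "mset (map snd p) = mset ?L"
  proof -
    have "mset (u # map snd p) = mset (?L @ [u])" by (simp only: m)
    then show ?thesis by simp
  qed
  then have "distinct ?L" using u(4) by (metis mset_eq_imp_distinct_iff)
  moreover have nb: "?L ! (Suc i mod ?n) \<in> nbrs G (?L ! i)" if "i < ?n" for i
    using u(2) nth_mem[OF that] arc[OF that] by (metis mk_symmetric_arc subsetD)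
  moreover have "set ?L \<subseteq> pverts G"
  proof
    fix x assume "x \<in> set ?L"
    then obtain y where "(x, y) \<in> set p" by auto
    then have "(x, y) \<in> parcs (mk_symmetric (with_proj G))" using u(2) by blast
    then have "y \<in> nbrs G x" by simp
    then show "x \<in> pverts G" using assms(2) by (auto simp: nbrs_def out_nbrs_def in_nbrs_def)
  qed
  moreover have "uedges p = {{?L ! i, ?L ! (Suc i mod ?n)} | i. i < ?n}"
  proof -
    have "set p = (\<lambda>i. p ! i) ` {..<?n}" by (auto simp: set_conv_nth)
    also have "\<dots> = (\<lambda>i. (?L ! i, ?L ! (Suc i mod ?n))) ` {..<?n}"
      by (rule image_cong) (use arc in auto)
    finally have "uedges p = (\<lambda>i. {?L ! i, ?L ! (Suc i mod ?n)}) ` {..<?n}"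
      unfolding uedges_def by (simp only: image_image prod.case)
    then show ?thesis by blast
  qed
  ultimately show ?thesis using u(5) by (intro exI[of _ ?L]) simp
qed

text \<open>A cycle on at most three vertices is the triangle. The conclusions are used to refute
  cycles in the small trees below; \<open>a\<close>, \<open>b\<close>, \<open>c\<close> may
  coincide, so the case of fewer vertices is included.\<close>

lemma ucycle_card_le_3:
  assumes p: "ucycle G p" and G: "parcs G \<subseteq> pverts G \<times> pverts G" and V: "pverts G \<subseteq> {a, b, c}"
  shows "distinct [a, b, c]" "b \<in> nbrs G a" "c \<in> nbrs G b" "c \<in> nbrs G a"
    "uedges p = {{a, b}, {b, c}, {c, a}}"
proof -
  from ucycle_vertex_list[OF p G] obtain L where L': "distinct L" "3 \<le> length L" "set L \<subseteq> pverts G"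
    "\<forall>i<length L. L ! (Suc i mod length L) \<in> nbrs G (L ! i)"
    "uedges p = {{L ! i, L ! (Suc i mod length L)} | i. i < length L}"
    by (elim exE conjE) (rule that)
  note L = L'(1,2) subset_trans[OF L'(3) V] L'(4,5)
  have "length L = card (set L)" using L(1) by (simp add: distinct_card)
  also have "\<dots> \<le> card {a, b, c}" using L(3) by (intro card_mono) auto
  finally have le: "3 \<le> card {a, b, c}" "length L \<le> card {a, b, c}" using L(2) by auto
  show d: "distinct [a, b, c]" using le(1) by (auto simp: card_insert_if split: if_splits)
  then have "length L = 3" using le L(2) by simp
  then obtain x y z where xyz: "L = [x, y, z]" by (auto simp: numeral_3_eq_3 length_Suc_conv)
  have n: "y \<in> nbrs G x" "z \<in> nbrs G y" "x \<in> nbrs G z"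
    using L(4)[rule_format, of 0] L(4)[rule_format, of 1] L(4)[rule_format, of 2] by (simp_all add: xyz)
  have e: "uedges p = {{x, y}, {y, z}, {z, x}}"
  proof -
    have "uedges p = (\<lambda>i. {L ! i, L ! (Suc i mod 3)}) ` {i. i < 3}"
      unfolding L(5) by (simp only: setcompr_eq_image \<open>length L = 3\<close>)
    moreover have "{i. i < (3::nat)} = {0, 1, 2}" by auto
    ultimately show ?thesis by (simp add: xyz)
  qed
  have "x \<in> {a, b, c}" "y \<in> {a, b, c}" "z \<in> {a, b, c}" "x \<noteq> y" "y \<noteq> z" "x \<noteq> z"
    using L(1,3) by (auto simp: xyz)
  then show "b \<in> nbrs G a" "c \<in> nbrs G b" "c \<in> nbrs G a" "uedges p = {{a, b}, {b, c}, {c, a}}"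
    using n n[THEN nbrs_sym] unfolding e by (auto simp: doubleton_eq_iff)
qed

section \<open>From strong covers to semi-forests on at most three vertices\<close>

context weighted_oriented_graph
begin

text \<open>What a strong cover demands of an in-neighbour, apart from membership in
  \<open>C\<close>. The arcs of the forests constructed below are taken from this relation.\<close>

definition parent :: "'v set \<Rightarrow> 'v \<Rightarrow> 'v \<Rightarrow> bool" where
  "parent C y x \<longleftrightarrow> (y, x) \<in> parcs D \<and> 1 < w y \<and> out_nbrs D y \<subseteq> C"

text \<open>\<open>x\<close> may serve as a root: the vertex \<open>u\<close> is attached to it, as
  a member of \<open>W1\<close> if it is outside \<open>C\<close> and of \<open>W2\<close> if it is
  in \<open>C\<close>.\<close>

definition attached :: "'v set \<Rightarrow> 'v set \<Rightarrow> 'v \<Rightarrow> bool" where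
  "attached C Z x \<longleftrightarrow> (\<exists>u\<in>pverts D - Z. u \<in> nbrs D x \<and> (u \<in> C \<longrightarrow> parent C u x))"

text \<open>The vertex set \<open>Z'\<close> carries a rooted oriented tree that can be part of a forest on \<open>Z\<close> which
  belongs to the cover \<open>C\<close>.\<close>

definition tree_on :: "'v set \<Rightarrow> 'v set \<Rightarrow> 'v set \<Rightarrow> bool" where
  "tree_on C Z Z' \<longleftrightarrow> (\<exists>T v. ROT D w T v \<and> pverts T = Z' \<and> attached C Z v \<and>
    (\<forall>y\<in>Z'. 2 \<le> deg T y \<or> y = v \<and> deg T y = 1 \<longrightarrow> out_nbrs D y \<subseteq> C))"

lemma tree_onI:
  assumes "ROT D w T v" "pverts T = Z'" "attached C Z v"
    and "\<forall>y\<in>Z'. 2 \<le> deg T y \<or> y = v \<and> deg T y = 1 \<longrightarrow> out_nbrs D y \<subseteq> C"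
  shows "tree_on C Z Z'"
  unfolding tree_on_def using assms by blast

lemma wf_D: "wf_digraph (with_proj D)"
  using arc_verts by (auto simp: wf_digraph_with_proj_iff)

lemma parent_arc: "parent C y x \<Longrightarrow> (y, x) \<in> parcs D"
  by (simp add: parent_def)

lemma parent_asym: "parent C y x \<Longrightarrow> \<not> parent C x y" "parent C y x \<Longrightarrow> y \<noteq> x"
  using oriented arc_neq by (auto simp: parent_def)

text \<open>A neighbour outside \<open>C\<close> can be attached. If there is none, the strong cover
  supplies a parent, which is in \<open>Z\<close> or can itself be attached.\<close>

lemma attached_or_parent:
  assumes "strong_cover D w C" "Z \<subseteq> C" "x \<in> Z"
  shows "attached C Z x \<or> (\<exists>y\<in>Z. parent C y x)"
proof (cases "nbrs D x \<subseteq> C")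
  case True
  then obtain y where y: "y \<in> C" "parent C y x"
    using assms unfolding strong_cover_def parent_def by blast
  show ?thesis
  proof (cases "y \<in> Z")
    case False
    moreover note a = arc_verts(1)[OF parent_arc[OF y(2)]] nbrs_arc(2)[OF parent_arc[OF y(2)]]
    ultimately show ?thesis using y(2) unfolding attached_def by (intro disjI1 bexI[of _ y] conjI impI) auto
  qed (use y in blast)
next
  case False
  then obtain u where u: "u \<in> nbrs D x" "u \<notin> C" by blast
  then have "u \<in> pverts D - Z" using G.E_V2[OF u(1)] assms(2) by blast
  then show ?thesis using u unfolding attached_def by (intro disjI1 bexI[of _ u] conjI impI) auto
qed

lemma nbrs_simple: "nbrs \<lparr>pverts = X0, parcs = A\<rparr> x = {y. (x, y) \<in> A \<or> (y, x) \<in> A}"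
  by (auto simp: nbrs_def out_nbrs_def in_nbrs_def)

lemma subgraphI:
  assumes "Z \<subseteq> pverts D" "A \<subseteq> parcs D" "A \<subseteq> Z \<times> Z"
  shows "subgraph (with_proj \<lparr>pverts = Z, parcs = A\<rparr>) (with_proj D)"
  using assms wf_D unfolding subgraph_with_proj_iff wf_digraph_with_proj_iff by auto

lemma tree_on_single:
  assumes "a \<in> pverts D" "attached C Z a"
  shows "tree_on C Z {a}"
proof -
  let ?T = "\<lparr>pverts = {a}, parcs = {}\<rparr>"
  have "\<not> ucycle ?T p" for p using ucycle_card_le_3(1)[of ?T p a a a] by auto
  then have "ROT D w ?T a" using assms subgraphI[of "{a}" "{}"] by (simp add: ROT_def)
  moreover have "deg ?T a = 0" by (simp add: deg_def nbrs_simple)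
  ultimately show ?thesis unfolding tree_on_def using assms(2) by (intro exI[of _ ?T] exI[of _ a]) simp
qed

lemma tree_on_edge:
  assumes r: "attached C Z a" and p: "parent C a b"
  shows "tree_on C Z {a, b}"
proof -
  let ?T = "\<lparr>pverts = {a, b}, parcs = {(a, b)}\<rparr>"
  have ab: "a \<noteq> b" "a \<in> pverts D" "b \<in> pverts D" "(a, b) \<in> parcs D" "1 < w a" "out_nbrs D a \<subseteq> C"
    using p parent_asym(2)[OF p] arc_verts by (auto simp: parent_def)
  have nc: "\<not> ucycle ?T q" for q using ucycle_card_le_3(1)[of ?T q a b b] by auto
  have deg: "deg ?T b = 1"
  proof -
    have "nbrs ?T b = {a}" using ab by (auto simp: nbrs_simple)
    then show ?thesis by (simp add: deg_def)
  qed
  have "pre_digraph.apath (with_proj ?T) a [(a, b)] b" using ab by (simp add: with_proj_apath_iff)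
  then have R: "ROT D w ?T a"
    unfolding ROT_def using ab nc deg subgraphI[of "{a, b}" "{(a, b)}"] by auto
  have O: "\<forall>y\<in>{a, b}. 2 \<le> deg ?T y \<or> y = a \<and> deg ?T y = 1 \<longrightarrow> out_nbrs D y \<subseteq> C"
    by (intro ballI impI, elim insertE emptyE) (use ab deg in auto)
  show ?thesis by (rule tree_onI[OF R _ r O]) simp
qed

lemma tree_on_star:
  assumes r: "attached C Z a" and p: "parent C a b" "parent C a c" and bc: "b \<noteq> c"
  shows "tree_on C Z {a, b, c}"
proof -
  let ?T = "\<lparr>pverts = {a, b, c}, parcs = {(a, b), (a, c)}\<rparr>"
  have ab: "a \<noteq> b" "a \<noteq> c" "a \<in> pverts D" "b \<in> pverts D" "c \<in> pverts D" "(a, b) \<in> parcs D"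
    "(a, c) \<in> parcs D" "1 < w a" "out_nbrs D a \<subseteq> C"
    using p parent_asym(2)[OF p(1)] parent_asym(2)[OF p(2)] arc_verts by (auto simp: parent_def)
  have nb: "nbrs ?T b = {a}" "nbrs ?T c = {a}" using ab bc by (auto simp: nbrs_simple)
  have nc: "\<not> ucycle ?T q" for q using ucycle_card_le_3(3)[of ?T q a b c] nb ab by auto
  have deg: "deg ?T b = 1" "deg ?T c = 1" using nb by (simp_all add: deg_def)
  have "pre_digraph.apath (with_proj ?T) a [(a, b)] b" "pre_digraph.apath (with_proj ?T) a [(a, c)] c"
    using ab by (simp_all add: with_proj_apath_iff)
  then have R: "ROT D w ?T a"
    unfolding ROT_def using ab nc deg subgraphI[of "{a, b, c}" "{(a, b), (a, c)}"] by auto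
  have O: "\<forall>y\<in>{a, b, c}. 2 \<le> deg ?T y \<or> y = a \<and> deg ?T y = 1 \<longrightarrow> out_nbrs D y \<subseteq> C"
    by (intro ballI impI, elim insertE emptyE) (use ab deg in auto)
  show ?thesis by (rule tree_onI[OF R _ r O]) simp
qed

lemma tree_on_path:
  assumes r: "attached C Z a" and p: "parent C a b" "parent C b c" and ac: "a \<noteq> c"
  shows "tree_on C Z {a, b, c}"
proof -
  let ?T = "\<lparr>pverts = {a, b, c}, parcs = {(a, b), (b, c)}\<rparr>"
  have ab: "a \<noteq> b" "b \<noteq> c" "a \<in> pverts D" "b \<in> pverts D" "c \<in> pverts D" "(a, b) \<in> parcs D"
    "(b, c) \<in> parcs D" "1 < w a" "1 < w b" "out_nbrs D a \<subseteq> C" "out_nbrs D b \<subseteq> C"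
    using p parent_asym(2)[OF p(1)] parent_asym(2)[OF p(2)] arc_verts by (auto simp: parent_def)
  have nb: "nbrs ?T c = {b}" using ab ac by (auto simp: nbrs_simple)
  have nc: "\<not> ucycle ?T q" for q
    using ucycle_card_le_3(4)[of ?T q a b c, THEN nbrs_sym] nb ab by auto
  have deg: "deg ?T c = 1" using nb by (simp add: deg_def)
  have "pre_digraph.apath (with_proj ?T) a [(a, b)] b"
    "pre_digraph.apath (with_proj ?T) a [(a, b), (b, c)] c"
    using ab ac by (simp_all add: with_proj_apath_iff)
  then have R: "ROT D w ?T a"
    unfolding ROT_def using ab nc deg subgraphI[of "{a, b, c}" "{(a, b), (b, c)}"] by auto
  have O: "\<forall>y\<in>{a, b, c}. 2 \<le> deg ?T y \<or> y = a \<and> deg ?T y = 1 \<longrightarrow> out_nbrs D y \<subseteq> C"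
    by (intro ballI impI, elim insertE emptyE) (use ab deg in auto)
  show ?thesis by (rule tree_onI[OF R _ r O]) simp
qed

definition has_forest :: "'v set \<Rightarrow> bool" where
  "has_forest Z \<longleftrightarrow> (\<exists>H. star_semi_forest D w H \<and> pverts H = Z)"

text \<open>The attached vertices are split by membership in \<open>C\<close>. Those outside form a
  stable set because \<open>C\<close> is a cover, and the out-neighbours of \<open>W2\<close> and of
  the inner vertices remain in \<open>C\<close>, so they avoid that set.\<close>

lemma forest_of_trees:
  fixes n :: nat
  assumes C: "strong_cover D w C" "Z \<subseteq> C" and Z: "Z = (\<Union>i<n. P i)"
    and disj: "\<And>i j. i < n \<Longrightarrow> j < n \<Longrightarrow> i \<noteq> j \<Longrightarrow> P i \<inter> P j = {}"
    and P: "\<And>i. i < n \<Longrightarrow> tree_on C Z (P i)"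
  shows "has_forest Z"
proof -
  let ?Q = "\<lambda>i (T, v, u). ROT D w T v \<and> pverts T = P i \<and> u \<in> pverts D - Z \<and> u \<in> nbrs D v \<and>
    (u \<in> C \<longrightarrow> parent C u v) \<and>
    (\<forall>y\<in>P i. 2 \<le> deg T y \<or> y = v \<and> deg T y = 1 \<longrightarrow> out_nbrs D y \<subseteq> C)"
  have "\<forall>i\<in>{..<n}. \<exists>q. ?Q i q"
  proof
    fix i assume "i \<in> {..<n}"
    then obtain T v where Tv: "ROT D w T v" "pverts T = P i" "attached C Z v"
      "\<forall>y\<in>P i. 2 \<le> deg T y \<or> y = v \<and> deg T y = 1 \<longrightarrow> out_nbrs D y \<subseteq> C"
      using P unfolding tree_on_def by blast
    then obtain u where u: "u \<in> pverts D - Z" "u \<in> nbrs D v" "u \<in> C \<longrightarrow> parent C u v"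
      unfolding attached_def by blast
    show "\<exists>q. ?Q i q"
      by (rule exI[of _ "(T, v, u)"], unfold prod.case) (intro conjI Tv(1,2,4) u)
  qed
  from bchoice[OF this] obtain f where f: "\<forall>i\<in>{..<n}. ?Q i (f i)" by (elim exE)
  define T v u where "T i = fst (f i)" and "v i = fst (snd (f i))" and "u i = snd (snd (f i))" for i
  have Tvu: "?Q i (T i, v i, u i)" if "i < n" for i
  proof -
    have "f i = (T i, v i, u i)" by (simp add: T_def v_def u_def)
    moreover have "?Q i (f i)" by (rule f[THEN bspec]) (simp add: that)
    ultimately show ?thesis by (rule subst)
  qed
  have T: "ROT D w (T i) (v i)" "pverts (T i) = P i" "u i \<in> pverts D - Z" "u i \<in> nbrs D (v i)"
    "u i \<in> C \<Longrightarrow> parent C (u i) (v i)"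
    "\<lbrakk>y \<in> P i; 2 \<le> deg (T i) y \<or> y = v i \<and> deg (T i) y = 1\<rbrakk> \<Longrightarrow> out_nbrs D y \<subseteq> C" if "i < n" for i y
    using Tvu[OF that] unfolding prod.case by blast+
  let ?H = "\<lparr>pverts = Z, parcs = (\<Union>i<n. parcs (T i))\<rparr>"
  have subT: "pverts (T i) \<subseteq> pverts D" "parcs (T i) \<subseteq> parcs D"
    "\<And>x y. (x, y) \<in> parcs (T i) \<Longrightarrow> x \<in> P i \<and> y \<in> P i" "v i \<in> P i" if "i < n" for i
    using T(1,2)[OF that] unfolding ROT_def subgraph_with_proj_iff wf_digraph_with_proj_iff by auto
  have degT: "deg ?H x = deg (T i) x" if "i < n" "x \<in> P i" for i x
  proof -
    have same: "j = i" if "j < n" "x \<in> P j" for j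
      using disj[OF that(1) \<open>i < n\<close>] that(2) \<open>x \<in> P i\<close> by blast
    have "e \<in> parcs (T i)" if e: "e \<in> parcs ?H" "fst e = x \<or> snd e = x" for e
    proof -
      obtain j where j: "j < n" "e \<in> parcs (T j)" using e(1) by auto
      then have "x \<in> P j" using subT(3)[OF j(1), of "fst e" "snd e"] e(2) by auto
      then show ?thesis using same[OF j(1)] j(2) by simp
    qed
    moreover have "parcs (T i) \<subseteq> parcs ?H" using \<open>i < n\<close> by auto
    ultimately have "(x, y) \<in> parcs ?H \<longleftrightarrow> (x, y) \<in> parcs (T i)"
      "(y, x) \<in> parcs ?H \<longleftrightarrow> (y, x) \<in> parcs (T i)" for y
      by fastforce+
    then have "nbrs ?H x = nbrs (T i) x" unfolding nbrs_def out_nbrs_def in_nbrs_def by blast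
    then show ?thesis by (simp add: deg_def)
  qed
  let ?W1 = "u ` {..<n} - C" and ?W2 = "u ` {..<n} \<inter> C"
  let ?H' = "{x \<in> pverts ?H. 2 \<le> deg ?H x} \<union> {v i | i. i < n \<and> deg ?H (v i) = 1}"
  have outH: "out_nbrs D y \<subseteq> C" if y: "y \<in> ?W2 \<union> ?H'" for y
  proof -
    consider (a) i where "i < n" "y = u i" "u i \<in> C" | (b) i where "i < n" "y \<in> P i" "2 \<le> deg ?H y"
      | (c) i where "i < n" "y = v i" "deg ?H (v i) = 1"
      using y Z by auto
    then show ?thesis
    proof cases
      case (a i) then show ?thesis using T(5)[OF a(1)] by (simp add: parent_def)
    next
      case (b i) then show ?thesis using T(6)[OF b(1,2)] degT[OF b(1,2)] by simp
    next
      case (c i)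
      then show ?thesis using T(6)[OF c(1) subT(4)[OF c(1)]] degT[OF c(1) subT(4)[OF c(1)]] by simp
    qed
  qed
  have "star_semi_forest D w ?H"
    unfolding star_semi_forest_def Let_def
  proof (rule conjI, goal_cases sub rest)
    case sub
    show ?case using subT T(2) Z by (intro subgraphI) fastforce+
  next
    case rest
    show ?case
    \<comment> \<open>There are no unicycle parts, so \<open>s\<close> is 0 and the family
      \<open>B\<close> is a dummy.\<close>
    proof (rule exI[of _ n], rule exI[of _ "0::nat"], rule exI[of _ T], rule exI[of _ v],
        rule exI[of _ u], rule exI[of _ "\<lambda>_. ?H"], rule exI[of _ ?W1], rule exI[of _ ?W2], intro conjI)
      show "stable_set D ?W1"
        using C(1) unfolding stable_set_def strong_cover_def by blast
      show "?W2 \<subseteq> V_plus D w"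
        using T(3,5) by (auto simp: V_plus_def parent_def)
      show "(\<Union>x\<in>?W2 \<union> ?H'. out_nbrs D x) \<inter> ?W1 = {}" using outH by blast
      show "\<forall>i<n. u i \<in> ?W2 \<longrightarrow> (u i, v i) \<in> parcs D" using T(5) by (simp add: parent_def)
      show "\<forall>i<n. u i \<in> pverts D - pverts ?H \<and> u i \<in> nbrs D (v i)" using T(3,4) by simp
      show "\<forall>i<n. \<forall>i'<n. i \<noteq> i' \<longrightarrow> pverts (T i) \<inter> pverts (T i') = {}" using T(2) disj by simp
      show "pverts ?H = (\<Union>i<n. pverts (T i)) \<union> (\<Union>j<0. pverts ?H)" using T(2) Z by simp
    qed (use T(1) in auto)
  qed
  then show ?thesis unfolding has_forest_def by (intro exI[of _ ?H]) simp
qed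

text \<open>Three vertices that are each other's parents in a circle need no root: the forest is one
  unicycle subgraph with no attached vertices.\<close>

lemma forest_of_cycle:
  assumes p: "parent C a b" "parent C b c" "parent C c a"
  shows "has_forest {a, b, c}"
proof -
  let ?B = "\<lparr>pverts = {a, b, c}, parcs = {(a, b), (b, c), (c, a)}\<rparr>"
  let ?c = "[(a, b), (b, c), (c, a)]"
  have ab: "a \<noteq> b" "b \<noteq> c" "c \<noteq> a" "a \<in> pverts D" "b \<in> pverts D" "c \<in> pverts D"
    "(a, b) \<in> parcs D" "(b, c) \<in> parcs D" "(c, a) \<in> parcs D" "1 < w a" "1 < w b" "1 < w c"
    "out_nbrs D a \<subseteq> C" "out_nbrs D b \<subseteq> C" "out_nbrs D c \<subseteq> C"
    using p p[THEN parent_asym(2)] arc_verts by (auto simp: parent_def)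
  have sub: "subgraph (with_proj ?B) (with_proj D)" using ab by (intro subgraphI) auto
  have cyc: "pre_digraph.cycle (with_proj ?B) ?c" using ab by (simp add: with_proj_cycle_iff)
  have edges: "uedges q = uedges ?c" if "ucycle ?B q" for q
    using ucycle_card_le_3(5)[OF that, of a b c] by (simp add: uedges_def)
  have uni: "unicycle D w ?B"
    unfolding unicycle_def using sub cyc edges ab by (intro conjI exI[of _ ?c]) auto
  have "star_semi_forest D w ?B"
    unfolding star_semi_forest_def Let_def
    by (rule conjI[OF sub], rule exI[of _ "0::nat"], rule exI[of _ "1::nat"], rule exI[of _ "\<lambda>_. ?B"],
        rule exI[of _ "\<lambda>_. a"], rule exI[of _ "\<lambda>_. a"], rule exI[of _ "\<lambda>_. ?B"],
        rule exI[of _ "{}"], rule exI[of _ "{}"])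
      (use uni in \<open>auto simp: stable_set_def\<close>)
  then show ?thesis unfolding has_forest_def by (intro exI[of _ ?B]) simp
qed

text \<open>Each vertex can be a root or has a parent in \<open>Z\<close>, and two vertices are
  never parents of each other. Choosing a parent for each vertex that cannot be a root leaves few
  shapes on at most three vertices, each of which is a semi-forest.\<close>

lemma strong_cover_has_forest:
  assumes C: "strong_cover D w C" "Z \<subseteq> C" and Z: "Z = {a, b, c}"
  shows "has_forest Z"
proof -
  have ZV: "Z \<subseteq> pverts D" using C by (auto simp: strong_cover_def)
  have rp: "attached C Z x \<or> (\<exists>y\<in>Z. parent C y x)" if "x \<in> Z" for x by (rule attached_or_parent[OF C that])
  have one: "has_forest Z" if "tree_on C Z Z"
    by (rule forest_of_trees[OF C, where n = 1 and P = "\<lambda>_. Z"]) (use that in auto)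
  have two: "has_forest Z" if "tree_on C Z X1" "tree_on C Z X2" "X1 \<inter> X2 = {}" "Z = X1 \<union> X2" for X1 X2
    by (rule forest_of_trees[OF C, where n = 2 and P = "\<lambda>i. if i = 0 then X1 else X2"])
      (use that in \<open>auto simp: less_2_cases_iff numeral_2_eq_2 lessThan_Suc\<close>)
  have three: "has_forest Z" if "tree_on C Z X1" "tree_on C Z X2" "tree_on C Z X3"
    "X1 \<inter> X2 = {}" "X1 \<inter> X3 = {}" "X2 \<inter> X3 = {}" "Z = X1 \<union> X2 \<union> X3" for X1 X2 X3
    by (rule forest_of_trees[OF C, where n = 3 and P = "\<lambda>i. if i = 0 then X1 else if i = 1 then X2 else X3"])
      (use that in \<open>auto simp: numeral_3_eq_3 lessThan_Suc less_Suc_eq\<close>)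
  have single: "tree_on C Z {x}" if "x \<in> Z" "attached C Z x" for x
    using tree_on_single that ZV by blast
  note asym = parent_asym[of C]
  consider "a = b" "b = c" | x y where "x \<noteq> y" "Z = {x, y}" | "a \<noteq> b" "a \<noteq> c" "b \<noteq> c"
    using Z by (metis insert_absorb2 insert_commute)
  then show ?thesis
  proof cases
    case 1
    then have "Z = {a}" using Z by simp
    then have "attached C Z a" using rp[of a] asym by auto
    then show ?thesis using one single \<open>Z = {a}\<close> by simp
  next
    case 2
    note xy = 2
    have xz: "x \<in> Z" "y \<in> Z" using xy by auto
    have "attached C Z x \<or> parent C y x" "attached C Z y \<or> parent C x y" using rp[of x] rp[of y] asym 2 by auto
    then consider "attached C Z x" "attached C Z y" | "attached C Z x" "parent C x y" | "attached C Z y" "parent C y x"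
      using asym by blast
    then show ?thesis
    proof cases
      case 1
      then show ?thesis
        using xy by (intro two[of "{x}" "{y}"] single xz) auto
    next
      case 2
      have "tree_on C Z Z" using tree_on_edge[OF 2] by (subst (2) xy(2))
      then show ?thesis by (rule one)
    next
      case 3
      have "Z = {y, x}" using xy(2) by auto
      then have "tree_on C Z Z" using tree_on_edge[OF 3] by simp
      then show ?thesis by (rule one)
    qed
  next
    case 3
    \<comment> \<open>The shapes on three vertices: \<open>R1\<close> is an edge and a single
      vertex, \<open>R2\<close> a star, \<open>R3\<close> a path, \<open>R4\<close> an oriented
      triangle, and \<open>R0\<close> three single vertices.\<close>
    have R1: "has_forest Z" if "Z = {x, y, z}" "distinct [x, y, z]" "attached C Z x" "attached C Z y" "parent C x z" for x y z
    proof (rule two[OF tree_on_edge[OF that(3,5)] single[of y]])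
      show "{x, z} \<inter> {y} = {}" "Z = {x, z} \<union> {y}" "y \<in> Z" using that(1,2) by auto
    qed (rule that(4))
    have R2: "has_forest Z" if "Z = {x, y, z}" "distinct [x, y, z]" "attached C Z x" "parent C x y" "parent C x z" for x y z
    proof (rule one)
      have "tree_on C Z {x, y, z}" using that(2) by (intro tree_on_star that) simp
      then show "tree_on C Z Z" by (simp add: that(1)[symmetric])
    qed
    have R3: "has_forest Z" if "Z = {x, y, z}" "distinct [x, y, z]" "attached C Z x" "parent C x y" "parent C y z" for x y z
    proof (rule one)
      have "tree_on C Z {x, y, z}" using that(2) by (intro tree_on_path that) simp
      then show "tree_on C Z Z" by (simp add: that(1)[symmetric])
    qed
    have R4: "has_forest Z" if "Z = {x, y, z}" "parent C x y" "parent C y z" "parent C z x" for x y z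
      using forest_of_cycle[OF that(2-4)] that(1) by simp
    have R0: "has_forest Z" if "attached C Z a" "attached C Z b" "attached C Z c"
    proof (rule three[OF single single single])
      show "{a} \<inter> {b} = {}" "{a} \<inter> {c} = {}" "{b} \<inter> {c} = {}" using 3 by auto
      show "a \<in> Z" "b \<in> Z" "c \<in> Z" "Z = {a} \<union> {b} \<union> {c}" using Z by auto
    qed (rule that)+
    have Zs: "Z = {a, c, b}" "Z = {b, a, c}" "Z = {b, c, a}" "Z = {c, a, b}" "Z = {c, b, a}"
      using Z by auto
    have d: "distinct [a, b, c]" "distinct [a, c, b]" "distinct [b, a, c]" "distinct [b, c, a]"
      "distinct [c, a, b]" "distinct [c, b, a]" using 3 by auto
    have "attached C Z a \<or> parent C b a \<or> parent C c a" "attached C Z b \<or> parent C a b \<or> parent C c b"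
      "attached C Z c \<or> parent C a c \<or> parent C b c"
      using rp[of a] rp[of b] rp[of c] asym(2) Z by auto
    moreover note asym(1)[of a b] asym(1)[of a c] asym(1)[of b c]
    moreover note R1[OF Z d(1)] R1[OF Zs(1) d(2)] R1[OF Zs(2) d(3)] R1[OF Zs(3) d(4)] R1[OF Zs(4) d(5)] R1[OF Zs(5) d(6)]
    moreover note R2[OF Z d(1)] R2[OF Zs(2) d(3)] R2[OF Zs(4) d(5)]
    moreover note R3[OF Z d(1)] R3[OF Zs(1) d(2)] R3[OF Zs(2) d(3)] R3[OF Zs(3) d(4)] R3[OF Zs(4) d(5)] R3[OF Zs(5) d(6)]
    moreover note R4[OF Z] R4[OF Zs(1)]
    ultimately show ?thesis using R0 by argo
  qed
qed

end

section \<open>Unmixedness of the edge ideal\<close>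

definition induced :: "'v pair_pre_digraph \<Rightarrow> 'v set \<Rightarrow> 'v pair_pre_digraph" where
  "induced D Z = \<lparr>pverts = Z, parcs = {e \<in> parcs D. fst e \<in> Z \<and> snd e \<in> Z}\<rparr>"

text \<open>Transfers unique existence along an injective encoding; it replaces simplices, which are
  digraphs, by their vertex sets.\<close>

lemma ex1_image_iff:
  assumes "\<And>K. P K \<longleftrightarrow> (\<exists>Z. Q Z \<and> K = f Z)" "\<And>Z. g (f Z) = Z"
  shows "(\<exists>!K. P K \<and> x \<in> g K) \<longleftrightarrow> (\<exists>!Z. Q Z \<and> x \<in> Z)"
proof
  assume "\<exists>!K. P K \<and> x \<in> g K"
  then obtain K where K: "P K" "x \<in> g K" "\<And>K'. P K' \<Longrightarrow> x \<in> g K' \<Longrightarrow> K' = K" by blast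
  obtain Z where Z: "Q Z" "K = f Z" using K(1) assms(1)[of K] by blast
  show "\<exists>!Z. Q Z \<and> x \<in> Z"
  proof (rule ex1I[of _ Z])
    show "Q Z \<and> x \<in> Z" using Z(1) K(2) unfolding Z(2) assms(2) by blast
    fix Y assume Y: "Q Y \<and> x \<in> Y"
    then have "P (f Y)" using assms(1)[of "f Y"] by blast
    moreover have "x \<in> g (f Y)" using Y unfolding assms(2) by blast
    ultimately have "f Y = K" by (rule K(3))
    then have "g (f Y) = g (f Z)" unfolding Z(2) by (rule arg_cong)
    then show "Y = Z" unfolding assms(2) .
  qed
next
  assume "\<exists>!Z. Q Z \<and> x \<in> Z"
  then obtain Z where Z: "Q Z" "x \<in> Z" "\<And>Y. Q Y \<Longrightarrow> x \<in> Y \<Longrightarrow> Y = Z" by blast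
  show "\<exists>!K. P K \<and> x \<in> g K"
  proof (rule ex1I[of _ "f Z"])
    show "P (f Z) \<and> x \<in> g (f Z)" unfolding assms(2) using Z(1,2) assms(1)[of "f Z"] by blast
    fix K assume K: "P K \<and> x \<in> g K"
    then obtain Y where Y: "Q Y" "K = f Y" using assms(1)[of K] by blast
    have "x \<in> Y" using K unfolding Y(2) assms(2) by blast
    then show "K = f Z" using Z(3)[OF Y(1)] Y(2) by blast
  qed
qed

section \<open>Forbidden cycles, connectedness and simplices in terms of neighbourhoods\<close>

context weighted_oriented_graph
begin

lemma ucycle_4:
  assumes "b \<in> nbrs D a" "c \<in> nbrs D b" "d \<in> nbrs D c" "a \<in> nbrs D d" "a \<noteq> c" "b \<noteq> d"
  shows "ucycle D [(a, b), (b, c), (c, d), (d, a)]"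
  using assms G.E_V[OF assms(1)] G.E_irrefl by (auto simp: ucycle_def with_proj_cycle_iff)

lemma ucycle_5:
  assumes "b \<in> nbrs D a" "c \<in> nbrs D b" "d \<in> nbrs D c" "e \<in> nbrs D d" "a \<in> nbrs D e"
    "distinct [a, b, c, d, e]"
  shows "ucycle D [(a, b), (b, c), (c, d), (d, e), (e, a)]"
  using assms G.E_V[OF assms(1)] by (auto simp: ucycle_def with_proj_cycle_iff)

lemma sgraph45_nbrs:
  assumes "\<nexists>p. ucycle D p \<and> length p = 4" "\<nexists>p. ucycle D p \<and> length p = 5"
  shows "sgraph45 (pverts D) (\<lambda>x y. y \<in> nbrs D x)"
proof
  fix a b c d assume "b \<in> nbrs D a" "c \<in> nbrs D b" "d \<in> nbrs D c" "a \<in> nbrs D d" "a \<noteq> c" "b \<noteq> d"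
  from ucycle_4[OF this] assms(1) show False by force
next
  fix a b c d e assume "b \<in> nbrs D a" "c \<in> nbrs D b" "d \<in> nbrs D c" "e \<in> nbrs D d" "a \<in> nbrs D e"
    "distinct [a, b, c, d, e]"
  from ucycle_5[OF this] assms(2) show False by force
qed

lemma connected_closed:
  assumes conn: "Digraph_Component.connected (with_proj D)"
    and S: "S \<subseteq> pverts D" "S \<noteq> {}" "\<And>x y. x \<in> S \<Longrightarrow> y \<in> nbrs D x \<Longrightarrow> y \<in> S"
  shows "S = pverts D"
proof
  obtain s where s: "s \<in> S" "s \<in> pverts D" using S by blast
  show "pverts D \<subseteq> S"
  proof
    fix v assume "v \<in> pverts D"
    then have "(s, v) \<in> rtrancl_on (pverts D) (parcs (mk_symmetric (with_proj D)))"
      using conn s(2) unfolding connected_def strongly_connected_def reachable_def by simp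
    then show "v \<in> S"
    proof (induction rule: rtrancl_on_induct)
      case (step y z)
      then show ?case using S(3)[of y z] by simp
    qed (rule s)
  qed
qed (rule S)

lemma closed_nbrs_eq: "closed_nbrs D x = insert x (G.nb x)"
  by (simp add: closed_nbrs_def G.nb_def)

lemma simplicial_iff: "simplicial D x \<longleftrightarrow> G.simplicial_vertex x"
proof -
  let ?Z = "closed_nbrs D x"
  let ?M = "\<lparr>pverts = ?Z, parcs = {e \<in> parcs (mk_symmetric (with_proj D)). fst e \<in> ?Z \<and> snd e \<in> ?Z}\<rparr>"
  have ind: "induce_subgraph (with_proj (mk_symmetric (with_proj D))) ?Z = with_proj ?M"
    by (simp add: induce_subgraph_def with_proj_def)
  have fin: "finite ?Z" by (simp add: closed_nbrs_eq)
  have "(\<exists>n. complete_digraph n (with_proj ?M)) \<longleftrightarrow>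
      parcs ?M = {(u, v). (u, v) \<in> pverts ?M \<times> pverts ?M \<and> u \<noteq> v}"
    unfolding complete_digraph_pair_def using fin by simp
  also have "\<dots> \<longleftrightarrow> (\<forall>u v. u \<in> ?Z \<and> v \<in> ?Z \<and> v \<in> nbrs D u \<longleftrightarrow> u \<in> ?Z \<and> v \<in> ?Z \<and> u \<noteq> v)"
    by (auto simp: set_eq_iff)
  also have "\<dots> \<longleftrightarrow> (\<forall>u\<in>G.nb x. \<forall>v\<in>G.nb x. u \<noteq> v \<longrightarrow> v \<in> nbrs D u)"
  proof
    assume L: "\<forall>u v. u \<in> ?Z \<and> v \<in> ?Z \<and> v \<in> nbrs D u \<longleftrightarrow> u \<in> ?Z \<and> v \<in> ?Z \<and> u \<noteq> v"
    show "\<forall>u\<in>G.nb x. \<forall>v\<in>G.nb x. u \<noteq> v \<longrightarrow> v \<in> nbrs D u"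
    proof (intro ballI impI)
      fix u v assume "u \<in> G.nb x" "v \<in> G.nb x" "u \<noteq> v"
      then show "v \<in> nbrs D u" using L[rule_format, of u v] by (simp add: closed_nbrs_eq)
    qed
  next
    assume R: "\<forall>u\<in>G.nb x. \<forall>v\<in>G.nb x. u \<noteq> v \<longrightarrow> v \<in> nbrs D u"
    show "\<forall>u v. u \<in> ?Z \<and> v \<in> ?Z \<and> v \<in> nbrs D u \<longleftrightarrow> u \<in> ?Z \<and> v \<in> ?Z \<and> u \<noteq> v"
    proof (intro allI iffI)
      fix u v assume "u \<in> ?Z \<and> v \<in> ?Z \<and> v \<in> nbrs D u"
      then show "u \<in> ?Z \<and> v \<in> ?Z \<and> u \<noteq> v" using G.E_irrefl by auto
    next
      fix u v assume uv: "u \<in> ?Z \<and> v \<in> ?Z \<and> u \<noteq> v"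
      have "v \<in> nbrs D u"
      proof (cases "u = x \<or> v = x")
        case True
        then have "v \<in> nbrs D x \<and> u = x \<or> u \<in> nbrs D x \<and> v = x" using uv by (simp add: closed_nbrs_eq) blast
        then show ?thesis using nbrs_sym[of u D x] by blast
      next
        case False
        then have "u \<in> G.nb x" "v \<in> G.nb x" using uv unfolding closed_nbrs_eq by blast+
        then show ?thesis using uv R by blast
      qed
      then show "u \<in> ?Z \<and> v \<in> ?Z \<and> v \<in> nbrs D u" using uv by blast
    qed
  qed
  finally show ?thesis unfolding simplicial_def ind G.simplicial_vertex_def by simp
qed

definition simplex_set :: "'v set \<Rightarrow> bool" where
  "simplex_set Z \<longleftrightarrow> (\<exists>s. G.simplicial_vertex s \<and> Z = insert s (G.nb s))"

lemma simplex_set_verts: "simplex_set Z \<Longrightarrow> Z \<subseteq> pverts D"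
  using G.E_V2 by (auto simp: simplex_set_def G.simplicial_vertex_def)

lemma simplex_of_iff: "simplex_of D K \<longleftrightarrow> (\<exists>Z. simplex_set Z \<and> K = induced D Z)"
proof
  assume K: "simplex_of D K"
  then obtain s where s: "G.simplicial_vertex s" "pverts K = insert s (G.nb s)"
    unfolding simplex_of_def simplicial_iff closed_nbrs_eq by blast
  have "parcs K = {e \<in> parcs D. fst e \<in> pverts K \<and> snd e \<in> pverts K}"
    using K unfolding simplex_of_def induced_subgraph_def by simp
  then have "K = induced D (pverts K)" by (simp add: induced_def)
  then show "\<exists>Z. simplex_set Z \<and> K = induced D Z" using s unfolding simplex_set_def by blast
next
  assume "\<exists>Z. simplex_set Z \<and> K = induced D Z"
  then obtain Z where Z: "simplex_set Z" "K = induced D Z" by blast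
  have "subgraph (with_proj K) (with_proj D)"
    unfolding Z(2) induced_def using simplex_set_verts[OF Z(1)] by (intro subgraphI) auto
  then have "induced_subgraph (with_proj K) (with_proj D)"
    unfolding induced_subgraph_def Z(2) induced_def by simp
  moreover have "\<exists>s. simplicial D s \<and> pverts K = closed_nbrs D s"
    using Z unfolding simplex_set_def simplicial_iff closed_nbrs_eq by (auto simp: induced_def)
  ultimately show "simplex_of D K" by (simp add: simplex_of_def)
qed

lemma ex1_simplex_iff:
  "(\<exists>!K. simplex_of D K \<and> x \<in> pverts K) \<longleftrightarrow> (\<exists>!Z. simplex_set Z \<and> x \<in> Z)"
  by (rule ex1_image_iff[OF simplex_of_iff]) (simp add: induced_def)

lemma generating_forest_iff:
  "(\<exists>K H. simplex_of D K \<and> generating_star_semi_forest D w K H) \<longleftrightarrow> (\<exists>Z. simplex_set Z \<and> has_forest Z)"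
proof
  assume "\<exists>K H. simplex_of D K \<and> generating_star_semi_forest D w K H"
  then obtain K H where K: "simplex_of D K" "star_semi_forest D w H" "pverts H = pverts K"
    unfolding generating_star_semi_forest_def by (elim exE conjE) (rule that)
  obtain Z where Z: "simplex_set Z" "K = induced D Z" using K(1) unfolding simplex_of_iff by (elim exE conjE) (rule that)
  then have "has_forest Z" unfolding has_forest_def using K(2,3) by (auto simp: induced_def)
  then show "\<exists>Z. simplex_set Z \<and> has_forest Z" using Z(1) by (intro exI conjI)
next
  assume "\<exists>Z. simplex_set Z \<and> has_forest Z"
  then obtain Z H where Z: "simplex_set Z" "star_semi_forest D w H" "pverts H = Z"
    unfolding has_forest_def by (elim exE conjE) (rule that)
  have "simplex_of D (induced D Z)" unfolding simplex_of_iff by (rule exI[of _ Z], rule conjI[OF Z(1) refl])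
  moreover have "generating_star_semi_forest D w (induced D Z) H"
    unfolding generating_star_semi_forest_def using Z(2,3) by (simp add: induced_def)
  ultimately show "\<exists>K H. simplex_of D K \<and> generating_star_semi_forest D w K H" by (intro exI conjI)
qed

section \<open>Unmixedness in terms of strong covers\<close>

lemma strong_cover_complement_stable:
  assumes "strong_cover D w C"
  shows "G.stable (pverts D - C)"
  unfolding G.stable_def
proof (intro conjI ballI)
  fix x y assume "x \<in> pverts D - C" "y \<in> pverts D - C"
  then show "y \<notin> nbrs D x"
    using assms unfolding strong_cover_def nbrs_def out_nbrs_def in_nbrs_def by blast
qed blast

definition unmixed_covers :: bool where
  "unmixed_covers \<longleftrightarrow> (\<forall>C C'. strong_cover D w C \<longrightarrow> strong_cover D w C' \<longrightarrow> card C = card C')"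

lemma card_complement: "S \<subseteq> pverts D \<Longrightarrow> card (pverts D - S) = card (pverts D) - card S \<and> card S \<le> card (pverts D)"
  using pair_finite_verts by (simp add: card_Diff_subset card_mono finite_subset)

lemma unmixed_well_covered:
  assumes unmixed_covers
  shows "G.well_covered"
  unfolding G.well_covered_def
proof (intro allI impI)
  fix S T assume ST: "G.max_stable S" "G.max_stable T"
  then have sub: "S \<subseteq> pverts D" "T \<subseteq> pverts D" by (auto simp: G.max_stable_def G.stable_def)
  have "card (pverts D - S) = card (pverts D - T)"
    using assms max_stable_strong_cover ST unfolding unmixed_covers_def by blast
  then show "card S = card T" using card_complement[OF sub(1)] card_complement[OF sub(2)] by linarith
qed

text \<open>Otherwise \<open>x\<close> could be added to the stable complement of \<open>C\<close>,
  and the complement of a maximal stable extension would be a smaller strong cover.\<close>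

lemma unmixed_strong_cover_minimal:
  assumes u: unmixed_covers and C: "strong_cover D w C" and x: "x \<in> C"
  shows "\<not> nbrs D x \<subseteq> C"
proof
  assume nb: "nbrs D x \<subseteq> C"
  have CV: "C \<subseteq> pverts D" using C by (simp add: strong_cover_def)
  have st: "G.stable (insert x (pverts D - C))"
  proof (rule G.stable_insert[OF strong_cover_complement_stable[OF C]])
    show "x \<in> pverts D" using x CV by blast
    show "x \<notin> nbrs D z" if "z \<in> pverts D - C" for z using that nb nbrs_sym[of x D z] by blast
  qed
  have sub: "insert x (pverts D - C) \<subseteq> pverts D" using st unfolding G.stable_def by blast
  obtain M where M: "insert x (pverts D - C) \<subseteq> M" "M \<subseteq> pverts D" "G.stable M"
      "\<And>z. z \<in> pverts D \<Longrightarrow> z \<notin> M \<Longrightarrow> \<exists>y\<in>M. y \<in> nbrs D z"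
    by (rule G.stable_extend[OF st sub order_refl]) (rule that)
  have "G.max_stable M" unfolding G.max_stable_def using M(3,4) by blast
  then have "card (pverts D - M) = card C"
    using u C max_stable_strong_cover unfolding unmixed_covers_def by blast
  moreover have "pverts D - M \<subset> C" using M(1) x by blast
  moreover have "finite C" by (rule finite_subset[OF CV pair_finite_verts])
  ultimately show False using psubset_card_mono[of C "pverts D - M"] by linarith
qed

lemma not_unmixed_if_undominated:
  assumes u: unmixed_covers and xy: "(x, y) \<in> parcs D" "1 < w x" "out_nbrs D x \<inter> S = {}"
    and S: "S \<subseteq> pverts D" "G.stable S" and yS: "y \<notin> S" "nbrs D y \<inter> S = {}"
    and dom: "\<And>z. \<lbrakk>z \<in> pverts D; z \<notin> S; z \<noteq> y\<rbrakk> \<Longrightarrow> nbrs D z \<inter> S \<noteq> {}"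
  shows False
proof -
  note xV = arc_verts[OF xy(1)]
  have "strong_cover D w (pverts D - S)"
    unfolding strong_cover_def
  proof (intro conjI allI impI ballI)
    show "a \<in> pverts D - S \<or> b \<in> pverts D - S" if "(a, b) \<in> parcs D" for a b
      using S(2) nbrs_arc(1)[OF that] arc_verts[OF that] unfolding G.stable_def by blast
    fix z assume z: "z \<in> pverts D - S" "nbrs D z \<subseteq> pverts D - S"
    then have "z = y" using dom by blast
    moreover have "x \<in> pverts D - S" using yS(2) nbrs_arc(2)[OF xy(1)] xV by blast
    moreover have "out_nbrs D x \<subseteq> pverts D - S" using xy(3) arc_verts by (auto simp: out_nbrs_def)
    ultimately show "\<exists>a\<in>pverts D - S. (a, z) \<in> parcs D \<and> 1 < w a \<and> out_nbrs D a \<subseteq> pverts D - S"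
      using xy by blast
  qed blast
  from unmixed_strong_cover_minimal[OF u this, of y] yS xV(2) G.E_V2[of _ y] show False by blast
qed

text \<open>A sink is nobody's in-neighbour, so no vertex of a strong cover has all its neighbours
  in the cover.\<close>

lemma sinks_strong_cover_max_stable:
  assumes sinks: "\<forall>x\<in>V_plus D w. is_sink D x" and C: "strong_cover D w C"
  shows "G.max_stable (pverts D - C)"
  unfolding G.max_stable_def
proof (intro conjI ballI strong_cover_complement_stable C)
  fix x assume x: "x \<in> pverts D - (pverts D - C)"
  have "\<not> nbrs D x \<subseteq> C"
  proof
    assume "nbrs D x \<subseteq> C"
    then obtain y where y: "(y, x) \<in> parcs D" "1 < w y" using C x unfolding strong_cover_def by blast
    then have "is_sink D y" using sinks arc_verts by (auto simp: V_plus_def)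
    then show False using y(1) by (auto simp: is_sink_def out_nbrs_def)
  qed
  then show "\<exists>y\<in>pverts D - C. y \<in> nbrs D x" using G.E_V2 by blast
qed

lemma unmixed_if_sinks:
  assumes sinks: "\<forall>x\<in>V_plus D w. is_sink D x" and wc: "G.well_covered"
  shows unmixed_covers
  unfolding unmixed_covers_def
proof (intro allI impI)
  fix C C' assume C: "strong_cover D w C" "strong_cover D w C'"
  then have sub: "C \<subseteq> pverts D" "C' \<subseteq> pverts D" by (auto simp: strong_cover_def)
  have "card (pverts D - C) = card (pverts D - C')"
    using wc sinks_strong_cover_max_stable[OF sinks] C unfolding G.well_covered_def by blast
  then show "card C = card C'" using card_complement[OF sub(1)] card_complement[OF sub(2)] by linarith
qed

text \<open>A strong cover around the forest contains the closed neighbourhood of a simplicial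
  vertex and is therefore not minimal.\<close>

lemma unmixed_no_forest:
  assumes u: unmixed_covers and Z: "simplex_set Z"
  shows "\<not> has_forest Z"
proof
  assume "has_forest Z"
  then obtain C where C: "strong_cover D w C" "Z \<subseteq> C"
    using forest_strong_cover unfolding has_forest_def by blast
  obtain s where "Z = insert s (G.nb s)" using Z by (auto simp: simplex_set_def)
  then have "s \<in> C" "nbrs D s \<subseteq> C" using C(2) by (auto simp: G.nb_def)
  then show False using unmixed_strong_cover_minimal[OF u C(1)] by blast
qed

text \<open>Four vertices of a simplex would carry a 4-cycle.\<close>

lemma simplex_set_le_3:
  assumes "sgraph45 (pverts D) (\<lambda>x y. y \<in> nbrs D x)" "simplex_set Z"
  shows "\<exists>a b c. Z = {a, b, c}"
proof -
  interpret H: sgraph45 "pverts D" "\<lambda>x y. y \<in> nbrs D x" by (rule assms(1))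
  obtain s where s: "G.simplicial_vertex s" "Z = insert s (G.nb s)"
    using assms(2) by (auto simp: simplex_set_def)
  show ?thesis
  proof (cases "\<exists>b. b \<in> G.nb s")
    case False
    then have "Z = {s, s, s}" using s(2) by auto
    then show ?thesis by blast
  next
    case True
    then obtain b where b: "b \<in> G.nb s" by blast
    show ?thesis
    proof (cases "\<exists>c. c \<in> G.nb s \<and> c \<noteq> b")
      case False
      then have "Z = {s, b, b}" using s(2) b by blast
      then show ?thesis by blast
    next
      case True
      then obtain c where c: "c \<in> G.nb s" "c \<noteq> b" by blast
      have "d = b \<or> d = c" if d: "d \<in> G.nb s" for d
      proof (rule ccontr)
        assume n: "\<not> (d = b \<or> d = c)"
        have adj: "v \<in> nbrs D u" if "u \<in> G.nb s" "v \<in> G.nb s" "u \<noteq> v" for u v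
          using s(1) that unfolding G.simplicial_vertex_def by blast
        have 1: "b \<in> nbrs D s" "s \<in> nbrs D d" "c \<noteq> s" using b d c nbrs_sym G.E_irrefl by auto
        show False
          by (rule H.no_C4[OF 1(1) adj[OF b c(1)] adj[OF c(1) d] 1(2)]) (use n c(2) 1(3) in auto)
      qed
      then have "Z = {s, b, c}" using s(2) b c by blast
      then show ?thesis by blast
    qed
  qed
qed

text \<open>The stable complement of a strong cover meets each simplex at most once. It meets each
  simplex, since a simplex inside the cover would have a forest. So its size is the number of
  simplices.\<close>

lemma unmixed_if_simplices:
  assumes g: "sgraph45 (pverts D) (\<lambda>x y. y \<in> nbrs D x)"
    and one: "\<forall>x\<in>pverts D. \<exists>!Z. simplex_set Z \<and> x \<in> Z" and nf: "\<nexists>Z. simplex_set Z \<and> has_forest Z"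
  shows unmixed_covers
proof -
  have card: "card (pverts D - C) = card {Z. simplex_set Z}" if C: "strong_cover D w C" for C
  proof -
    let ?f = "\<lambda>x. THE Z. simplex_set Z \<and> x \<in> Z"
    have f: "simplex_set (?f x) \<and> x \<in> ?f x" if "x \<in> pverts D" for x
      by (rule theI') (use one that in blast)
    have fu: "?f x = Z" if "simplex_set Z" "x \<in> Z" for x Z
    proof -
      have "x \<in> pverts D" using simplex_set_verts that by blast
      then show ?thesis using f[of x] one that by blast
    qed
    have "bij_betw ?f (pverts D - C) {Z. simplex_set Z}"
    proof (rule bij_betwI')
      fix x y assume xy: "x \<in> pverts D - C" "y \<in> pverts D - C"
      show "?f x = ?f y \<longleftrightarrow> x = y"
      proof
        assume eq: "?f x = ?f y"
        have fx: "simplex_set (?f x)" "x \<in> ?f x" "y \<in> ?f x" using f[of x] f[of y] xy eq by auto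
        then obtain s where s: "G.simplicial_vertex s" "?f x = insert s (G.nb s)"
          by (auto simp: simplex_set_def)
        show "x = y"
        proof (rule ccontr)
          assume "x \<noteq> y"
          have "y \<in> nbrs D x"
          proof (cases "x = s \<or> y = s")
            case True
          then have "y \<in> nbrs D s \<and> x = s \<or> x \<in> nbrs D s \<and> y = s"
            using fx(2,3) \<open>x \<noteq> y\<close> unfolding s(2) G.nb_def by blast
          then show ?thesis using nbrs_sym[of x D s] by blast
          next
            case False
            then have "x \<in> G.nb s" "y \<in> G.nb s" using fx s(2) by blast+
            then show ?thesis using s(1) \<open>x \<noteq> y\<close> unfolding G.simplicial_vertex_def by blast
          qed
          then show False using strong_cover_complement_stable[OF C] xy unfolding G.stable_def by blast
        qed
      qed simp
    next
      fix x assume "x \<in> pverts D - C" then show "?f x \<in> {Z. simplex_set Z}" using f by blast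
    next
      fix Z assume "Z \<in> {Z. simplex_set Z}"
      then have Z: "simplex_set Z" by blast
      have "\<not> Z \<subseteq> C"
      proof
        assume "Z \<subseteq> C"
        obtain a b c where "Z = {a, b, c}" using simplex_set_le_3[OF g Z] by blast
        from strong_cover_has_forest[OF C \<open>Z \<subseteq> C\<close> this] show False using nf Z by blast
      qed
      then obtain x where x: "x \<in> Z" "x \<notin> C" by blast
      then have "x \<in> pverts D - C" using simplex_set_verts[OF Z] by blast
      then show "\<exists>x\<in>pverts D - C. Z = ?f x" using fu[OF Z x(1)] by blast
    qed
    then show ?thesis by (rule bij_betw_same_card)
  qed
  show ?thesis
    unfolding unmixed_covers_def
  proof (intro allI impI)
    fix C C' assume C: "strong_cover D w C" "strong_cover D w C'"
    then have sub: "C \<subseteq> pverts D" "C' \<subseteq> pverts D" by (auto simp: strong_cover_def)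
    then show "card C = card C'"
      using card[OF C(1)] card[OF C(2)] card_complement[OF sub(1)] card_complement[OF sub(2)] by linarith
  qed
qed

end

section \<open>Maximal stable sets and symmetries of C_7 and T_10\<close>

context sgraph
begin

text \<open>A vertex belongs to a maximal stable set exactly when no neighbour does; this turns the
  sizes of such sets into truth tables.\<close>

lemma max_stable_iff:
  assumes "max_stable S" "x \<in> V"
  shows "nb x = {a, b} \<Longrightarrow> x \<in> S \<longleftrightarrow> a \<notin> S \<and> b \<notin> S"
    and "nb x = {a, b, c} \<Longrightarrow> x \<in> S \<longleftrightarrow> a \<notin> S \<and> b \<notin> S \<and> c \<notin> S"
proof -
  have "x \<in> S \<longleftrightarrow> (\<forall>y\<in>nb x. y \<notin> S)"
    using assms unfolding max_stable_def stable_def nb_def by blast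
  then show "nb x = {a, b} \<Longrightarrow> x \<in> S \<longleftrightarrow> a \<notin> S \<and> b \<notin> S"
    "nb x = {a, b, c} \<Longrightarrow> x \<in> S \<longleftrightarrow> a \<notin> S \<and> b \<notin> S \<and> c \<notin> S"
    by simp_all
qed

lemma C7_count:
  "\<forall>A B C D E F G :: bool. (A \<longleftrightarrow> \<not> G \<and> \<not> B) \<and> (B \<longleftrightarrow> \<not> A \<and> \<not> C) \<and> (C \<longleftrightarrow> \<not> B \<and> \<not> D) \<and> (D \<longleftrightarrow> \<not> C \<and> \<not> E) \<and>
    (E \<longleftrightarrow> \<not> D \<and> \<not> F) \<and> (F \<longleftrightarrow> \<not> E \<and> \<not> G) \<and> (G \<longleftrightarrow> \<not> F \<and> \<not> A) \<longrightarrow>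
    of_bool A + (of_bool B + (of_bool C + (of_bool D + (of_bool E + (of_bool F + of_bool G))))) = (3::nat)"
  unfolding all_bool_eq by simp

text \<open>The truth values belong to the centre, the three \<open>a\<close> and the three
  \<open>c\<close>. Each \<open>b\<close> is replaced by the condition that its two neighbours are
  absent, which leaves seven truth values instead of ten.\<close>

lemma T10_count:
  "\<forall>v a b c x y z :: bool. (v \<longleftrightarrow> \<not> a \<and> \<not> b \<and> \<not> c) \<and> (a \<longleftrightarrow> \<not> v \<and> \<not> (\<not> a \<and> \<not> x)) \<and>
    (b \<longleftrightarrow> \<not> v \<and> \<not> (\<not> b \<and> \<not> y)) \<and> (c \<longleftrightarrow> \<not> v \<and> \<not> (\<not> c \<and> \<not> z)) \<and>
    (x \<longleftrightarrow> \<not> (\<not> a \<and> \<not> x) \<and> \<not> y \<and> \<not> z) \<and> (y \<longleftrightarrow> \<not> (\<not> b \<and> \<not> y) \<and> \<not> x \<and> \<not> z) \<and>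
    (z \<longleftrightarrow> \<not> (\<not> c \<and> \<not> z) \<and> \<not> x \<and> \<not> y) \<longrightarrow>
    of_bool v + (of_bool a + (of_bool b + (of_bool c + (of_bool (\<not> a \<and> \<not> x) + (of_bool (\<not> b \<and> \<not> y) +
      (of_bool (\<not> c \<and> \<not> z) + (of_bool x + (of_bool y + of_bool z)))))))) = (4::nat)"
  unfolding all_bool_eq by simp

lemma card_insert_Int: "finite A \<Longrightarrow> x \<notin> A \<Longrightarrow> card (insert x A \<inter> S) = of_bool (x \<in> S) + card (A \<inter> S)"
  by simp

lemma C7_at_well_covered:
  assumes C: "C7_at v y t r s u z" and V: "V = {v, y, t, r, s, u, z}"
  shows well_covered
proof -
  have "card S = 3" if S: "max_stable S" for S
  proof -
    have d: "distinct [v, y, t, r, s, u, z]" using C by (simp add: C7_at_def)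
    have nb: "nb v = {z, y}" "nb y = {v, t}" "nb t = {y, r}" "nb r = {t, s}" "nb s = {r, u}" "nb u = {s, z}"
      "nb z = {u, v}" using C unfolding C7_at_def by - (elim conjE, assumption)+
    have V': "v \<in> V" "y \<in> V" "t \<in> V" "r \<in> V" "s \<in> V" "u \<in> V" "z \<in> V" unfolding V by blast+
    note N = max_stable_iff(1)[OF S V'(1) nb(1)] max_stable_iff(1)[OF S V'(2) nb(2)]
      max_stable_iff(1)[OF S V'(3) nb(3)] max_stable_iff(1)[OF S V'(4) nb(4)] max_stable_iff(1)[OF S V'(5) nb(5)]
      max_stable_iff(1)[OF S V'(6) nb(6)] max_stable_iff(1)[OF S V'(7) nb(7)]
    have "S = V \<inter> S" using S unfolding max_stable_def stable_def by blast
    then have "card S = card ({v, y, t, r, s, u, z} \<inter> S)" unfolding V by simp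
    also have "\<dots> = of_bool (v \<in> S) + (of_bool (y \<in> S) + (of_bool (t \<in> S) + (of_bool (r \<in> S) +
        (of_bool (s \<in> S) + (of_bool (u \<in> S) + of_bool (z \<in> S))))))"
      using d by (simp add: card_insert_Int del: Int_insert_left_if0 Int_insert_left_if1)
    also have "\<dots> = 3" by (rule C7_count[rule_format]) (intro conjI N)
    finally show ?thesis .
  qed
  then show ?thesis unfolding well_covered_def by simp
qed

lemma T10_at_well_covered:
  assumes C: "T10_at v a1 a2 a3 b1 b2 b3 c1 c2 c3" and V: "V = {v, a1, a2, a3, b1, b2, b3, c1, c2, c3}"
  shows well_covered
proof -
  have "card S = 4" if S: "max_stable S" for S
  proof -
    have d: "distinct [v, a1, a2, a3, b1, b2, b3, c1, c2, c3]" using C by (simp add: T10_at_def)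
    have nb: "nb v = {a1, a2, a3}" "nb a1 = {v, b1}" "nb a2 = {v, b2}" "nb a3 = {v, b3}"
      "nb b1 = {a1, c1}" "nb b2 = {a2, c2}" "nb b3 = {a3, c3}"
      "nb c1 = {b1, c2, c3}" "nb c2 = {b2, c1, c3}" "nb c3 = {b3, c1, c2}"
      using C unfolding T10_at_def by - (elim conjE, assumption)+
    have V': "v \<in> V" "a1 \<in> V" "a2 \<in> V" "a3 \<in> V" "b1 \<in> V" "b2 \<in> V" "b3 \<in> V" "c1 \<in> V" "c2 \<in> V" "c3 \<in> V"
      unfolding V by blast+
    note B = max_stable_iff(1)[OF S V'(5) nb(5)] max_stable_iff(1)[OF S V'(6) nb(6)]
      max_stable_iff(1)[OF S V'(7) nb(7)]
    note N = max_stable_iff(2)[OF S V'(1) nb(1)] max_stable_iff(1)[OF S V'(2) nb(2), unfolded B]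
      max_stable_iff(1)[OF S V'(3) nb(3), unfolded B] max_stable_iff(1)[OF S V'(4) nb(4), unfolded B]
      max_stable_iff(2)[OF S V'(8) nb(8), unfolded B] max_stable_iff(2)[OF S V'(9) nb(9), unfolded B]
      max_stable_iff(2)[OF S V'(10) nb(10), unfolded B]
    have "S = V \<inter> S" using S unfolding max_stable_def stable_def by blast
    then have "card S = card ({v, a1, a2, a3, b1, b2, b3, c1, c2, c3} \<inter> S)" unfolding V by simp
    also have "\<dots> = of_bool (v \<in> S) + (of_bool (a1 \<in> S) + (of_bool (a2 \<in> S) + (of_bool (a3 \<in> S) +
        (of_bool (b1 \<in> S) + (of_bool (b2 \<in> S) + (of_bool (b3 \<in> S) + (of_bool (c1 \<in> S) +
        (of_bool (c2 \<in> S) + of_bool (c3 \<in> S)))))))))"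
      using d by (simp add: card_insert_Int del: Int_insert_left_if0 Int_insert_left_if1)
    also have "\<dots> = 4" unfolding B by (rule T10_count[rule_format]) (intro conjI N)
    finally show ?thesis .
  qed
  then show ?thesis unfolding well_covered_def by simp
qed

lemma C7_at_rotate: "C7_at v y t r s u z \<Longrightarrow> C7_at y t r s u z v"
  unfolding C7_at_def by (simp add: insert_commute) metis

lemma C7_at_reflect: "C7_at v y t r s u z \<Longrightarrow> C7_at t y v z u s r"
  unfolding C7_at_def by (simp add: insert_commute) metis

lemma C7_at_centre:
  assumes "C7_at v y t r s u z" "V = {v, y, t, r, s, u, z}" "x \<in> V"
  shows "\<exists>v t r s u z. C7_at v x t r s u z \<and> V = {v, x, t, r, s, u, z}"
proof -
  have step: "\<exists>v t r s u z. C7_at v x t r s u z \<and> V = {v, x, t, r, s, u, z}"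
    if "C7_at v x t r s u z" "V = {v, x, t, r, s, u, z}" for v t r s u z
    using that by (intro exI conjI)
  note C1 = C7_at_rotate[OF assms(1)]
  note C2 = C7_at_rotate[OF C1]
  note C3 = C7_at_rotate[OF C2]
  note C4 = C7_at_rotate[OF C3]
  note C5 = C7_at_rotate[OF C4]
  note C6 = C7_at_rotate[OF C5]
  consider "x = v" | "x = y" | "x = t" | "x = r" | "x = s" | "x = u" | "x = z" using assms(2,3) by blast
  then show ?thesis
  proof cases
    case 1 show ?thesis by (rule step[of z y t r s u]) (use C6 assms(2) 1 in auto)
  next
    case 2 show ?thesis by (rule step[of v t r s u z]) (use assms 2 in auto)
  next
    case 3 show ?thesis by (rule step[of y r s u z v]) (use C1 assms(2) 3 in auto)
  next
    case 4 show ?thesis by (rule step[of t s u z v y]) (use C2 assms(2) 4 in auto)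
  next
    case 5 show ?thesis by (rule step[of r u z v y t]) (use C3 assms(2) 5 in auto)
  next
    case 6 show ?thesis by (rule step[of s z v y t r]) (use C4 assms(2) 6 in auto)
  next
    case 7 show ?thesis by (rule step[of u v y t r s]) (use C5 assms(2) 7 in auto)
  qed
qed

text \<open>Rotations bring \<open>x\<close> into second place, and the reflection fixing
  \<open>x\<close> puts \<open>a\<close> and \<open>b\<close> in the right order.\<close>

lemma C7_at_path:
  assumes "C7_at v y t r s u z" "V = {v, y, t, r, s, u, z}" and ab: "E a x" "E x b" "a \<noteq> b"
  shows "\<exists>r s u z. C7_at a x b r s u z \<and> V = {a, x, b, r, s, u, z}"
proof -
  obtain v t r s u z where C: "C7_at v x t r s u z" "V = {v, x, t, r, s, u, z}"
    using C7_at_centre[OF assms(1,2) E_V2[OF ab(1)]] by (elim exE conjE) (rule that)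
  have "a \<in> nb x" "b \<in> nb x" using ab E_sym by auto
  then consider "a = v" "b = t" | "a = t" "b = v" using C(1) ab(3) unfolding C7_at_def by auto
  then show ?thesis
  proof cases
    case 1 then show ?thesis using C by (intro exI conjI) auto
  next
    case 2
    have "V = {t, x, v, z, u, s, r}" using C(2) by blast
    then show ?thesis using C7_at_reflect[OF C(1)] 2 by (intro exI conjI) auto
  qed
qed

definition T10_spans :: "'a \<Rightarrow> 'a \<Rightarrow> 'a \<Rightarrow> 'a \<Rightarrow> 'a \<Rightarrow> 'a \<Rightarrow> 'a \<Rightarrow> 'a \<Rightarrow> 'a \<Rightarrow> 'a \<Rightarrow> bool" where
  "T10_spans v a1 a2 a3 b1 b2 b3 c1 c2 c3 \<longleftrightarrow> T10_at v a1 a2 a3 b1 b2 b3 c1 c2 c3 \<and>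
    V = {v, a1, a2, a3, b1, b2, b3, c1, c2, c3}"

text \<open>These two transpositions generate all permutations of the three branches.\<close>

lemma T10_spans_swap:
  "T10_spans v a1 a2 a3 b1 b2 b3 c1 c2 c3 \<Longrightarrow> T10_spans v a2 a1 a3 b2 b1 b3 c2 c1 c3"
  "T10_spans v a1 a2 a3 b1 b2 b3 c1 c2 c3 \<Longrightarrow> T10_spans v a1 a3 a2 b1 b3 b2 c1 c3 c2"
  unfolding T10_spans_def T10_at_def by (simp_all add: insert_commute) metis+

end

section \<open>Oriented paths through a vertex of weight above 1\<close>

context weighted_oriented_graph
begin

lemma nb_eq_nbrs: "G.nb x = nbrs D x"
  by (simp add: G.nb_def)

lemma out_nbrs_asym: "(a, x) \<in> parcs D \<Longrightarrow> a \<notin> out_nbrs D x"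
  using oriented by (simp add: out_nbrs_def)

lemma out_nbrs_sub: "out_nbrs D x \<subseteq> nbrs D x"
  by (simp add: nbrs_def)

text \<open>The stable set \<open>{v, s}\<close> dominates every vertex except \<open>t\<close>, the
  end of the path, and \<open>v\<close> is not an out-neighbour of \<open>x\<close> because its arc
  points to \<open>x\<close>.\<close>

lemma C7_at_no_path:
  assumes u: unmixed_covers and C: "G.C7_at v x t r s p z" "pverts D = {v, x, t, r, s, p, z}"
    and arcs: "(v, x) \<in> parcs D" "(x, t) \<in> parcs D" "1 < w x"
  shows False
proof (rule not_unmixed_if_undominated[OF u arcs(2,3), of "{v, s}"])
  show "out_nbrs D x \<inter> {v, s} = {}"
    using out_nbrs_asym[OF arcs(1)] out_nbrs_sub[of x] C(1) unfolding G.C7_at_def nb_eq_nbrs by auto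
  show "G.stable {v, s}"
    using C unfolding G.C7_at_def nb_eq_nbrs G.stable_def by auto
qed (use C in \<open>auto simp: G.C7_at_def nb_eq_nbrs\<close>)

text \<open>For each path a stable set is given that dominates everything except the end of the path
  and meets the neighbourhood of the middle vertex at most in the start.\<close>

lemma T10_no_path:
  assumes u: unmixed_covers and C: "G.T10_spans v a1 a2 a3 b1 b2 b3 c1 c2 c3"
  shows "(b1, a1) \<in> parcs D \<Longrightarrow> (a1, v) \<in> parcs D \<Longrightarrow> 1 < w a1 \<Longrightarrow> False"
    and "(a2, v) \<in> parcs D \<Longrightarrow> (v, a1) \<in> parcs D \<Longrightarrow> 1 < w v \<Longrightarrow> False"
    and "(c1, b1) \<in> parcs D \<Longrightarrow> (b1, a1) \<in> parcs D \<Longrightarrow> 1 < w b1 \<Longrightarrow> False"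
    and "(v, a1) \<in> parcs D \<Longrightarrow> (a1, b1) \<in> parcs D \<Longrightarrow> 1 < w a1 \<Longrightarrow> False"
    and "(c2, c1) \<in> parcs D \<Longrightarrow> (c1, b1) \<in> parcs D \<Longrightarrow> 1 < w c1 \<Longrightarrow> False"
    and "(a1, b1) \<in> parcs D \<Longrightarrow> (b1, c1) \<in> parcs D \<Longrightarrow> 1 < w b1 \<Longrightarrow> False"
    and "(b2, c2) \<in> parcs D \<Longrightarrow> (c2, c1) \<in> parcs D \<Longrightarrow> 1 < w c2 \<Longrightarrow> False"
proof -
  have d: "distinct [v, a1, a2, a3, b1, b2, b3, c1, c2, c3]"
    and N: "nbrs D v = {a1, a2, a3}" "nbrs D a1 = {v, b1}" "nbrs D a2 = {v, b2}" "nbrs D a3 = {v, b3}"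
      "nbrs D b1 = {a1, c1}" "nbrs D b2 = {a2, c2}" "nbrs D b3 = {a3, c3}"
      "nbrs D c1 = {b1, c2, c3}" "nbrs D c2 = {b2, c1, c3}" "nbrs D c3 = {b3, c1, c2}"
    and V: "pverts D = {v, a1, a2, a3, b1, b2, b3, c1, c2, c3}"
    using C unfolding G.T10_spans_def G.T10_at_def nb_eq_nbrs by simp_all
  \<comment> \<open>These sets leave undominated exactly \<open>v\<close>, \<open>a1\<close>,
    \<open>b1\<close> and \<open>c1\<close>, in this order.\<close>
  have st: "G.stable {b1, b2, b3}" "G.stable {a2, c1, b3}" "G.stable {v, c2, b3}" "G.stable {a1, b2, b3}"
    unfolding G.stable_def using d by (auto simp: V N)
  have S: "False" if "(q, x) \<in> parcs D" "(x, y) \<in> parcs D" "1 < w x" "G.stable S" "nbrs D x \<inter> S \<subseteq> {q}"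
      "y \<notin> S" "nbrs D y \<inter> S = {}" "\<forall>z\<in>pverts D. z \<notin> S \<and> z \<noteq> y \<longrightarrow> nbrs D z \<inter> S \<noteq> {}" for q x y S
  proof (rule not_unmixed_if_undominated[OF u that(2,3) _ _ that(4,6,7)])
    show "out_nbrs D x \<inter> S = {}" using out_nbrs_asym[OF that(1)] out_nbrs_sub[of x] that(5) by blast
    show "S \<subseteq> pverts D" using that(4) unfolding G.stable_def by blast
    show "nbrs D z \<inter> S \<noteq> {}" if "z \<in> pverts D" "z \<notin> S" "z \<noteq> y" for z
      using that \<open>\<forall>z\<in>pverts D. z \<notin> S \<and> z \<noteq> y \<longrightarrow> nbrs D z \<inter> S \<noteq> {}\<close> by blast
  qed
  show False if "(b1, a1) \<in> parcs D" "(a1, v) \<in> parcs D" "1 < w a1"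
    by (rule S[OF that st(1)]) (use d in \<open>auto simp: V N\<close>)
  show False if "(a2, v) \<in> parcs D" "(v, a1) \<in> parcs D" "1 < w v"
    by (rule S[OF that st(2)]) (use d in \<open>auto simp: V N\<close>)
  show False if "(c1, b1) \<in> parcs D" "(b1, a1) \<in> parcs D" "1 < w b1"
    by (rule S[OF that st(2)]) (use d in \<open>auto simp: V N\<close>)
  show False if "(v, a1) \<in> parcs D" "(a1, b1) \<in> parcs D" "1 < w a1"
    by (rule S[OF that st(3)]) (use d in \<open>auto simp: V N\<close>)
  show False if "(c2, c1) \<in> parcs D" "(c1, b1) \<in> parcs D" "1 < w c1"
    by (rule S[OF that st(3)]) (use d in \<open>auto simp: V N\<close>)
  show False if "(a1, b1) \<in> parcs D" "(b1, c1) \<in> parcs D" "1 < w b1"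
    by (rule S[OF that st(4)]) (use d in \<open>auto simp: V N\<close>)
  show False if "(b2, c2) \<in> parcs D" "(c2, c1) \<in> parcs D" "1 < w c2"
    by (rule S[OF that st(4)]) (use d in \<open>auto simp: V N\<close>)
qed

lemma T10_no_path_through:
  assumes u: unmixed_covers and C: "G.T10_spans v a1 a2 a3 b1 b2 b3 c1 c2 c3"
    and path: "(p, x) \<in> parcs D" "(x, q) \<in> parcs D" "1 < w x" and x: "x \<in> {v, a1, b1, c1}"
  shows False
proof -
  note C213 = G.T10_spans_swap(1)[OF C]
  note C132 = G.T10_spans_swap(2)[OF C]
  note C312 = G.T10_spans_swap(1)[OF C132]
  note C231 = G.T10_spans_swap(2)[OF C213]
  note C321 = G.T10_spans_swap(2)[OF C312]
  note K = T10_no_path[OF u C]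
  have N: "nbrs D v = {a1, a2, a3}" "nbrs D a1 = {v, b1}" "nbrs D b1 = {a1, c1}" "nbrs D c1 = {b1, c2, c3}"
    using C unfolding G.T10_spans_def G.T10_at_def nb_eq_nbrs by simp_all
  have pq: "p \<in> nbrs D x" "q \<in> nbrs D x" "p \<noteq> q"
    using nbrs_arc(2)[OF path(1)] nbrs_arc(1)[OF path(2)] path(2) oriented[OF path(1)] by auto
  consider "x = v" | "x = a1" | "x = b1" | "x = c1" using x by blast
  then show False
  proof cases
    case 1
    then have "p = a1 \<or> p = a2 \<or> p = a3" "q = a1 \<or> q = a2 \<or> q = a3" using pq N by auto
    then show False
      using path pq(3) K(2) T10_no_path(2)[OF u C213] T10_no_path(2)[OF u C132] T10_no_path(2)[OF u C312]
        T10_no_path(2)[OF u C231] T10_no_path(2)[OF u C321] unfolding 1 by blast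
  next
    case 2
    then have "p = v \<and> q = b1 \<or> p = b1 \<and> q = v" using pq N by auto
    then show False using path K(1,4) unfolding 2 by blast
  next
    case 3
    then have "p = a1 \<and> q = c1 \<or> p = c1 \<and> q = a1" using pq N by auto
    then show False using path K(3,6) unfolding 3 by blast
  next
    case 4
    then have pq': "p = b1 \<or> p = c2 \<or> p = c3" "q = b1 \<or> q = c2 \<or> q = c3" using pq N by auto
    \<comment> \<open>A path through \<open>c1\<close> inside the triangle is not excluded directly.
      Either orientation of the edge between \<open>b1\<close> and \<open>c1\<close> yields, with
      one of its arcs, an excluded path with the same middle vertex.\<close>
    have "(b1, c1) \<in> parcs D \<or> (c1, b1) \<in> parcs D"
      using N(4) unfolding nbrs_def out_nbrs_def in_nbrs_def by blast
    then show False
      using path pq(3) pq' K(5) T10_no_path(5)[OF u C132] T10_no_path(7)[OF u C213] T10_no_path(7)[OF u C312]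
        T10_no_path(7)[OF u C231] unfolding 4 by blast
  qed
qed

lemma C7_sinks:
  assumes u: unmixed_covers and C: "G.C7_at v y t r s p z" "pverts D = {v, y, t, r, s, p, z}"
    and path: "(a, x) \<in> parcs D" "(x, b) \<in> parcs D" "1 < w x"
  shows False
proof -
  have "a \<noteq> b" using path(2) oriented[OF path(1)] by auto
  from G.C7_at_path[OF C nbrs_arc(1)[OF path(1)] nbrs_arc(1)[OF path(2)] this]
  obtain r s p z where "G.C7_at a x b r s p z" "pverts D = {a, x, b, r, s, p, z}"
    by (elim exE conjE) (rule that)
  from C7_at_no_path[OF u this path] show False .
qed

lemma T10_sinks:
  assumes u: unmixed_covers and C: "G.T10_spans v a1 a2 a3 b1 b2 b3 c1 c2 c3"
    and path: "(p, x) \<in> parcs D" "(x, q) \<in> parcs D" "1 < w x"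
  shows False
proof -
  note C213 = G.T10_spans_swap(1)[OF C]
  note C312 = G.T10_spans_swap(1)[OF G.T10_spans_swap(2)[OF C]]
  have "x \<in> {v, a1, b1, c1} \<or> x \<in> {v, a2, b2, c2} \<or> x \<in> {v, a3, b3, c3}"
    using C arc_verts(1)[OF path(2)] unfolding G.T10_spans_def by blast
  then show False
    using T10_no_path_through[OF u C path] T10_no_path_through[OF u C213 path]
      T10_no_path_through[OF u C312 path] by blast
qed

text \<open>A vertex of weight above 1 is not a source, so if it were not a sink it would be the
  middle vertex of a path.\<close>

lemma V_plus_sinks_if_no_path:
  assumes "\<And>a x b. (a, x) \<in> parcs D \<Longrightarrow> (x, b) \<in> parcs D \<Longrightarrow> 1 < w x \<Longrightarrow> False"
  shows "\<forall>x\<in>V_plus D w. is_sink D x"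
proof
  fix x assume "x \<in> V_plus D w"
  then have x: "x \<in> pverts D" "1 < w x" by (auto simp: V_plus_def)
  then obtain a where "(a, x) \<in> parcs D" using source_weight[OF x(1)] by fastforce
  then show "is_sink D x" using assms x(2) unfolding is_sink_def out_nbrs_def by blast
qed

text \<open>Arcs are pairs, so the arc map of an isomorphism is forced by the vertex map. What
  remains is a bijection of the vertices that carries neighbourhoods to neighbourhoods.\<close>

lemma underlying_iso_iff:
  assumes H: "parcs H \<subseteq> pverts H \<times> pverts H"
  shows "underlying_iso D (mk_symmetric (with_proj H)) \<longleftrightarrow>
    (\<exists>g. bij_betw g (pverts H) (pverts D) \<and> (\<forall>i\<in>pverts H. nbrs D (g i) = g ` nbrs H i))"
    (is "?L \<longleftrightarrow> ?R")
proof
  assume ?L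
  then obtain f where f: "pre_digraph.digraph_isomorphism (with_proj (mk_symmetric (with_proj D))) f"
    and eq: "with_proj (mk_symmetric (with_proj H)) = app_iso f (with_proj (mk_symmetric (with_proj D)))"
    unfolding underlying_iso_def digraph_iso_def by blast
  let ?h = "iso_verts f"
  have inj: "inj_on ?h (pverts D)" using f by (simp add: pre_digraph.digraph_isomorphism_def)
  have verts: "pverts H = ?h ` pverts D" using arg_cong[OF eq, of verts] by simp
  have ends: "iso_tail f = fst" "iso_head f = snd" using arg_cong[OF eq, of tail] arg_cong[OF eq, of head] by simp_all
  have arc: "iso_arcs f (x, y) = (?h x, ?h y)" if "y \<in> nbrs D x" for x y
  proof -
    have "(x, y) \<in> arcs (with_proj (mk_symmetric (with_proj D)))" using that by simp
    then have "?h (fst (x, y)) = fst (iso_arcs f (x, y))" "?h (snd (x, y)) = snd (iso_arcs f (x, y))"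
      using f unfolding pre_digraph.digraph_isomorphism_def ends with_proj_simps by blast+
    then show ?thesis by (simp add: prod_eq_iff)
  qed
  have arcs: "parcs (mk_symmetric (with_proj H)) = iso_arcs f ` parcs (mk_symmetric (with_proj D))"
    using arg_cong[OF eq, of arcs] by simp
  have nbH: "nbrs H (?h x) = ?h ` nbrs D x" if x: "x \<in> pverts D" for x
  proof (intro equalityI subsetI)
    fix j assume "j \<in> nbrs H (?h x)"
    then have "(?h x, j) \<in> iso_arcs f ` parcs (mk_symmetric (with_proj D))" unfolding arcs[symmetric] by simp
    then obtain a b where ab: "b \<in> nbrs D a" "(?h x, j) = iso_arcs f (a, b)" by auto
    then have "?h x = ?h a" "j = ?h b" using arc[OF ab(1)] by simp_all
    moreover have "a \<in> pverts D" using G.E_V ab(1) by blast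
    ultimately show "j \<in> ?h ` nbrs D x" using inj_onD[OF inj _ x] ab(1) by blast
  next
    fix j assume "j \<in> ?h ` nbrs D x"
    then obtain b where b: "b \<in> nbrs D x" "j = ?h b" by blast
    then have "(?h x, j) \<in> iso_arcs f ` parcs (mk_symmetric (with_proj D))"
      using arc[OF b(1)] by (intro image_eqI[of _ _ "(x, b)"]) simp_all
    then show "j \<in> nbrs H (?h x)" unfolding arcs[symmetric] by simp
  qed
  let ?g = "the_inv_into (pverts D) ?h"
  have g: "?g (?h x) = x" if "x \<in> pverts D" for x by (rule the_inv_into_f_f[OF inj that])
  have "bij_betw ?g (pverts H) (pverts D)"
    unfolding verts by (rule bij_betw_the_inv_into) (simp add: bij_betw_def inj)
  moreover have "nbrs D (?g i) = ?g ` nbrs H i" if i: "i \<in> pverts H" for i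
  proof -
    obtain x where x: "x \<in> pverts D" "i = ?h x" using i unfolding verts by blast
    have "?g ` ?h ` nbrs D x = (\<lambda>y. y) ` nbrs D x"
      unfolding image_image by (rule image_cong[OF refl]) (use g G.E_V2 in auto)
    then show ?thesis unfolding x(2) g[OF x(1)] nbH[OF x(1)] by simp
  qed
  ultimately show ?R by blast
next
  assume ?R
  then obtain g where bij: "bij_betw g (pverts H) (pverts D)"
    and nb: "\<And>i. i \<in> pverts H \<Longrightarrow> nbrs D (g i) = g ` nbrs H i" by blast
  have inj: "inj_on g (pverts H)" using bij by (simp add: bij_betw_def)
  have verts: "pverts D = g ` pverts H" using bij by (simp add: bij_betw_def)
  let ?h = "the_inv_into (pverts H) g"
  have h: "?h (g i) = i" if "i \<in> pverts H" for i by (rule the_inv_into_f_f[OF inj that])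
  have nbV: "j \<in> pverts H" if "j \<in> nbrs H i" for i j
    using that H unfolding nbrs_def out_nbrs_def in_nbrs_def by blast
  have injh: "inj_on ?h (pverts D)"
    using bij_betw_the_inv_into[OF bij] by (simp add: bij_betw_def)
  have arcs_sub: "parcs (mk_symmetric (with_proj D)) \<subseteq> pverts D \<times> pverts D"
  proof
    fix e assume "e \<in> parcs (mk_symmetric (with_proj D))"
    then show "e \<in> pverts D \<times> pverts D" using G.E_V G.E_V2 by (cases e) auto
  qed
  have arcs: "parcs (mk_symmetric (with_proj H)) = map_prod ?h ?h ` parcs (mk_symmetric (with_proj D))"
  proof (intro equalityI subsetI)
    fix e assume e: "e \<in> parcs (mk_symmetric (with_proj H))"
    obtain i j where ij: "e = (i, j)" by (cases e)
    then have j: "j \<in> nbrs H i" using e by simp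
    note V = nbV[OF nbrs_sym[OF j]] nbV[OF j]
    have "g j \<in> nbrs D (g i)" unfolding nb[OF V(1)] using j by blast
    then have "(g i, g j) \<in> parcs (mk_symmetric (with_proj D))" by simp
    moreover have "e = map_prod ?h ?h (g i, g j)" using h V ij by simp
    ultimately show "e \<in> map_prod ?h ?h ` parcs (mk_symmetric (with_proj D))" by blast
  next
    fix e assume "e \<in> map_prod ?h ?h ` parcs (mk_symmetric (with_proj D))"
    then obtain x y where xy: "y \<in> nbrs D x" "e = (?h x, ?h y)" by auto
    have "x \<in> pverts D" by (rule G.E_V[OF xy(1)])
    then obtain i where i: "i \<in> pverts H" "x = g i" unfolding verts by blast
    obtain j where j: "j \<in> nbrs H i" "y = g j" using xy(1) unfolding i(2) nb[OF i(1)] by blast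
    then show "e \<in> parcs (mk_symmetric (with_proj H))" using xy(2) i h nbV by simp
  qed
  have hverts: "?h ` pverts D = pverts H"
    using bij_betw_the_inv_into[OF bij] by (simp add: bij_betw_def)
  let ?f = "\<lparr>iso_verts = ?h, iso_arcs = map_prod ?h ?h, iso_head = snd, iso_tail = fst\<rparr>"
  have "wf_digraph (with_proj (mk_symmetric (with_proj D)))"
    unfolding wf_digraph_with_proj_iff using G.E_V G.E_V2 by auto
  moreover have "inj_on (map_prod ?h ?h) (parcs (mk_symmetric (with_proj D)))"
    by (rule inj_on_subset[OF map_prod_inj_on[OF injh injh] arcs_sub])
  ultimately have "pre_digraph.digraph_isomorphism (with_proj (mk_symmetric (with_proj D))) ?f"
    unfolding pre_digraph.digraph_isomorphism_def using injh by auto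
  moreover have "with_proj (mk_symmetric (with_proj H)) = app_iso ?f (with_proj (mk_symmetric (with_proj D)))"
    using arcs hverts by (simp add: app_iso_def with_proj_def)
  ultimately show ?L unfolding underlying_iso_def digraph_iso_def by blast
qed

lemma underlying_iso_C7:
  "underlying_iso D C7 \<longleftrightarrow>
    (\<exists>v y t r s u z. G.C7_at v y t r s u z \<and> pverts D = {v, y, t, r, s, u, z})"
proof -
  define H :: "nat pair_pre_digraph" where "H = \<lparr>pverts = {0..<7}, parcs = {(i, (i + 1) mod 7) | i. i < 7}\<rparr>"
  have arcs: "parcs H = {(0, 1), (1, 2), (2, 3), (3, 4), (4, 5), (5, 6), (6, 0)}"
  proof -
    have "parcs H = (\<lambda>i. (i, (i + 1) mod 7)) ` {..<7}" by (auto simp: H_def)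
    also have "{..<7::nat} = {0, 1, 2, 3, 4, 5, 6}" by auto
    finally show ?thesis by (simp add: numeral_2_eq_2)
  qed
  have V: "pverts H = {0, 1, 2, 3, 4, 5, 6}" unfolding H_def by auto
  have nbH: "nbrs H 0 = {6, 1}" "nbrs H 1 = {0, 2}" "nbrs H 2 = {1, 3}" "nbrs H 3 = {2, 4}"
    "nbrs H 4 = {3, 5}" "nbrs H 5 = {4, 6}" "nbrs H 6 = {5, 0}"
    unfolding nbrs_def out_nbrs_def in_nbrs_def arcs by auto
  have "parcs H \<subseteq> pverts H \<times> pverts H" unfolding V arcs by simp
  from underlying_iso_iff[OF this]
  have iso: "underlying_iso D C7 \<longleftrightarrow>
      (\<exists>g. bij_betw g (pverts H) (pverts D) \<and> (\<forall>i\<in>pverts H. nbrs D (g i) = g ` nbrs H i))"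
    unfolding C7_def H_def .
  show ?thesis
    unfolding iso
  proof
    assume "\<exists>g. bij_betw g (pverts H) (pverts D) \<and> (\<forall>i\<in>pverts H. nbrs D (g i) = g ` nbrs H i)"
    then obtain g where g: "bij_betw g (pverts H) (pverts D)" "\<forall>i\<in>pverts H. nbrs D (g i) = g ` nbrs H i"
      by blast
    have "distinct (map g [0, 1, 2, 3, 4, 5, 6])"
      using g(1) unfolding distinct_map bij_betw_def V by simp
    then have "G.C7_at (g 0) (g 1) (g 2) (g 3) (g 4) (g 5) (g 6)"
      using g(2) unfolding G.C7_at_def nb_eq_nbrs V by (simp add: nbH del: One_nat_def)
    moreover have "pverts D = {g 0, g 1, g 2, g 3, g 4, g 5, g 6}"
      using g(1) unfolding bij_betw_def V by simp
    ultimately show "\<exists>v y t r s u z. G.C7_at v y t r s u z \<and> pverts D = {v, y, t, r, s, u, z}"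
      by (intro exI conjI)
  next
    assume "\<exists>v y t r s u z. G.C7_at v y t r s u z \<and> pverts D = {v, y, t, r, s, u, z}"
    then obtain v y t r s u z where C: "G.C7_at v y t r s u z" "pverts D = {v, y, t, r, s, u, z}"
      by (elim exE conjE) (rule that)
    let ?g = "\<lambda>i::nat. [v, y, t, r, s, u, z] ! i"
    have "bij_betw ?g (pverts H) (pverts D)"
      by (rule bij_betw_nth) (use C in \<open>auto simp: G.C7_at_def H_def\<close>)
    moreover have "\<forall>i\<in>pverts H. nbrs D (?g i) = ?g ` nbrs H i"
      using C(1) unfolding V G.C7_at_def nb_eq_nbrs by (simp add: nbH del: One_nat_def)
    ultimately show "\<exists>g. bij_betw g (pverts H) (pverts D) \<and> (\<forall>i\<in>pverts H. nbrs D (g i) = g ` nbrs H i)"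
      by (intro exI conjI)
  qed
qed

lemma underlying_iso_T10:
  "underlying_iso D T10 \<longleftrightarrow> (\<exists>v a1 a2 a3 b1 b2 b3 c1 c2 c3. G.T10_spans v a1 a2 a3 b1 b2 b3 c1 c2 c3)"
proof -
  define H :: "T10_vertex pair_pre_digraph" where
    "H = \<lparr>pverts = {T10_v} \<union> T10_a ` {1, 2, 3} \<union> T10_b ` {1, 2, 3} \<union> T10_c ` {1, 2, 3},
      parcs = {(T10_v, T10_a i) | i. i \<in> {1, 2, 3}} \<union> {(T10_a i, T10_b i) | i. i \<in> {1, 2, 3}}
        \<union> {(T10_b i, T10_c i) | i. i \<in> {1, 2, 3}}
        \<union> {(T10_c 1, T10_c 2), (T10_c 2, T10_c 3), (T10_c 1, T10_c 3)}\<rparr>"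
  have arcs: "parcs H = {(T10_v, T10_a 1), (T10_v, T10_a 2), (T10_v, T10_a 3), (T10_a 1, T10_b 1),
      (T10_a 2, T10_b 2), (T10_a 3, T10_b 3), (T10_b 1, T10_c 1), (T10_b 2, T10_c 2), (T10_b 3, T10_c 3),
      (T10_c 1, T10_c 2), (T10_c 2, T10_c 3), (T10_c 1, T10_c 3)}"
    by (auto simp: H_def)
  have V: "pverts H = {T10_v, T10_a 1, T10_a 2, T10_a 3, T10_b 1, T10_b 2, T10_b 3, T10_c 1, T10_c 2, T10_c 3}"
    by (auto simp: H_def)
  have nbH: "nbrs H T10_v = {T10_a 1, T10_a 2, T10_a 3}"
    "nbrs H (T10_a 1) = {T10_v, T10_b 1}" "nbrs H (T10_a 2) = {T10_v, T10_b 2}" "nbrs H (T10_a 3) = {T10_v, T10_b 3}"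
    "nbrs H (T10_b 1) = {T10_a 1, T10_c 1}" "nbrs H (T10_b 2) = {T10_a 2, T10_c 2}" "nbrs H (T10_b 3) = {T10_a 3, T10_c 3}"
    "nbrs H (T10_c 1) = {T10_b 1, T10_c 2, T10_c 3}" "nbrs H (T10_c 2) = {T10_b 2, T10_c 1, T10_c 3}"
    "nbrs H (T10_c 3) = {T10_b 3, T10_c 1, T10_c 2}"
    unfolding nbrs_def out_nbrs_def in_nbrs_def arcs by auto
  have "parcs H \<subseteq> pverts H \<times> pverts H" unfolding V arcs by simp
  from underlying_iso_iff[OF this]
  have iso: "underlying_iso D T10 \<longleftrightarrow>
      (\<exists>g. bij_betw g (pverts H) (pverts D) \<and> (\<forall>i\<in>pverts H. nbrs D (g i) = g ` nbrs H i))"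
    unfolding T10_def H_def .
  show ?thesis
    unfolding iso
  proof
    assume "\<exists>g. bij_betw g (pverts H) (pverts D) \<and> (\<forall>i\<in>pverts H. nbrs D (g i) = g ` nbrs H i)"
    then obtain g where g: "bij_betw g (pverts H) (pverts D)" "\<forall>i\<in>pverts H. nbrs D (g i) = g ` nbrs H i"
      by blast
    have "distinct (map g [T10_v, T10_a 1, T10_a 2, T10_a 3, T10_b 1, T10_b 2, T10_b 3, T10_c 1, T10_c 2, T10_c 3])"
      using g(1) unfolding distinct_map bij_betw_def V by simp
    then have "G.T10_at (g T10_v) (g (T10_a 1)) (g (T10_a 2)) (g (T10_a 3)) (g (T10_b 1)) (g (T10_b 2))
        (g (T10_b 3)) (g (T10_c 1)) (g (T10_c 2)) (g (T10_c 3))"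
      using g(2) unfolding G.T10_at_def nb_eq_nbrs V by (simp add: nbH del: One_nat_def)
    moreover have "pverts D = {g T10_v, g (T10_a 1), g (T10_a 2), g (T10_a 3), g (T10_b 1), g (T10_b 2),
        g (T10_b 3), g (T10_c 1), g (T10_c 2), g (T10_c 3)}"
      using g(1) unfolding bij_betw_def V by simp
    ultimately show "\<exists>v a1 a2 a3 b1 b2 b3 c1 c2 c3. G.T10_spans v a1 a2 a3 b1 b2 b3 c1 c2 c3"
      unfolding G.T10_spans_def by (intro exI conjI)
  next
    assume "\<exists>v a1 a2 a3 b1 b2 b3 c1 c2 c3. G.T10_spans v a1 a2 a3 b1 b2 b3 c1 c2 c3"
    then obtain v a1 a2 a3 b1 b2 b3 c1 c2 c3 where C: "G.T10_at v a1 a2 a3 b1 b2 b3 c1 c2 c3"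
        "pverts D = {v, a1, a2, a3, b1, b2, b3, c1, c2, c3}"
      unfolding G.T10_spans_def by (elim exE conjE) (rule that)
    let ?n = "\<lambda>x y z i. if i = (1::nat) then x else if i = 2 then y else z"
    let ?g = "case_T10_vertex v (?n a1 a2 a3) (?n b1 b2 b3) (?n c1 c2 c3)"
    have "distinct (map ?g [T10_v, T10_a 1, T10_a 2, T10_a 3, T10_b 1, T10_b 2, T10_b 3, T10_c 1, T10_c 2, T10_c 3])"
      using C(1) unfolding G.T10_at_def by simp
    then have "inj_on ?g (pverts H)" unfolding distinct_map V by simp
    moreover have "?g ` pverts H = pverts D" unfolding V C(2) by simp
    ultimately have "bij_betw ?g (pverts H) (pverts D)" unfolding bij_betw_def by (intro conjI)
    moreover have "\<forall>i\<in>pverts H. nbrs D (?g i) = ?g ` nbrs H i"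
      using C(1) unfolding V G.T10_at_def nb_eq_nbrs by (simp add: nbH del: One_nat_def)
    ultimately show "\<exists>g. bij_betw g (pverts H) (pverts D) \<and> (\<forall>i\<in>pverts H. nbrs D (g i) = g ` nbrs H i)"
      by (intro exI conjI)
  qed
qed

end

theorem theorem5p10:
  fixes D :: "'v pair_pre_digraph" and w :: "'v \<Rightarrow> nat"
  assumes "weighted_oriented_graph D w"
    and "Digraph_Component.connected (with_proj D)"
    and "\<nexists>p. ucycle D p \<and> length p = 4"
    and "\<nexists>p. ucycle D p \<and> length p = 5"
  shows "unmixed_ideal (mvpoly_ring (pverts D)) (edge_ideal D w :: ('v, 'k::field) mvpoly set) \<longleftrightarrow>
      ((underlying_iso D C7 \<or> underlying_iso D T10) \<and> (\<forall>x\<in>V_plus D w. is_sink D x)) \<or>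
      ((\<forall>x\<in>pverts D. \<exists>!K. simplex_of D K \<and> x \<in> pverts K) \<and>
       (\<nexists>K H. simplex_of D K \<and> generating_star_semi_forest D w K H))"
    (is "_ \<longleftrightarrow> ?a \<or> ?b")
proof -
  interpret weighted_oriented_graph D w by (rule assms(1))
  note g45 = sgraph45_nbrs[OF assms(3,4)]
  interpret H: sgraph45 "pverts D" "\<lambda>x y. y \<in> nbrs D x" by (rule g45)
  \<comment> \<open>Both sides are compared with the condition on strong covers, in which the field
    does not occur.\<close>
  have "unmixed_covers \<longleftrightarrow> ?a \<or> ?b"
  proof
    assume u: unmixed_covers
    have closed: "S = pverts D" if "S \<subseteq> pverts D" "S \<noteq> {}" "\<And>x y. x \<in> S \<Longrightarrow> y \<in> nbrs D x \<Longrightarrow> y \<in> S" for S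
      by (rule connected_closed[OF assms(2) that])
    have "(\<forall>x\<in>pverts D. G.in_simplex x) \<or>
        (\<exists>v y t r s u z. G.C7_at v y t r s u z \<and> pverts D = {v, y, t, r, s, u, z}) \<or>
        (\<exists>v a1 a2 a3 b1 b2 b3 c1 c2 c3. G.T10_at v a1 a2 a3 b1 b2 b3 c1 c2 c3 \<and>
          pverts D = {v, a1, a2, a3, b1, b2, b3, c1, c2, c3})"
      by (rule H.well_covered_classification[OF unmixed_well_covered[OF u]]) (rule closed)
    then show "?a \<or> ?b"
    proof (elim disjE)
      assume 1: "\<forall>x\<in>pverts D. G.in_simplex x"
      have "\<exists>!Z. simplex_set Z \<and> x \<in> Z" if x: "x \<in> pverts D" for x
      proof -
        have "\<exists>Z. simplex_set Z \<and> x \<in> Z"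
          using 1 x unfolding G.in_simplex_def simplex_set_def by blast
        moreover have "Z = Z'" if "simplex_set Z" "x \<in> Z" "simplex_set Z'" "x \<in> Z'" for Z Z'
          using that G.simplices_agree[OF unmixed_well_covered[OF u]] unfolding simplex_set_def
          by (elim exE conjE) blast
        ultimately show ?thesis by (elim exE, intro ex1I) blast+
      qed
      then have "\<forall>x\<in>pverts D. \<exists>!K. simplex_of D K \<and> x \<in> pverts K" unfolding ex1_simplex_iff by blast
      moreover have "\<nexists>K H. simplex_of D K \<and> generating_star_semi_forest D w K H"
        unfolding generating_forest_iff using unmixed_no_forest[OF u] by blast
      ultimately show ?thesis by (intro disjI2 conjI)
    next
      assume 2: "\<exists>v y t r s u z. G.C7_at v y t r s u z \<and> pverts D = {v, y, t, r, s, u, z}"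
      then have "underlying_iso D C7" unfolding underlying_iso_C7 .
      moreover obtain v y t r s p z where C: "G.C7_at v y t r s p z" "pverts D = {v, y, t, r, s, p, z}"
        using 2 by (elim exE conjE) (rule that)
      have "\<forall>x\<in>V_plus D w. is_sink D x" by (rule V_plus_sinks_if_no_path) (rule C7_sinks[OF u C])
      ultimately show ?thesis by (intro disjI1 conjI)
    next
      assume "\<exists>v a1 a2 a3 b1 b2 b3 c1 c2 c3. G.T10_at v a1 a2 a3 b1 b2 b3 c1 c2 c3 \<and>
        pverts D = {v, a1, a2, a3, b1, b2, b3, c1, c2, c3}"
      then have T: "\<exists>v a1 a2 a3 b1 b2 b3 c1 c2 c3. G.T10_spans v a1 a2 a3 b1 b2 b3 c1 c2 c3"
        unfolding G.T10_spans_def .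
      then have "underlying_iso D T10" unfolding underlying_iso_T10 .
      moreover obtain v a1 a2 a3 b1 b2 b3 c1 c2 c3 where C: "G.T10_spans v a1 a2 a3 b1 b2 b3 c1 c2 c3"
        using T by (elim exE) (rule that)
      have "\<forall>x\<in>V_plus D w. is_sink D x" by (rule V_plus_sinks_if_no_path) (rule T10_sinks[OF u C])
      ultimately show ?thesis by (intro disjI1 conjI disjI2)
    qed
  next
    assume "?a \<or> ?b"
    then show unmixed_covers
    proof
      assume a: ?a
      have "G.well_covered"
      proof (cases "underlying_iso D C7")
        case True
        then show ?thesis unfolding underlying_iso_C7 by (elim exE conjE) (rule G.C7_at_well_covered)
      next
        case False
        then have "underlying_iso D T10" using a by blast
        then show ?thesis
          unfolding underlying_iso_T10 G.T10_spans_def by (elim exE conjE) (rule G.T10_at_well_covered)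
      qed
      then show ?thesis using a unmixed_if_sinks by blast
    next
      assume ?b
      then show ?thesis
        unfolding ex1_simplex_iff generating_forest_iff by (elim conjE) (rule unmixed_if_simplices[OF g45])
    qed
  qed
  then show ?thesis unfolding unmixed_iff_strong_covers unmixed_covers_def .
qed

end
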